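(* Let $n\ge 1$ and let $SN=\{\pm v_1,\dots,\pm v_n\}$. The following assignments, where $\delta_j\in\{1,-1\}$, define an action of the inverse braid monoid of type $B$, $IB(B_n)$, on $SN$ by partial bijections: $$\sigma_i(\delta_j v_j)=\begin{cases}\delta_i v_{i+1}, & j=i,\\ \delta_{i+1}v_i, & j=i+1,\\ \delta_j v_j, & j\neq i,i+1,\end{cases}\qquad (1\le i\le n-1),$$ $$\tau(\delta_j v_j)=\begin{cases}-\delta_1v_1, & j=1,\\ \delta_jv_j, & j\ne 1,\end{cases}$$ $$\operatorname{dom}\epsilon_i=\{\pm v_j : j\neq i\},\qquad \epsilon_i(\delta_jv_j)=\delta_jv_j\ \text{ for } j\ne i\qquad (1\le i\le n),$$ with $\epsilon=\epsilon_1$. This action defines a homomorphism of inverse monoids $\rho_B: IB(B_n)\to I(B_n)$ such that the diagram $$\begin{array}{ccc} Br(B_n)&\longrightarrow& W(B_n)\\ \downarrow&&\downarrow\\ IB(B_n)&\stackrel{\rho_B}{\longrightarrow}& I(B_n)\end{array}$$ is commutative, where the vertical arrows are the inclusions of the groups of invertible elements into the monoids and the top arrow is the canonical epimorphism from the braid group of type $B_n$ onto the Weyl group of type $B_n$.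
   Context: A monoid $M$ is inverse if for every $a\in M$ there is a unique $b\in M$ with $a=aba$ and $b=bab$. Signed permutations: $SN=\{\pm v_1,\dots,\pm v_n\}$ has $2n$ elements. $W(B_n)$ is the group of bijections $\sigma$ of $SN$ with $(-x)\sigma=-(x)\sigma$ for all $x\in SN$. $I(B_n)$ is the monoid of partial bijections $\sigma$ of $SN$ (bijections between subsets of $SN$) such that $x\in\operatorname{dom}\sigma$ if and only if $-x\in\operatorname{dom}\sigma$, and $(-x)\sigma=-(x)\sigma$ for $x\in\operatorname{dom}\sigma$. The product is composition of partial maps; a product $ab$ means first $a$, then $b$. Partial braids: fix $m$ collinear points in the plane. A partial braid on $m$ strings is an isotopy class (fixing endpoints) of systems of $k$ disjoint arcs in $\mathbb R^2\times[0,1]$, $0\le k\le m$, monotone in the last coordinate, joining $k$ of the $m$ points in the upper plane bijectively to $k$ of the $m$ points in the lower plane. The product is obtained by stacking, then removing every arc that does not join the upper plane to the lower plane. This gives the inverse braid monoid $IB_m$. Its group of units is the Artin braid group $Br_m$. $IB(B_n)$ (also denoted $IBB_n$), the inverse braid monoid of type $B$, is the submonoid of $IB_{n+1}$ consisting of the partial braids in which the first string is present and joins the first upper point to the first lower point. Number the $n+1$ points $0,1,\dots,n$, with $0$ the fixed first one. Its group of units is the braid group $Br(B_n)$ of type $B_n$, with generators $\sigma_i$ ($1\le i\le n-1$), the Artin half-twist exchanging points $i$ and $i+1$, and $\tau$, the square of the Artin half-twist on the points $0$ and $1$. These satisfy the defining relations $\tau\sigma_1\tau\sigma_1=\sigma_1\tau\sigma_1\tau$;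 $\tau\sigma_i=\sigma_i\tau$ for $i>1$; $\sigma_i\sigma_{i+1}\sigma_i=\sigma_{i+1}\sigma_i\sigma_{i+1}$; $\sigma_i\sigma_j=\sigma_j\sigma_i$ for $|i-j|>1$. For $1\le i\le n$, $\epsilon_i\in IB(B_n)$ is the trivial braid with string $i$ deleted, and $\epsilon=\epsilon_1$. The monoid $IB(B_n)$ is generated by $\sigma_i^{\pm1}$, $\tau^{\pm1}$ and $\epsilon$. The canonical epimorphism $Br(B_n)\to W(B_n)$ sends $\sigma_i$ to the signed permutation exchanging $v_i$ and $v_{i+1}$ (and $-v_i$ and $-v_{i+1}$) and fixing the other elements, and sends $\tau$ to the signed permutation exchanging $v_1$ and $-v_1$ and fixing the other elements. *)

theory Defs
  imports "HOL-Analysis.Analysis" "HOL-Algebra.Group"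
begin

section \<open>Inverse monoids\<close>

definition inverse_monoid :: "('a, 'c) monoid_scheme \<Rightarrow> bool" where
  "inverse_monoid M \<longleftrightarrow> monoid M \<and>
     (\<forall>a\<in>carrier M. \<exists>!b. b \<in> carrier M \<and>
        a = a \<otimes>\<^bsub>M\<^esub> b \<otimes>\<^bsub>M\<^esub> a \<and> b = b \<otimes>\<^bsub>M\<^esub> a \<otimes>\<^bsub>M\<^esub> b)"

definition gen_inv :: "('a, 'c) monoid_scheme \<Rightarrow> 'a \<Rightarrow> 'a" where
  "gen_inv M a = (THE b. b \<in> carrier M \<and>
     a = a \<otimes>\<^bsub>M\<^esub> b \<otimes>\<^bsub>M\<^esub> a \<and> b = b \<otimes>\<^bsub>M\<^esub> a \<otimes>\<^bsub>M\<^esub> b)"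

definition inverse_monoid_hom ::
    "('a, 'c) monoid_scheme \<Rightarrow> ('b, 'd) monoid_scheme \<Rightarrow> ('a \<Rightarrow> 'b) \<Rightarrow> bool" where
  "inverse_monoid_hom M N h \<longleftrightarrow>
     inverse_monoid M \<and> inverse_monoid N \<and> h \<in> hom M N \<and> h \<one>\<^bsub>M\<^esub> = \<one>\<^bsub>N\<^esub> \<and>
     (\<forall>a\<in>carrier M. h (gen_inv M a) = gen_inv N (h a))"

section \<open>Signed partial permutations\<close>

text \<open>The element \<open>v\<^sub>i\<close> is encoded by the integer \<open>i\<close> and \<open>-v\<^sub>i\<close> by \<open>-i\<close>; thus
  \<open>\<delta> v\<^sub>j\<close> with a sign \<open>\<delta>\<close> is the integer \<open>\<delta> * j\<close>.\<close>

definition SN :: "nat \<Rightarrow> int set" where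
  "SN n = {x. x \<noteq> 0 \<and> \<bar>x\<bar> \<le> int n}"

text \<open>Products are read from left to right: in \<open>a \<otimes> b\<close> the map \<open>a\<close> is applied first.\<close>

definition I_B :: "nat \<Rightarrow> (int \<rightharpoonup> int) monoid" where
  "I_B n = \<lparr>
     carrier = {s. dom s \<subseteq> SN n \<and> ran s \<subseteq> SN n \<and> inj_on s (dom s) \<and>
                   (\<forall>x. x \<in> dom s \<longleftrightarrow> - x \<in> dom s) \<and>
                   (\<forall>x\<in>dom s. the (s (- x)) = - the (s x))},
     mult = (\<lambda>a b. b \<circ>\<^sub>m a),
     one = (\<lambda>x. if x \<in> SN n then Some x else None)\<rparr>"

definition W_B :: "nat \<Rightarrow> (int \<rightharpoonup> int) monoid" where
  "W_B n = (I_B n)\<lparr>carrier := {s \<in> carrier (I_B n). dom s = SN n \<and> ran s = SN n}\<rparr>"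

text \<open>In the following maps a point \<open>x = \<delta> v\<^sub>j\<close> has \<open>\<delta> = sgn x\<close> and \<open>j = \<bar>x\<bar>\<close>.\<close>

definition sigma_map :: "nat \<Rightarrow> nat \<Rightarrow> int \<rightharpoonup> int" where
  "sigma_map n i = (\<lambda>x. if x \<in> SN n then
      Some (sgn x * (if \<bar>x\<bar> = int i then int (i + 1)
                     else if \<bar>x\<bar> = int (i + 1) then int i
                     else \<bar>x\<bar>)) else None)"

definition tau_map :: "nat \<Rightarrow> int \<rightharpoonup> int" where
  "tau_map n = (\<lambda>x. if x \<in> SN n then Some (if \<bar>x\<bar> = 1 then - x else x) else None)"

definition epsilon_map :: "nat \<Rightarrow> nat \<Rightarrow> int \<rightharpoonup> int" where
  "epsilon_map n i = (\<lambda>x. if x \<in> SN n \<and> \<bar>x\<bar> \<noteq> int i then Some x else None)"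

section \<open>Partial braids\<close>

text \<open>The plane is \<open>\<complex>\<close> and the \<open>m\<close> marked points are \<open>0, 1, \<dots>, m - 1\<close>. An arc monotone in the
  last coordinate is the graph \<open>{(g t, t)}\<close> of a path \<open>g\<close> in the plane, with the upper plane at
  \<open>t = 0\<close> and the lower plane at \<open>t = 1\<close>. A system of arcs assigns to the index of each upper
  point the arc starting there, if there is one; arcs are disjoint iff the paths differ at every
  time.\<close>

type_synonym arcs = "nat \<rightharpoonup> (real \<Rightarrow> complex)"

definition arc_system :: "nat \<Rightarrow> arcs \<Rightarrow> bool" where
  "arc_system m b \<longleftrightarrow> dom b \<subseteq> {..<m} \<and>
     (\<forall>i g. b i = Some g \<longrightarrow>
        path g \<and> pathstart g = of_nat i \<and> pathfinish g \<in> of_nat ` {..<m}) \<and>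
     (\<forall>i j f g. b i = Some f \<longrightarrow> b j = Some g \<longrightarrow> i \<noteq> j \<longrightarrow> (\<forall>t\<in>{0..1}. f t \<noteq> g t))"

text \<open>\<open>H s i\<close> is the arc at the upper point \<open>i\<close> at stage \<open>s\<close> of the isotopy.\<close>

definition isotopic :: "nat \<Rightarrow> arcs \<Rightarrow> arcs \<Rightarrow> bool" where
  "isotopic m a b \<longleftrightarrow> dom a = dom b \<and>
     (\<exists>H :: real \<Rightarrow> nat \<Rightarrow> real \<Rightarrow> complex.
        (\<forall>i\<in>dom a. continuous_on ({0..1} \<times> {0..1}) (\<lambda>(s, t). H s i t)) \<and>
        (\<forall>s\<in>{0..1}. arc_system m (\<lambda>i. if i \<in> dom a then Some (H s i) else None)) \<and>
        (\<forall>s\<in>{0..1}. \<forall>i\<in>dom a. pathfinish (H s i) = pathfinish (the (a i))) \<and>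
        (\<forall>i\<in>dom a. \<forall>t\<in>{0..1}. H 0 i t = the (a i) t \<and> H 1 i t = the (b i) t))"

definition isotopy_rel :: "nat \<Rightarrow> arcs rel" where
  "isotopy_rel m = {(a, b). arc_system m a \<and> arc_system m b \<and> isotopic m a b}"

definition end_index :: "(real \<Rightarrow> complex) \<Rightarrow> nat" where
  "end_index g = (THE j. pathfinish g = of_nat j)"

text \<open>An arc of \<open>a\<close> ending at a point where no arc of \<open>b\<close> starts is removed, as is an arc of \<open>b\<close>
  at whose starting point no arc of \<open>a\<close> ends.\<close>

definition stack :: "arcs \<Rightarrow> arcs \<Rightarrow> arcs" where
  "stack a b = (\<lambda>i. case a i of None \<Rightarrow> None
      | Some f \<Rightarrow> (case b (end_index f) of None \<Rightarrow> None | Some g \<Rightarrow> Some (f +++ g)))"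

definition trivial_arcs :: "nat set \<Rightarrow> arcs" where
  "trivial_arcs A = (\<lambda>i. if i \<in> A then Some (\<lambda>t. of_nat i) else None)"

definition IB :: "nat \<Rightarrow> arcs set monoid" where
  "IB m = \<lparr>
     carrier = {b. arc_system m b} // isotopy_rel m,
     mult = (\<lambda>X Y. \<Union>a\<in>X. \<Union>b\<in>Y. isotopy_rel m `` {stack a b}),
     one = isotopy_rel m `` {trivial_arcs {..<m}}\<rparr>"

text \<open>The points \<open>i\<close> and \<open>i + 1\<close> rotate by half a turn about their midpoint.\<close>

definition half_twist_arcs :: "nat \<Rightarrow> nat \<Rightarrow> arcs" where
  "half_twist_arcs m i = (\<lambda>j. if j < m then
      Some (\<lambda>t. if j = i then of_nat i + 1/2 - cis (pi * t) / 2
                else if j = i + 1 then of_nat i + 1/2 + cis (pi * t) / 2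
                else of_nat j) else None)"

definition half_twist :: "nat \<Rightarrow> nat \<Rightarrow> arcs set" where
  "half_twist m i = isotopy_rel m `` {half_twist_arcs m i}"

section \<open>The inverse braid monoid of type B\<close>

definition IB_B :: "nat \<Rightarrow> arcs set monoid" where
  "IB_B n = (IB (n + 1))\<lparr>carrier :=
     {X \<in> carrier (IB (n + 1)). \<exists>b\<in>X. \<exists>g. b 0 = Some g \<and> pathfinish g = 0}\<rparr>"

definition Br_B :: "nat \<Rightarrow> arcs set monoid" where
  "Br_B n = units_of (IB_B n)"

definition sigma :: "nat \<Rightarrow> nat \<Rightarrow> arcs set" where
  "sigma n i = half_twist (n + 1) i"

definition tau :: "nat \<Rightarrow> arcs set" where
  "tau n = half_twist (n + 1) 0 \<otimes>\<^bsub>IB (n + 1)\<^esub> half_twist (n + 1) 0"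

definition epsilon :: "nat \<Rightarrow> nat \<Rightarrow> arcs set" where
  "epsilon n i = isotopy_rel (n + 1) `` {trivial_arcs ({..n} - {i})}"

definition canonical_epi :: "nat \<Rightarrow> (arcs set \<Rightarrow> (int \<rightharpoonup> int)) \<Rightarrow> bool" where
  "canonical_epi n p \<longleftrightarrow> p \<in> epi (Br_B n) (W_B n) \<and>
     (\<forall>i\<in>{1..<n}. p (sigma n i) = sigma_map n i) \<and> p (tau n) = tau_map n"

text \<open>An action of \<open>IB_B n\<close> on \<open>SN n\<close> by partial bijections, with the prescribed action of the
  generators.\<close>

definition prescribed_action :: "nat \<Rightarrow> (arcs set \<Rightarrow> (int \<rightharpoonup> int)) \<Rightarrow> bool" where
  "prescribed_action n r \<longleftrightarrow> inverse_monoid_hom (IB_B n) (I_B n) r \<and>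
     (\<forall>i\<in>{1..<n}. r (sigma n i) = sigma_map n i) \<and>
     r (tau n) = tau_map n \<and>
     (\<forall>i\<in>{1..n}. r (epsilon n i) = epsilon_map n i)"

end

theory Submission
  imports Defs "HOL-Algebra.Generated_Groups"
begin

text \<open>
  Subtracting the fixed string and taking continuous square roots \<open>w\<^sub>j\<close> of the others turns a
  full braid of type \<open>B\<close> into a path in the complement of the complexified hyperplane arrangement
  of type \<open>B\<close>, given by \<open>w\<^sub>i \<noteq> 0\<close> and \<open>w\<^sub>i \<noteq> \<plusminus> w\<^sub>j\<close>. The sign that a string receives under
  \<open>\<rho>\<close> is the sign of the end point of its square root lift, so \<open>\<rho>\<close> is defined on all partial
  braids, and its invariance and multiplicativity are those of lifts along \<open>z \<mapsto> z\<^sup>2\<close>.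

  Uniqueness needs that \<open>\<sigma>\<^sub>i\<close>, \<open>\<tau>\<close> and \<open>\<epsilon>\<^sub>i\<close> generate. The real parts of \<open>\<plusminus> w\<^sub>j\<close> determine a Weyl
  chamber. After a small shear and a subdivision, a path moves one point at a time and crosses one
  chamber wall at a time. Chambers are convex, and the part of a wall neighbourhood in which the two
  exchanged points pass on a given side of each other is star-shaped, so each crossing is homotopic
  to a lifted half twist, that is, to \<open>\<sigma>\<^sub>i\<^sup>\<plusminus>\<^sup>1\<close> or \<open>\<tau>\<^sup>\<plusminus>\<^sup>1\<close>. A partial braid is a trivial partial
  braid times a full braid.
\<close>

text \<open>A braid only permutes unsigned points. It carries signs because no string meets the
  fixed one: their difference lives in the punctured plane, where a square root is determined by its
  initial value. The marked points are the squares of the real configuration \<open>std n\<close>,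
  and the possible end configurations \<open>std n \<circ> g\<close> are its translates under signed
  permutations; this is why paths can be composed after a relabelling. The obstacle to generation is
  that a path may meet several walls at once, or run along one. Subdivision alone does not cure
  this: all intermediate configurations must have pairwise distinct real parts. Only finitely many
  coordinates occur at the subdivision times, so all but finitely many shears achieve it, and a
  shear fixes the real base configurations and hence the homotopy class. Between such configurations
  a single moving point passes its neighbours one by one, while its mirror image passes theirs. The
  invariant is that the path travelled so far, closed by a straight segment to the base
  configuration of the present chamber, represents a product of generators and their
  inverses.\<close>

section \<open>Homotopies obtained by reparametrisation\<close>

text \<open>The straight homotopy from \<open>f\<close> to \<open>g\<close> stays in the convex
  interval [0,1], so composing it with \<open>p\<close> never leaves the image of \<open>p\<close>.
  The constant, reversal and subdivision homotopies are all of this kind.\<close>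

lemma homotopic_paths_reparam:
  fixes p :: "real \<Rightarrow> 'a::topological_space"
  assumes "path p" "path_image p \<subseteq> S"
    and "continuous_on {0..1} f" "f \<in> {0..1} \<rightarrow> {0..1}"
    and "continuous_on {0..1} g" "g \<in> {0..1} \<rightarrow> {0..1}"
    and "f 0 = g 0" "f 1 = g 1"
  shows "homotopic_paths S (p \<circ> f) (p \<circ> g)"
proof -
  define k where "k = (\<lambda>z. (1 - fst z) * f (snd z) + fst z * g (snd z))"
  have kk: "k z \<in> {0..1}" if "z \<in> {0..1} \<times> {0..1}" for z
  proof -
    have "f (snd z) \<in> {0..1}" "g (snd z) \<in> {0..1}" "fst z \<in> {0..1}" using that assms by auto
    then show ?thesis
      unfolding k_def using convex_bound_le[of "f (snd z)" 1 "g (snd z)" "1 - fst z" "fst z"] by auto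
  qed
  have "continuous_on ({0..1} \<times> {0..1}) k"
    unfolding k_def by (intro continuous_intros continuous_on_compose2[OF assms(3)] continuous_on_compose2[OF assms(5)]) auto
  then have c: "continuous_on ({0..1} \<times> {0..1}) (p \<circ> k)"
    using assms(1) kk unfolding path_def
    by (intro continuous_on_compose) (auto intro: continuous_on_subset)
  show ?thesis
    unfolding homotopic_paths
  proof (intro exI[of _ "p \<circ> k"] conjI c ballI)
    show "p \<circ> k \<in> {0..1} \<times> {0..1} \<rightarrow> S"
      using kk assms(2) unfolding path_image_def by (force simp: subset_iff)
  qed (use assms(7,8) in \<open>auto simp: k_def pathstart_def pathfinish_def algebra_simps\<close>)
qed

lemma homotopic_paths_const_right:
  fixes p :: "real \<Rightarrow> 'a::topological_space"
  assumes "path p" "path_image p \<subseteq> S" "a = pathfinish p"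
  shows "homotopic_paths S (p +++ (\<lambda>t. a)) p"
proof -
  have "homotopic_paths S (p \<circ> (\<lambda>t. min (2 * t) 1)) (p \<circ> id)"
    using assms by (intro homotopic_paths_reparam continuous_intros) auto
  moreover have "p \<circ> (\<lambda>t. min (2 * t) 1) = p +++ (\<lambda>t. a)"
    using assms by (auto simp: fun_eq_iff joinpaths_def pathfinish_def min_def)
  ultimately show ?thesis by simp
qed

lemma homotopic_paths_const_left:
  fixes p :: "real \<Rightarrow> 'a::topological_space"
  assumes "path p" "path_image p \<subseteq> S" "a = pathstart p"
  shows "homotopic_paths S ((\<lambda>t. a) +++ p) p"
proof -
  have "homotopic_paths S (p \<circ> (\<lambda>t. max (2 * t - 1) 0)) (p \<circ> id)"
    using assms by (intro homotopic_paths_reparam continuous_intros) auto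
  moreover have "p \<circ> (\<lambda>t. max (2 * t - 1) 0) = (\<lambda>t. a) +++ p"
    using assms by (auto simp: fun_eq_iff joinpaths_def pathstart_def max_def)
  ultimately show ?thesis by simp
qed

text \<open>Going out and back is \<open>p\<close> composed with a tent function, whose end values
  agree with those of the constant 0.\<close>

lemma homotopic_paths_reversepath_right:
  fixes p :: "real \<Rightarrow> 'a::topological_space"
  assumes "path p" "path_image p \<subseteq> S" "a = pathstart p"
  shows "homotopic_paths S (p +++ reversepath p) (\<lambda>t. a)"
proof -
  have "homotopic_paths S (p \<circ> (\<lambda>t. min (2 * t) (2 - 2 * t))) (p \<circ> (\<lambda>t. 0))"
    using assms by (intro homotopic_paths_reparam continuous_intros) (auto simp: min_def)
  moreover have e1: "p \<circ> (\<lambda>t. min (2 * t) (2 - 2 * t)) = p +++ reversepath p"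
    by (auto simp: fun_eq_iff joinpaths_def reversepath_def min_def)
  moreover have e2: "p \<circ> (\<lambda>t. 0) = (\<lambda>t. a)"
    using assms by (auto simp: pathstart_def)
  ultimately show ?thesis unfolding e1 e2 by -
qed

lemma homotopic_paths_reversepath_left:
  fixes p :: "real \<Rightarrow> 'a::topological_space"
  assumes "path p" "path_image p \<subseteq> S" "a = pathfinish p"
  shows "homotopic_paths S (reversepath p +++ p) (\<lambda>t. a)"
  using homotopic_paths_reversepath_right[of "reversepath p" S a] assms by simp

lemma homotopic_pathsE:
  assumes "homotopic_paths S p q"
  obtains h :: "real \<times> real \<Rightarrow> 'a::topological_space"
  where "continuous_on ({0..1} \<times> {0..1}) h"
    "\<forall>s\<in>{0..1}. \<forall>t\<in>{0..1}. h (s, t) \<in> S"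
    "\<forall>t\<in>{0..1}. h (0, t) = p t" "\<forall>t\<in>{0..1}. h (1, t) = q t"
    "\<forall>s\<in>{0..1}. h (s, 0) = p 0" "\<forall>s\<in>{0..1}. h (s, 1) = p 1"
proof -
  obtain h where h: "continuous_on ({0..1} \<times> {0..1}) h" "h \<in> {0..1} \<times> {0..1} \<rightarrow> S"
    "\<forall>x\<in>{0..1}. h (0, x) = p x" "\<forall>x\<in>{0..1}. h (1, x) = q x"
    "\<forall>t\<in>{0..1::real}. pathstart (h \<circ> Pair t) = pathstart p \<and> pathfinish (h \<circ> Pair t) = pathfinish p"
    using assms unfolding homotopic_paths by (elim exE conjE)
  show thesis
    by (rule that[OF h(1)]) (use h(2-) in \<open>auto simp: pathstart_def pathfinish_def Pi_iff\<close>)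
qed

lemma homotopic_pathsI:
  fixes h :: "real \<times> real \<Rightarrow> 'a::topological_space"
  assumes "continuous_on ({0..1} \<times> {0..1}) h"
    "\<And>s t. s \<in> {0..1} \<Longrightarrow> t \<in> {0..1} \<Longrightarrow> h (s, t) \<in> S"
    "\<And>t. t \<in> {0..1} \<Longrightarrow> h (0, t) = p t" "\<And>t. t \<in> {0..1} \<Longrightarrow> h (1, t) = q t"
    "\<And>s. s \<in> {0..1} \<Longrightarrow> h (s, 0) = p 0" "\<And>s. s \<in> {0..1} \<Longrightarrow> h (s, 1) = p 1"
  shows "homotopic_paths S p q"
  unfolding homotopic_paths
  by (rule exI[of _ h]) (use assms in \<open>auto simp: pathstart_def pathfinish_def\<close>)

lemma path_fun_iff:
  fixes p :: "real \<Rightarrow> 'b \<Rightarrow> 'c::topological_space"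
  shows "path p \<longleftrightarrow> (\<forall>i. path (\<lambda>t. p t i))"
  unfolding path_def
  using continuous_on_product_then_coordinatewise continuous_on_coordinatewise_then_product by metis

section \<open>Arc systems as paths of configurations\<close>

text \<open>The value 0 outside \<open>A\<close> makes a configuration depend on its points alone,
  while the configuration spaces for all sets of strings sit in one product space and can be related
  by coordinate maps.\<close>

definition conf :: "nat set \<Rightarrow> (nat \<Rightarrow> complex) set" where
  "conf A = {c. inj_on c A \<and> (\<forall>i. i \<notin> A \<longrightarrow> c i = 0)}"

text \<open>The motion of all points at once. Absent strings contribute 0, in agreement with
  \<open>conf (dom b)\<close>.\<close>

definition pth :: "arcs \<Rightarrow> real \<Rightarrow> nat \<Rightarrow> complex" where
  "pth b t i = (case b i of None \<Rightarrow> 0 | Some g \<Rightarrow> g t)"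

definition arcs_of :: "nat set \<Rightarrow> (real \<Rightarrow> nat \<Rightarrow> complex) \<Rightarrow> arcs" where
  "arcs_of A p = (\<lambda>i. if i \<in> A then Some (\<lambda>t. p t i) else None)"

lemma dom_arcs_of [simp]: "dom (arcs_of A p) = A"
  by (auto simp: arcs_of_def dom_def)

lemma pth_arcs_of: "pth (arcs_of A p) t i = (if i \<in> A then p t i else 0)"
  by (simp add: pth_def arcs_of_def)

lemma pth_in: "i \<in> dom b \<Longrightarrow> pth b t i = the (b i) t"
  by (auto simp: pth_def)

lemma pth_notin: "i \<notin> dom b \<Longrightarrow> pth b t i = 0"
  by (auto simp: pth_def domIff)

text \<open>Continuity into a product is continuity of each coordinate, and disjointness of the arcs
  at a time is injectivity of the configuration at that time.\<close>

lemma arc_system_iff: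
  "arc_system m b \<longleftrightarrow> dom b \<subseteq> {..<m} \<and> path (pth b) \<and> path_image (pth b) \<subseteq> conf (dom b) \<and>
     (\<forall>i\<in>dom b. pth b 0 i = of_nat i \<and> pth b 1 i \<in> of_nat ` {..<m})" (is "?L \<longleftrightarrow> ?R")
proof
  assume L: ?L
  have "path (\<lambda>t. pth b t i)" for i
    using L by (cases "b i") (auto simp: arc_system_def pth_def path_def)
  then have "path (pth b)" by (simp add: path_fun_iff)
  moreover have "path_image (pth b) \<subseteq> conf (dom b)"
    using L unfolding arc_system_def path_image_def conf_def inj_on_def
    by (fastforce simp: pth_def domIff split: option.splits)
  ultimately show ?R
    using L by (auto simp: arc_system_def pth_def pathstart_def pathfinish_def)
next
  assume R: ?R
  have "path g \<and> pathstart g = of_nat i \<and> pathfinish g \<in> of_nat ` {..<m}" if "b i = Some g" for i g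
  proof -
    have "(\<lambda>t. pth b t i) = g" using that by (auto simp: pth_def)
    moreover have "path (\<lambda>t. pth b t i)" using R by (simp add: path_fun_iff)
    moreover have "i \<in> dom b" using that by auto
    ultimately show ?thesis
      using R by (auto simp: pathstart_def pathfinish_def)
  qed
  moreover have "f t \<noteq> g t" if "b i = Some f" "b j = Some g" "i \<noteq> j" "t \<in> {0..1}" for i j f g t
  proof -
    have "pth b t \<in> conf (dom b)" using R that(4) by (auto simp: path_image_def)
    then have "pth b t i \<noteq> pth b t j" using that by (auto simp: conf_def inj_on_def dom_def)
    then show ?thesis using that by (simp add: pth_def)
  qed
  ultimately show ?L
    using R unfolding arc_system_def by blast
qed

lemma arc_systemD:
  assumes "arc_system m b"
  shows "dom b \<subseteq> {..<m}" "path (pth b)" "path_image (pth b) \<subseteq> conf (dom b)"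
    "i \<in> dom b \<Longrightarrow> pth b 0 i = of_nat i" "i \<in> dom b \<Longrightarrow> pth b 1 i \<in> of_nat ` {..<m}"
  using assms unfolding arc_system_iff by auto

text \<open>The stage of an isotopy is the parameter of a homotopy. Every stage is an arc system,
  which pins the upper ends, and the lower ends are fixed explicitly; so isotopy is homotopy
  relative to the ends, and results on path homotopies apply.\<close>

lemma isotopic_iff:
  assumes a: "arc_system m a" and b: "arc_system m b"
  shows "isotopic m a b \<longleftrightarrow> dom a = dom b \<and> homotopic_paths (conf (dom a)) (pth a) (pth b)"
    (is "?L \<longleftrightarrow> ?R")
proof
  assume ?L
  then obtain H :: "real \<Rightarrow> nat \<Rightarrow> real \<Rightarrow> complex" where d: "dom a = dom b"
    and H1: "\<forall>i\<in>dom a. continuous_on ({0..1} \<times> {0..1}) (\<lambda>(s, t). H s i t)"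
    and H2: "\<forall>s\<in>{0..1}. arc_system m (\<lambda>i. if i \<in> dom a then Some (H s i) else None)"
    and H3: "\<forall>s\<in>{0..1}. \<forall>i\<in>dom a. pathfinish (H s i) = pathfinish (the (a i))"
    and H4: "\<forall>i\<in>dom a. \<forall>t\<in>{0..1}. H 0 i t = the (a i) t \<and> H 1 i t = the (b i) t"
    unfolding isotopic_def by (elim conjE exE) (rule that)
  note H = bspec[OF H1] bspec[OF H2] bspec[OF bspec[OF H3]] bspec[OF bspec[OF H4]]
  define h where "h = (\<lambda>(s, t) i. if i \<in> dom a then H s i t else 0)"
  have hs: "(\<lambda>t. h (s, t)) = pth (\<lambda>i. if i \<in> dom a then Some (H s i) else None)" for s
    by (auto simp: h_def pth_def fun_eq_iff)
  have "homotopic_paths (conf (dom a)) (pth a) (pth b)"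
  proof (rule homotopic_pathsI[of h])
    show "continuous_on ({0..1} \<times> {0..1}) h"
    proof (rule continuous_on_coordinatewise_then_product)
      fix i
      show "continuous_on ({0..1} \<times> {0..1}) (\<lambda>x. h x i)"
        using H(1)[of i] by (cases "i \<in> dom a") (auto simp: h_def case_prod_beta)
    qed
    show "h (s, t) \<in> conf (dom a)" if st: "s \<in> {0..1}" "t \<in> {0..1}" for s t
    proof -
      have "h (s, t) \<in> path_image (\<lambda>t. h (s, t))"
        using st by (auto simp: path_image_def)
      moreover have "dom (\<lambda>i. if i \<in> dom a then Some (H s i) else None) = dom a"
        by (auto simp: dom_def)
      ultimately show "h (s, t) \<in> conf (dom a)"
        using arc_systemD(3)[OF H(2)[OF st(1)]] unfolding hs by auto
    qed
    fix s :: real assume s: "s \<in> {0..1}"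
    have "h (0, s) i = pth a s i \<and> h (1, s) i = pth b s i" for i
      using H(4)[OF _ s, of i] d by (cases "i \<in> dom a") (auto simp: h_def pth_in pth_notin)
    then show "h (0, s) = pth a s" "h (1, s) = pth b s" by blast+
    have "H s i 0 = of_nat i" if "i \<in> dom a" for i
      using H(2)[OF s] that unfolding arc_system_def by (auto simp: pathstart_def)
    then have "h (s, 0) i = pth a 0 i \<and> h (s, 1) i = pth a 1 i" for i
      using arc_systemD(4)[OF a, of i] H(3)[OF s, of i]
      by (cases "i \<in> dom a") (auto simp: h_def pth_in pth_notin pathfinish_def)
    then show "h (s, 0) = pth a 0" "h (s, 1) = pth a 1" by blast+
  qed
  then show ?R using d by simp
next
  assume R: ?R
  then have "homotopic_paths (conf (dom a)) (pth a) (pth b)" ..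
  then obtain h :: "real \<times> real \<Rightarrow> nat \<Rightarrow> complex"
    where h: "continuous_on ({0..1} \<times> {0..1}) h"
    "\<forall>s\<in>{0..1}. \<forall>t\<in>{0..1}. h (s, t) \<in> conf (dom a)"
    "\<forall>t\<in>{0..1}. h (0, t) = pth a t" "\<forall>t\<in>{0..1}. h (1, t) = pth b t"
    "\<forall>s\<in>{0..1}. h (s, 0) = pth a 0" "\<forall>s\<in>{0..1}. h (s, 1) = pth a 1"
    by (rule homotopic_pathsE)
  define H where "H = (\<lambda>s i t. h (s, t) i)"
  show ?L
    unfolding isotopic_def
  proof (intro conjI exI[of _ H] ballI)
    show "dom a = dom b" using R by simp
    show "continuous_on ({0..1} \<times> {0..1}) (\<lambda>(s, t). H s i t)" for i
      using continuous_on_product_then_coordinatewise[OF h(1), of i] by (simp add: H_def case_prod_beta)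
    fix s :: real assume s: "s \<in> {0..1}"
    let ?b = "\<lambda>i. if i \<in> dom a then Some (H s i) else None"
    have d: "dom ?b = dom a" by (auto simp: dom_def)
    note hc = bspec[OF bspec[OF h(2) s]]
    have "pth ?b t = h (s, t)" if "t \<in> {0..1}" for t
      using hc[OF that] by (auto simp: pth_def H_def conf_def fun_eq_iff)
    moreover have "continuous_on {0..1} (\<lambda>t. h (s, t))"
      using s by (intro continuous_on_compose2[OF h(1)] continuous_intros) auto
    ultimately have pb: "path (pth ?b)" "path_image (pth ?b) \<subseteq> conf (dom a)"
      using hc unfolding path_def path_image_def by (auto intro: continuous_on_eq)
    moreover have "pth ?b 0 i = of_nat i \<and> pth ?b 1 i \<in> of_nat ` {..<m}" if "i \<in> dom a" for i
      using that arc_systemD(4,5)[OF a that] bspec[OF h(5) s] bspec[OF h(6) s] by (simp add: pth_def H_def)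
    ultimately show "arc_system m ?b"
      unfolding arc_system_iff d using arc_systemD(1)[OF a] by blast
    fix i assume i: "i \<in> dom a"
    then show "pathfinish (H s i) = pathfinish (the (a i))"
      using bspec[OF h(6) s] by (simp add: H_def pathfinish_def pth_in)
  next
    fix i and t :: real assume "i \<in> dom a" "t \<in> {0..1}"
    then show "H 0 i t = the (a i) t" "H 1 i t = the (b i) t"
      using h(3,4) R by (simp_all add: H_def pth_in)
  qed
qed

declare domIff [iff del]

section \<open>Stacking of arc systems\<close>

definition endp :: "arcs \<Rightarrow> nat \<Rightarrow> nat" where
  "endp b i = end_index (the (b i))"

lemma endp_eqI:
  assumes "i \<in> dom b" "pth b 1 i = of_nat j"
  shows "endp b i = j"
  using assms unfolding endp_def end_index_def pathfinish_def by (simp add: pth_in)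

lemma endp:
  assumes "arc_system m b" "i \<in> dom b"
  shows "pth b 1 i = of_nat (endp b i)" "endp b i < m"
proof -
  obtain j where "j < m" "pth b 1 i = of_nat j"
    using arc_systemD(5)[OF assms] by auto
  moreover from this have "endp b i = j" by (intro endp_eqI assms)
  ultimately show "pth b 1 i = of_nat (endp b i)" "endp b i < m" by auto
qed

lemma pth_in_conf:
  assumes "arc_system m b" "t \<in> {0..1}"
  shows "pth b t \<in> conf (dom b)"
  using arc_systemD(3)[OF assms(1)] assms(2) by (auto simp: path_image_def)

lemma inj_on_endp:
  assumes "arc_system m b"
  shows "inj_on (endp b) (dom b)"
proof (rule inj_onI)
  fix i j assume "i \<in> dom b" "j \<in> dom b" "endp b i = endp b j"
  then have "pth b 1 i = pth b 1 j" using endp(1)[OF assms] by simp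
  then show "i = j"
    using pth_in_conf[OF assms, of 1] \<open>i \<in> dom b\<close> \<open>j \<in> dom b\<close> by (auto simp: conf_def inj_on_def)
qed

text \<open>The map of configuration spaces induced by an injection of index sets. With
  \<open>id\<close> it forgets strings; with \<open>endp a\<close> it lets a lower braid be indexed
  by the upper points of \<open>a\<close>.\<close>

definition pull :: "nat set \<Rightarrow> (nat \<Rightarrow> nat) \<Rightarrow> (nat \<Rightarrow> complex) \<Rightarrow> nat \<Rightarrow> complex" where
  "pull D \<phi> c = (\<lambda>i. if i \<in> D then c (\<phi> i) else 0)"

lemma continuous_on_pull: "continuous_on S (pull D \<phi>)"
proof (rule continuous_on_coordinatewise_then_product)
  show "continuous_on S (\<lambda>c. pull D \<phi> c i)" for i
    by (cases "i \<in> D")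
      (auto simp: pull_def intro: continuous_on_subset[OF continuous_on_product_coordinates])
qed

lemma pull_in_conf:
  assumes "inj_on \<phi> D" "\<phi> ` D \<subseteq> B" "c \<in> conf B"
  shows "pull D \<phi> c \<in> conf D"
  using assms unfolding conf_def pull_def inj_on_def by (simp add: image_subset_iff)

lemma homotopic_paths_pull:
  assumes "homotopic_paths (conf B) p q" "inj_on \<phi> D" "\<phi> ` D \<subseteq> B"
  shows "homotopic_paths (conf D) (pull D \<phi> \<circ> p) (pull D \<phi> \<circ> q)"
  using assms by (intro homotopic_paths_continuous_image[where S = "conf B"])
    (auto intro: continuous_on_pull pull_in_conf)

lemma path_pull:
  assumes "path p" "path_image p \<subseteq> conf B" "inj_on \<phi> D" "\<phi> ` D \<subseteq> B"
  shows "path (pull D \<phi> \<circ> p)" "path_image (pull D \<phi> \<circ> p) \<subseteq> conf D"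
  using homotopic_paths_pull[of B p p \<phi> D] assms by auto

lemma pull_pull:
  assumes "\<phi> ` D \<subseteq> D'"
  shows "pull D \<phi> \<circ> (pull D' \<psi> \<circ> p) = pull D (\<psi> \<circ> \<phi>) \<circ> p"
  using assms by (auto simp: pull_def fun_eq_iff)

lemma pull_cong: "(\<And>i. i \<in> D \<Longrightarrow> \<phi> i = \<psi> i) \<Longrightarrow> pull D \<phi> = pull D \<psi>"
  by (auto simp: pull_def fun_eq_iff)

definition sdom :: "arcs \<Rightarrow> arcs \<Rightarrow> nat set" where
  "sdom a b = {i \<in> dom a. endp a i \<in> dom b}"

lemma dom_stack: "dom (stack a b) = sdom a b"
  by (auto simp: stack_def sdom_def endp_def domIff split: option.splits)

text \<open>A product of partial braids is a concatenation of paths once the strings that do not run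
  through are forgotten and the lower ones are renumbered. Facts about products thereby become facts
  about joins.\<close>

lemma pth_stack:
  "pth (stack a b) = (pull (sdom a b) id \<circ> pth a) +++ (pull (sdom a b) (endp a) \<circ> pth b)"
proof (intro ext)
  fix t i
  show "pth (stack a b) t i =
      ((pull (sdom a b) id \<circ> pth a) +++ (pull (sdom a b) (endp a) \<circ> pth b)) t i"
    by (cases "a i"; cases "b (endp a i)")
      (auto simp: stack_def pth_def pull_def sdom_def endp_def joinpaths_def domIff)
qed

lemma sdom_maps: "id ` sdom a b \<subseteq> dom a" "endp a ` sdom a b \<subseteq> dom b"
  by (auto simp: sdom_def)

lemma inj_on_endp_sdom: "arc_system m a \<Longrightarrow> inj_on (endp a) (sdom a b)"
  by (rule inj_on_subset[OF inj_on_endp]) (auto simp: sdom_def)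

lemma stack_meet:
  assumes "arc_system m a" "arc_system m b"
  shows "pathfinish (pull (sdom a b) id \<circ> pth a) = pathstart (pull (sdom a b) (endp a) \<circ> pth b)"
proof
  fix i
  show "pathfinish (pull (sdom a b) id \<circ> pth a) i = pathstart (pull (sdom a b) (endp a) \<circ> pth b) i"
    using endp(1)[OF assms(1), of i] arc_systemD(4)[OF assms(2), of "endp a i"]
    by (auto simp: pathfinish_def pathstart_def pull_def sdom_def)
qed

lemma stack_pieces:
  assumes "arc_system m a" "arc_system m b"
  shows "path (pull (sdom a b) id \<circ> pth a)" "path (pull (sdom a b) (endp a) \<circ> pth b)"
    "path_image (pull (sdom a b) id \<circ> pth a) \<subseteq> conf (sdom a b)"
    "path_image (pull (sdom a b) (endp a) \<circ> pth b) \<subseteq> conf (sdom a b)"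
  using path_pull[OF arc_systemD(2,3)[OF assms(1)] inj_on_id sdom_maps(1)]
    path_pull[OF arc_systemD(2,3)[OF assms(2)] inj_on_endp_sdom[OF assms(1)] sdom_maps(2)]
  by auto

lemma arc_system_stack:
  assumes "arc_system m a" "arc_system m b"
  shows "arc_system m (stack a b)"
proof -
  have "sdom a b \<subseteq> {..<m}" using arc_systemD(1)[OF assms(1)] by (auto simp: sdom_def)
  moreover have "pth (stack a b) 0 i = of_nat i \<and> pth (stack a b) 1 i \<in> of_nat ` {..<m}"
    if "i \<in> sdom a b" for i
    using that arc_systemD(4)[OF assms(1), of i] arc_systemD(5)[OF assms(2), of "endp a i"]
    by (simp add: pth_stack joinpaths_def pull_def sdom_def)
  ultimately show ?thesis
    using stack_pieces[OF assms] stack_meet[OF assms]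
    unfolding arc_system_iff dom_stack by (auto simp: pth_stack subset_path_image_join)
qed

lemma endp_stack:
  assumes "arc_system m a" "arc_system m b" "i \<in> sdom a b"
  shows "endp (stack a b) i = endp b (endp a i)"
  using assms endp(1)[OF assms(2), of "endp a i"]
  by (intro endp_eqI) (auto simp: dom_stack pth_stack joinpaths_def pull_def sdom_def)

section \<open>Isotopy as a congruence for stacking\<close>

text \<open>The homotopy transports the end values and the condition on the image from
  \<open>a\<close> to \<open>b\<close>, so \<open>b\<close> becomes an arc system too.\<close>

lemma isotopy_relI:
  assumes "arc_system m a" "dom a = dom b" "homotopic_paths (conf (dom a)) (pth a) (pth b)"
  shows "(a, b) \<in> isotopy_rel m"
proof -
  have "pth b 0 = pth a 0" "pth b 1 = pth a 1"
    using homotopic_paths_imp_pathstart[OF assms(3)] homotopic_paths_imp_pathfinish[OF assms(3)]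
    by (auto simp: pathstart_def pathfinish_def)
  then have "arc_system m b"
    using assms homotopic_paths_imp_path[OF assms(3)] homotopic_paths_imp_subset[OF assms(3)]
    unfolding arc_system_iff by auto
  then show ?thesis using assms by (simp add: isotopy_rel_def isotopic_iff)
qed

lemma isotopy_relD:
  assumes "(a, b) \<in> isotopy_rel m"
  shows "arc_system m a" "arc_system m b" "dom b = dom a"
    "homotopic_paths (conf (dom a)) (pth a) (pth b)"
    "i \<in> dom a \<Longrightarrow> endp b i = endp a i"
proof -
  show h: "arc_system m a" "arc_system m b" "dom b = dom a"
    "homotopic_paths (conf (dom a)) (pth a) (pth b)"
    using assms isotopic_iff unfolding isotopy_rel_def by auto
  assume "i \<in> dom a"
  then show "endp b i = endp a i"
    using homotopic_paths_imp_pathfinish[OF h(4)] endp(1)[OF h(1)] h(3)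
    by (intro endp_eqI) (auto simp: pathfinish_def)
qed

lemma isotopy_rel_pth_eqI:
  assumes "arc_system m a" "dom a = dom b" "\<And>t i. t \<in> {0..1} \<Longrightarrow> i \<in> dom a \<Longrightarrow> pth a t i = pth b t i"
  shows "(a, b) \<in> isotopy_rel m"
proof (rule isotopy_relI[OF assms(1,2)], rule homotopic_paths_eq)
  show "pth a t = pth b t" if "t \<in> {0..1}" for t
  proof
    show "pth a t i = pth b t i" for i
      using assms(2) assms(3)[OF that, of i] by (cases "i \<in> dom a") (auto simp: pth_notin)
  qed
qed (use arc_systemD[OF assms(1)] in auto)

lemma equiv_isotopy_rel: "equiv {b. arc_system m b} (isotopy_rel m)"
proof (rule equivI)
  show "isotopy_rel m \<subseteq> {b. arc_system m b} \<times> {b. arc_system m b}"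
    by (auto simp: isotopy_rel_def)
  show "refl_on {b. arc_system m b} (isotopy_rel m)"
    by (rule refl_onI) (auto intro!: isotopy_relI simp: arc_systemD(2,3))
  show "sym (isotopy_rel m)"
    by (rule symI, rule isotopy_relI)
      (auto simp: isotopy_relD(2,3) intro: homotopic_paths_sym isotopy_relD(4))
  show "trans (isotopy_rel m)"
  proof (rule transI)
    fix a b c assume ab: "(a, b) \<in> isotopy_rel m" and bc: "(b, c) \<in> isotopy_rel m"
    show "(a, c) \<in> isotopy_rel m"
      using isotopy_relD(1,3,4)[OF ab] isotopy_relD(3,4)[OF bc]
      by (auto intro!: isotopy_relI intro: homotopic_paths_trans)
  qed
qed

lemma isotopy_rel_refl: "arc_system m a \<Longrightarrow> (a, a) \<in> isotopy_rel m"
  using equiv_isotopy_rel[of m] by (auto simp: equiv_def refl_on_def)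

lemma isotopy_rel_sym: "(a, b) \<in> isotopy_rel m \<Longrightarrow> (b, a) \<in> isotopy_rel m"
  using equiv_isotopy_rel[of m] by (auto simp: equiv_def dest: symD)

lemma isotopy_rel_trans [trans]:
  "(a, b) \<in> isotopy_rel m \<Longrightarrow> (b, c) \<in> isotopy_rel m \<Longrightarrow> (a, c) \<in> isotopy_rel m"
  using equiv_isotopy_rel[of m] by (auto simp: equiv_def dest: transD)

text \<open>The domain and the end indices are isotopy invariants, so the same strings survive in
  both products, with the same renumbering; the two homotopies can then be pulled back and
  joined.\<close>

lemma stack_cong:
  assumes "(a, a') \<in> isotopy_rel m" "(b, b') \<in> isotopy_rel m"
  shows "(stack a b, stack a' b') \<in> isotopy_rel m"
proof -
  note A = isotopy_relD[OF assms(1)] and B = isotopy_relD[OF assms(2)]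
  have s: "sdom a' b' = sdom a b" using A(3,5) B(3) by (auto simp: sdom_def)
  have e: "pull (sdom a b) (endp a') = pull (sdom a b) (endp a)"
    using A(5) by (intro pull_cong) (auto simp: sdom_def)
  show ?thesis
  proof (rule isotopy_relI)
    show "homotopic_paths (conf (dom (stack a b))) (pth (stack a b)) (pth (stack a' b'))"
      unfolding dom_stack pth_stack s e
      by (intro homotopic_paths_join stack_meet[OF A(1) B(1)]
          homotopic_paths_pull[OF A(4)] homotopic_paths_pull[OF B(4)] inj_on_endp_sdom[OF A(1)])
        (auto simp: sdom_def)
  qed (use arc_system_stack[OF A(1) B(1)] s in \<open>auto simp: dom_stack\<close>)
qed

text \<open>Both bracketings keep the same set \<open>D\<close> of strings, those running through
  all three braids, and pull-backs compose. What remains is associativity of joins up to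
  homotopy.\<close>

lemma stack_assoc:
  assumes a: "arc_system m a" and b: "arc_system m b" and c: "arc_system m c"
  shows "(stack a (stack b c), stack (stack a b) c) \<in> isotopy_rel m"
proof -
  define D where "D = {i \<in> dom a. endp a i \<in> dom b \<and> endp b (endp a i) \<in> dom c}"
  have D1: "sdom a (stack b c) = D" by (auto simp: sdom_def D_def dom_stack)
  have D2: "sdom (stack a b) c = D"
    using endp_stack[OF a b] unfolding sdom_def[of "stack a b"] D_def dom_stack
    by (auto simp: sdom_def)
  have i: "inj_on (endp a) D" "inj_on (endp b \<circ> endp a) D"
    using inj_on_subset[OF inj_on_endp[OF a], of D]
      inj_on_subset[OF inj_on_endp[OF b], of "endp a ` D"]
    by (auto simp: D_def intro!: comp_inj_on)
  have im: "id ` D \<subseteq> dom a" "endp a ` D \<subseteq> dom b" "(endp b \<circ> endp a) ` D \<subseteq> dom c"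
    "endp a ` D \<subseteq> sdom b c" "id ` D \<subseteq> sdom a b"
    by (auto simp: D_def sdom_def)
  have e: "pull D (endp (stack a b)) = pull D (endp b \<circ> endp a)"
    using endp_stack[OF a b] im(5) by (intro pull_cong) auto
  let ?p = "pull D id \<circ> pth a" and ?q = "pull D (endp a) \<circ> pth b"
    and ?r = "pull D (endp b \<circ> endp a) \<circ> pth c"
  have 1: "pth (stack a (stack b c)) = ?p +++ (?q +++ ?r)"
    unfolding pth_stack D1 path_compose_join pull_pull[OF im(4)] by simp
  have 2: "pth (stack (stack a b) c) = (?p +++ ?q) +++ ?r"
    unfolding pth_stack D2 path_compose_join pull_pull[OF im(5)] e by simp
  show ?thesis
  proof (rule isotopy_relI)
    show "homotopic_paths (conf (dom (stack a (stack b c))))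
        (pth (stack a (stack b c))) (pth (stack (stack a b) c))"
      unfolding 1 2 dom_stack D1
    proof (intro homotopic_paths_assoc)
      show "path ?p" "path_image ?p \<subseteq> conf D"
        using path_pull[OF arc_systemD(2,3)[OF a] inj_on_id im(1)] by auto
      show "path ?q" "path_image ?q \<subseteq> conf D"
        using path_pull[OF arc_systemD(2,3)[OF b] i(1) im(2)] by auto
      show "path ?r" "path_image ?r \<subseteq> conf D"
        using path_pull[OF arc_systemD(2,3)[OF c] i(2) im(3)] by auto
      show "pathfinish ?p = pathstart ?q" "pathfinish ?q = pathstart ?r"
        using endp(1)[OF a] endp(1)[OF b] arc_systemD(4)[OF b] arc_systemD(4)[OF c] im
        by (auto simp: pathfinish_def pathstart_def pull_def D_def fun_eq_iff)
    qed
  qed (use arc_system_stack a b c D1 D2 in \<open>auto simp: dom_stack\<close>)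
qed

section \<open>Trivial braids, reversed braids and idempotents\<close>

lemma dom_trivial_arcs [simp]: "dom (trivial_arcs A) = A"
  by (auto simp: trivial_arcs_def dom_def)

lemma pth_trivial_arcs: "pth (trivial_arcs A) t i = (if i \<in> A then of_nat i else 0)"
  by (simp add: trivial_arcs_def pth_def)

lemma arc_system_trivial: "A \<subseteq> {..<m} \<Longrightarrow> arc_system m (trivial_arcs A)"
  unfolding arc_system_iff
  by (auto simp: path_fun_iff path_def path_image_def conf_def inj_on_def pth_trivial_arcs)

lemma endp_trivial [simp]: "i \<in> A \<Longrightarrow> endp (trivial_arcs A) i = i"
  by (intro endp_eqI) (auto simp: pth_trivial_arcs)

lemma pth_restrict: "pth (b |` A) = pull (dom b \<inter> A) id \<circ> pth b"
  by (auto simp: fun_eq_iff pth_def pull_def restrict_map_def domIff split: option.splits)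

lemma arc_system_restrict: "arc_system m b \<Longrightarrow> arc_system m (b |` A)"
  unfolding arc_system_def by (auto simp: restrict_map_def dom_def split: if_splits)

lemma restrict_map_id: "dom b \<subseteq> A \<Longrightarrow> b |` A = b"
  by (rule ext) (metis domIff restrict_in restrict_out subsetD)

text \<open>On the strings that survive, the trivial factor is a waiting period before the motion of
  \<open>b\<close>.\<close>

lemma stack_trivial_left:
  assumes b: "arc_system m b" and A: "A \<subseteq> {..<m}"
  shows "(stack (trivial_arcs A) b, b |` A) \<in> isotopy_rel m"
proof (rule isotopy_relI)
  note t = arc_system_trivial[OF A]
  let ?D = "dom b \<inter> A"
  have s: "sdom (trivial_arcs A) b = ?D" by (auto simp: sdom_def)
  have e: "pull ?D (endp (trivial_arcs A)) = pull ?D id" by (rule pull_cong) simp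
  show "arc_system m (stack (trivial_arcs A) b)" by (intro arc_system_stack t b)
  show "dom (stack (trivial_arcs A) b) = dom (b |` A)" by (auto simp: dom_stack sdom_def)
  have "pull ?D id \<circ> pth (trivial_arcs A) = (\<lambda>t. pathstart (pull ?D id \<circ> pth b))"
    using arc_systemD(4)[OF b] by (auto simp: fun_eq_iff pull_def pth_trivial_arcs pathstart_def)
  then show "homotopic_paths (conf (dom (stack (trivial_arcs A) b)))
      (pth (stack (trivial_arcs A) b)) (pth (b |` A))"
    using path_pull[OF arc_systemD(2,3)[OF b] inj_on_id, of ?D]
    unfolding dom_stack pth_stack s e pth_restrict
    by (auto intro!: homotopic_paths_const_left)
qed

lemma stack_trivial_right:
  assumes b: "arc_system m b" and A: "A \<subseteq> {..<m}"
  shows "(stack b (trivial_arcs A), b |` {i. endp b i \<in> A}) \<in> isotopy_rel m"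
proof (rule isotopy_relI)
  note t = arc_system_trivial[OF A]
  let ?D = "dom b \<inter> {i. endp b i \<in> A}"
  have s: "sdom b (trivial_arcs A) = ?D" by (auto simp: sdom_def)
  show "arc_system m (stack b (trivial_arcs A))" by (intro arc_system_stack t b)
  show "dom (stack b (trivial_arcs A)) = dom (b |` {i. endp b i \<in> A})"
    by (auto simp: dom_stack sdom_def)
  have "pull ?D (endp b) \<circ> pth (trivial_arcs A) = (\<lambda>t. pathfinish (pull ?D id \<circ> pth b))"
    using endp(1)[OF b] by (auto simp: fun_eq_iff pull_def pth_trivial_arcs pathfinish_def)
  then show "homotopic_paths (conf (dom (stack b (trivial_arcs A))))
      (pth (stack b (trivial_arcs A))) (pth (b |` {i. endp b i \<in> A}))"
    using path_pull[OF arc_systemD(2,3)[OF b] inj_on_id, of ?D]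
    unfolding dom_stack pth_stack s pth_restrict
    by (auto intro!: homotopic_paths_const_right)
qed

text \<open>Time reversal, with each string renumbered by its lower end, which has become its upper
  end.\<close>

definition inv_arcs :: "arcs \<Rightarrow> arcs" where
  "inv_arcs b = arcs_of (endp b ` dom b)
     (pull (endp b ` dom b) (inv_into (dom b) (endp b)) \<circ> reversepath (pth b))"

lemma dom_inv_arcs [simp]: "dom (inv_arcs b) = endp b ` dom b"
  by (simp add: inv_arcs_def)

lemma pth_inv_arcs:
  "pth (inv_arcs b) = pull (endp b ` dom b) (inv_into (dom b) (endp b)) \<circ> reversepath (pth b)"
  by (auto simp: inv_arcs_def fun_eq_iff pth_arcs_of pull_def)

text \<open>After renumbering, each of the two products is a path joined with its reverse, which
  contracts to a constant path.\<close>

lemma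
  assumes b: "arc_system m b"
  shows arc_system_inv: "arc_system m (inv_arcs b)"
    and endp_inv: "i \<in> dom b \<Longrightarrow> endp (inv_arcs b) (endp b i) = i"
    and stack_inv_right: "(stack b (inv_arcs b), trivial_arcs (dom b)) \<in> isotopy_rel m"
    and stack_inv_left: "(stack (inv_arcs b) b, trivial_arcs (endp b ` dom b)) \<in> isotopy_rel m"
proof -
  let ?E = "endp b ` dom b" and ?f = "inv_into (dom b) (endp b)"
  have f: "?f ` ?E \<subseteq> dom b" "inj_on ?f ?E"
    by (auto simp: inv_into_into intro: inj_on_inv_into)
  have fe: "?f (endp b i) = i" if "i \<in> dom b" for i
    using inv_into_f_f[OF inj_on_endp[OF b] that] .
  have rp: "path (reversepath (pth b))" "path_image (reversepath (pth b)) \<subseteq> conf (dom b)"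
    using arc_systemD(2,3)[OF b] by auto
  have E: "?E \<subseteq> {..<m}" using endp(2)[OF b] by auto
  show inv: "arc_system m (inv_arcs b)"
    unfolding arc_system_iff dom_inv_arcs
  proof (intro conjI ballI)
    show "path (pth (inv_arcs b))" "path_image (pth (inv_arcs b)) \<subseteq> conf ?E"
      using path_pull[OF rp f(2,1)] by (simp_all add: pth_inv_arcs)
    fix j assume "j \<in> ?E"
    then obtain i where i: "i \<in> dom b" "j = endp b i" by auto
    then show "pth (inv_arcs b) 0 j = of_nat j" "pth (inv_arcs b) 1 j \<in> of_nat ` {..<m}"
      using endp(1)[OF b i(1)] arc_systemD(4)[OF b i(1)] arc_systemD(1)[OF b]
      by (auto simp: pth_inv_arcs pull_def reversepath_def fe)
  qed (use E in auto)
  show ei: "endp (inv_arcs b) (endp b i) = i" if "i \<in> dom b" for i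
    using that arc_systemD(4)[OF b that]
    by (intro endp_eqI) (auto simp: pth_inv_arcs pull_def reversepath_def fe)
  show "(stack b (inv_arcs b), trivial_arcs (dom b)) \<in> isotopy_rel m"
  proof (rule isotopy_relI)
    have s: "sdom b (inv_arcs b) = dom b" by (auto simp: sdom_def)
    show "arc_system m (stack b (inv_arcs b))" by (intro arc_system_stack inv b)
    show "dom (stack b (inv_arcs b)) = dom (trivial_arcs (dom b))" by (simp add: dom_stack s)
    have p: "pull (dom b) id \<circ> pth b = pth b"
      by (auto simp: fun_eq_iff pull_def pth_notin)
    have q: "pull (dom b) (endp b) \<circ> pth (inv_arcs b) = reversepath (pth b)"
      by (auto simp: fun_eq_iff pull_def pth_inv_arcs fe reversepath_def pth_notin)
    have t: "pth (trivial_arcs (dom b)) = (\<lambda>t. pathstart (pth b))"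
      using arc_systemD(4)[OF b] by (auto simp: fun_eq_iff pth_trivial_arcs pathstart_def pth_notin)
    show "homotopic_paths (conf (dom (stack b (inv_arcs b)))) (pth (stack b (inv_arcs b)))
        (pth (trivial_arcs (dom b)))"
      unfolding pth_stack dom_stack s p q t
      by (intro homotopic_paths_reversepath_right arc_systemD[OF b] refl)
  qed
  show "(stack (inv_arcs b) b, trivial_arcs ?E) \<in> isotopy_rel m"
  proof (rule isotopy_relI)
    have s: "sdom (inv_arcs b) b = ?E" using ei by (auto simp: sdom_def)
    show "arc_system m (stack (inv_arcs b) b)" by (intro arc_system_stack inv b)
    show "dom (stack (inv_arcs b) b) = dom (trivial_arcs ?E)" by (simp add: dom_stack s)
    let ?p = "pull ?E ?f \<circ> pth b"
    have p: "pull ?E id \<circ> pth (inv_arcs b) = reversepath ?p"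
      by (auto simp: fun_eq_iff pull_def pth_inv_arcs reversepath_def)
    have q: "pull ?E (endp (inv_arcs b)) \<circ> pth b = ?p"
      using ei by (auto simp: fun_eq_iff pull_def fe)
    have t: "pth (trivial_arcs ?E) = (\<lambda>t. pathfinish ?p)"
      using endp(1)[OF b] by (auto simp: fun_eq_iff pth_trivial_arcs pathfinish_def pull_def fe)
    show "homotopic_paths (conf (dom (stack (inv_arcs b) b))) (pth (stack (inv_arcs b) b))
        (pth (trivial_arcs ?E))"
      unfolding pth_stack dom_stack s p q t
      using path_pull[OF arc_systemD(2,3)[OF b] f(2,1)]
      by (intro homotopic_paths_reversepath_left) auto
  qed
qed

text \<open>Since \<open>e\<close> and its square have the same strings, every string of
  \<open>e\<close> ends in \<open>dom e\<close>, so \<open>e\<close> absorbs the trivial braid on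
  \<open>dom e\<close> from the right. Writing that trivial braid as \<open>e\<close> times its
  reverse f gives e = e(ef) = (ee)f = ef, which is trivial.\<close>

lemma idempotent_arcs:
  assumes e: "arc_system m e" and ee: "(stack e e, e) \<in> isotopy_rel m"
  shows "(e, trivial_arcs (dom e)) \<in> isotopy_rel m"
proof -
  have s: "sdom e e = dom e" using isotopy_relD(3)[OF ee] unfolding dom_stack by (rule sym)
  let ?f = "inv_arcs e"
  note inv = arc_system_inv[OF e]
  have "(e, stack e (trivial_arcs (dom e))) \<in> isotopy_rel m"
  proof -
    have "dom e \<subseteq> {i. endp e i \<in> dom e}"
      using s unfolding sdom_def by blast
    then have "e |` {i. endp e i \<in> dom e} = e" by (rule restrict_map_id)
    then show ?thesis
      using stack_trivial_right[OF e arc_systemD(1)[OF e]] by (auto intro: isotopy_rel_sym)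
  qed
  also have "(stack e (trivial_arcs (dom e)), stack e (stack e ?f)) \<in> isotopy_rel m"
    by (intro stack_cong isotopy_rel_refl e isotopy_rel_sym[OF stack_inv_right[OF e]])
  also have "(stack e (stack e ?f), stack (stack e e) ?f) \<in> isotopy_rel m"
    by (intro stack_assoc e inv)
  also have "(stack (stack e e) ?f, stack e ?f) \<in> isotopy_rel m"
    by (intro stack_cong isotopy_rel_refl ee inv)
  also have "(stack e ?f, trivial_arcs (dom e)) \<in> isotopy_rel m"
    by (rule stack_inv_right[OF e])
  finally show ?thesis .
qed

section \<open>The inverse braid monoid of type B\<close>

definition cls :: "nat \<Rightarrow> arcs \<Rightarrow> arcs set" where
  "cls m b = isotopy_rel m `` {b}"

lemma cls_eq_iff:
  assumes "arc_system m a" "arc_system m b"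
  shows "cls m a = cls m b \<longleftrightarrow> (a, b) \<in> isotopy_rel m"
  using eq_equiv_class_iff[OF equiv_isotopy_rel[of m]] assms by (simp add: cls_def)

lemma cls_eqI: "(a, b) \<in> isotopy_rel m \<Longrightarrow> cls m a = cls m b"
  by (simp add: cls_eq_iff isotopy_relD)

text \<open>By \<open>stack_cong\<close> all classes in the defining union coincide, and both index
  sets are nonempty.\<close>

lemma mult_cls:
  assumes "arc_system m a" "arc_system m b"
  shows "cls m a \<otimes>\<^bsub>IB m\<^esub> cls m b = cls m (stack a b)"
proof -
  have *: "cls m (stack a' b') = cls m (stack a b)" if "a' \<in> cls m a" "b' \<in> cls m b" for a' b'
    using that by (intro cls_eqI isotopy_rel_sym[OF stack_cong]) (auto simp: cls_def)
  have "cls m a \<otimes>\<^bsub>IB m\<^esub> cls m b = (\<Union>a'\<in>cls m a. \<Union>b'\<in>cls m b. cls m (stack a' b'))"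
    by (simp add: IB_def cls_def)
  also have "\<dots> = (\<Union>a'\<in>cls m a. \<Union>b'\<in>cls m b. cls m (stack a b))"
    using * by (intro SUP_cong refl)
  also have "\<dots> = cls m (stack a b)"
  proof -
    have "a \<in> cls m a" "b \<in> cls m b"
      using assms by (auto simp: cls_def isotopy_rel_refl)
    then have "cls m a \<noteq> {}" "cls m b \<noteq> {}" by blast+
    then show ?thesis by simp
  qed
  finally show ?thesis .
qed

definition barc :: "nat \<Rightarrow> arcs \<Rightarrow> bool" where
  "barc n b \<longleftrightarrow> arc_system (Suc n) b \<and> 0 \<in> dom b \<and> endp b 0 = 0"

lemma barc_arc_system: "barc n b \<Longrightarrow> arc_system (Suc n) b"
  by (simp add: barc_def)

lemma barc_cong:
  assumes "(a, b) \<in> isotopy_rel (Suc n)" "barc n a"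
  shows "barc n b"
  using assms isotopy_relD[OF assms(1)] by (auto simp: barc_def)

text \<open>The defining condition speaks of some representative; as ends of strings are isotopy
  invariants, it can be tested on any representative.\<close>

lemma carrier_IB_B: "carrier (IB_B n) = cls (Suc n) ` {b. barc n b}"
proof -
  have iff: "(\<exists>b'\<in>cls (Suc n) b. \<exists>g. b' 0 = Some g \<and> pathfinish g = 0) \<longleftrightarrow> barc n b"
    if b: "arc_system (Suc n) b" for b
  proof
    assume "\<exists>b'\<in>cls (Suc n) b. \<exists>g. b' 0 = Some g \<and> pathfinish g = 0"
    then obtain b' g where *: "(b, b') \<in> isotopy_rel (Suc n)" "b' 0 = Some g" "pathfinish g = 0"
      by (auto simp: cls_def)
    then have "0 \<in> dom b'" "endp b' 0 = 0"
      by (auto intro!: endp_eqI simp: pth_def pathfinish_def domIff)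
    then have "barc n b'" using isotopy_relD(2)[OF *(1)] by (simp add: barc_def)
    then show "barc n b" using barc_cong[OF isotopy_rel_sym[OF *(1)]] by simp
  next
    assume "barc n b"
    then have "pth b 1 0 = 0" "0 \<in> dom b" using endp(1)[OF b, of 0] by (auto simp: barc_def)
    moreover have "b \<in> cls (Suc n) b" using b by (simp add: cls_def isotopy_rel_refl)
    ultimately show "\<exists>b'\<in>cls (Suc n) b. \<exists>g. b' 0 = Some g \<and> pathfinish g = 0"
      by (intro bexI[of _ b]) (auto simp: pth_def pathfinish_def domIff)
  qed
  let ?P = "\<lambda>X. \<exists>b'\<in>X. \<exists>g. b' 0 = Some g \<and> pathfinish g = 0"
  have "carrier (IB_B n) = cls (Suc n) ` {b. arc_system (Suc n) b \<and> ?P (cls (Suc n) b)}"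
    by (auto simp: IB_B_def IB_def quotient_def cls_def)
  also have "{b. arc_system (Suc n) b \<and> ?P (cls (Suc n) b)} = {b. barc n b}"
    using iff barc_arc_system by blast
  finally show ?thesis .
qed

lemma mult_IB_B: "mult (IB_B n) = mult (IB (Suc n))"
  by (simp add: IB_B_def)

lemma mult_cls_B:
  "barc n a \<Longrightarrow> barc n b \<Longrightarrow> cls (Suc n) a \<otimes>\<^bsub>IB_B n\<^esub> cls (Suc n) b = cls (Suc n) (stack a b)"
  unfolding mult_IB_B by (rule mult_cls) (simp_all only: barc_arc_system)

lemma one_IB_B: "\<one>\<^bsub>IB_B n\<^esub> = cls (Suc n) (trivial_arcs {..n})"
  by (simp add: IB_B_def IB_def cls_def lessThan_Suc_atMost)

lemma barc_stack: "barc n a \<Longrightarrow> barc n b \<Longrightarrow> barc n (stack a b)"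
  unfolding barc_def by (auto simp: arc_system_stack endp_stack dom_stack sdom_def)

lemma barc_trivial: "A \<subseteq> {..n} \<Longrightarrow> 0 \<in> A \<Longrightarrow> barc n (trivial_arcs A)"
  unfolding barc_def by (auto intro!: arc_system_trivial)

lemma barc_inv: "barc n b \<Longrightarrow> barc n (inv_arcs b)"
  unfolding barc_def using arc_system_inv endp_inv by (metis dom_inv_arcs imageI)

lemma barc_dom: "barc n b \<Longrightarrow> dom b \<subseteq> {..n}"
  using arc_systemD(1)[of "Suc n" b] by (auto simp: barc_def lessThan_Suc_atMost)

lemma monoid_IB_B: "monoid (IB_B n)"
proof (rule monoidI)
  show "x \<otimes>\<^bsub>IB_B n\<^esub> y \<in> carrier (IB_B n)" if "x \<in> carrier (IB_B n)" "y \<in> carrier (IB_B n)" for x y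
    using that by (auto simp: carrier_IB_B mult_cls_B barc_stack)
  show "\<one>\<^bsub>IB_B n\<^esub> \<in> carrier (IB_B n)"
    by (auto simp: carrier_IB_B one_IB_B barc_trivial)
  show "x \<otimes>\<^bsub>IB_B n\<^esub> y \<otimes>\<^bsub>IB_B n\<^esub> z = x \<otimes>\<^bsub>IB_B n\<^esub> (y \<otimes>\<^bsub>IB_B n\<^esub> z)"
    if "x \<in> carrier (IB_B n)" "y \<in> carrier (IB_B n)" "z \<in> carrier (IB_B n)" for x y z
    using that unfolding carrier_IB_B
    by (elim imageE CollectE) (simp add: mult_cls_B barc_stack barc_arc_system
        cls_eqI[OF isotopy_rel_sym[OF stack_assoc]])
  fix x assume "x \<in> carrier (IB_B n)"
  then obtain b where b: "x = cls (Suc n) b" "barc n b" by (auto simp: carrier_IB_B)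
  note as = barc_arc_system[OF b(2)]
  have "dom b \<subseteq> {i. endp b i \<in> {..n}}" using endp(2)[OF as] by fastforce
  then have r: "b |` {..n} = b" "b |` {i. endp b i \<in> {..n}} = b"
    using barc_dom[OF b(2)] by (simp_all only: restrict_map_id)
  show "\<one>\<^bsub>IB_B n\<^esub> \<otimes>\<^bsub>IB_B n\<^esub> x = x"
    using stack_trivial_left[OF as, of "{..n}", unfolded lessThan_Suc_atMost] b barc_trivial[of "{..n}" n] r
    by (simp add: one_IB_B mult_cls_B cls_eqI)
  show "x \<otimes>\<^bsub>IB_B n\<^esub> \<one>\<^bsub>IB_B n\<^esub> = x"
    using stack_trivial_right[OF as, of "{..n}", unfolded lessThan_Suc_atMost] b barc_trivial[of "{..n}" n] r
    by (simp add: one_IB_B mult_cls_B cls_eqI)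
qed

section \<open>Inverse monoids via commuting idempotents\<close>

text \<open>If aba = a, then bab is an inverse of a. For inverses b and c of a, commuting the
  idempotents ba, ca and then ab, ac turns both b and c into cab.\<close>

lemma inverse_monoidI:
  assumes "monoid M"
    and reg: "\<And>a. a \<in> carrier M \<Longrightarrow> \<exists>b\<in>carrier M. a \<otimes>\<^bsub>M\<^esub> b \<otimes>\<^bsub>M\<^esub> a = a"
    and comm: "\<And>e f. e \<in> carrier M \<Longrightarrow> f \<in> carrier M \<Longrightarrow> e \<otimes>\<^bsub>M\<^esub> e = e \<Longrightarrow> f \<otimes>\<^bsub>M\<^esub> f = f \<Longrightarrow>
      e \<otimes>\<^bsub>M\<^esub> f = f \<otimes>\<^bsub>M\<^esub> e"
  shows "inverse_monoid M"
proof -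
  interpret monoid M by fact
  have "\<exists>!b. b \<in> carrier M \<and> a = a \<otimes>\<^bsub>M\<^esub> b \<otimes>\<^bsub>M\<^esub> a \<and> b = b \<otimes>\<^bsub>M\<^esub> a \<otimes>\<^bsub>M\<^esub> b"
    if a: "a \<in> carrier M" for a
  proof (rule ex_ex1I)
    obtain b where b: "b \<in> carrier M" "a \<otimes>\<^bsub>M\<^esub> b \<otimes>\<^bsub>M\<^esub> a = a" using reg[OF a] by blast
    let ?c = "b \<otimes>\<^bsub>M\<^esub> a \<otimes>\<^bsub>M\<^esub> b"
    have "a \<otimes>\<^bsub>M\<^esub> ?c \<otimes>\<^bsub>M\<^esub> a = (a \<otimes>\<^bsub>M\<^esub> b \<otimes>\<^bsub>M\<^esub> a) \<otimes>\<^bsub>M\<^esub> b \<otimes>\<^bsub>M\<^esub> a"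
      using a b(1) by (simp add: m_assoc)
    moreover have "?c \<otimes>\<^bsub>M\<^esub> a \<otimes>\<^bsub>M\<^esub> ?c = b \<otimes>\<^bsub>M\<^esub> (a \<otimes>\<^bsub>M\<^esub> b \<otimes>\<^bsub>M\<^esub> a) \<otimes>\<^bsub>M\<^esub> b \<otimes>\<^bsub>M\<^esub> a \<otimes>\<^bsub>M\<^esub> b"
      using a b(1) by (simp add: m_assoc)
    moreover have "b \<otimes>\<^bsub>M\<^esub> a \<otimes>\<^bsub>M\<^esub> b \<otimes>\<^bsub>M\<^esub> a \<otimes>\<^bsub>M\<^esub> b = b \<otimes>\<^bsub>M\<^esub> (a \<otimes>\<^bsub>M\<^esub> b \<otimes>\<^bsub>M\<^esub> a) \<otimes>\<^bsub>M\<^esub> b"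
      using a b(1) by (simp add: m_assoc)
    ultimately show "\<exists>b. b \<in> carrier M \<and> a = a \<otimes>\<^bsub>M\<^esub> b \<otimes>\<^bsub>M\<^esub> a \<and> b = b \<otimes>\<^bsub>M\<^esub> a \<otimes>\<^bsub>M\<^esub> b"
      using a b by (intro exI[of _ ?c]) simp
  next
    fix b c
    assume "b \<in> carrier M \<and> a = a \<otimes>\<^bsub>M\<^esub> b \<otimes>\<^bsub>M\<^esub> a \<and> b = b \<otimes>\<^bsub>M\<^esub> a \<otimes>\<^bsub>M\<^esub> b"
      and "c \<in> carrier M \<and> a = a \<otimes>\<^bsub>M\<^esub> c \<otimes>\<^bsub>M\<^esub> a \<and> c = c \<otimes>\<^bsub>M\<^esub> a \<otimes>\<^bsub>M\<^esub> c"
    then have b: "b \<in> carrier M" "a \<otimes>\<^bsub>M\<^esub> b \<otimes>\<^bsub>M\<^esub> a = a" "b \<otimes>\<^bsub>M\<^esub> a \<otimes>\<^bsub>M\<^esub> b = b"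
      and c: "c \<in> carrier M" "a \<otimes>\<^bsub>M\<^esub> c \<otimes>\<^bsub>M\<^esub> a = a" "c \<otimes>\<^bsub>M\<^esub> a \<otimes>\<^bsub>M\<^esub> c = c"
      by auto
    have idem: "(x \<otimes>\<^bsub>M\<^esub> y) \<otimes>\<^bsub>M\<^esub> (x \<otimes>\<^bsub>M\<^esub> y) = x \<otimes>\<^bsub>M\<^esub> y"
      if "x \<in> carrier M" "y \<in> carrier M" "x \<otimes>\<^bsub>M\<^esub> y \<otimes>\<^bsub>M\<^esub> x = x" for x y
      using that by (metis m_assoc m_closed)
    have "b = b \<otimes>\<^bsub>M\<^esub> (a \<otimes>\<^bsub>M\<^esub> c \<otimes>\<^bsub>M\<^esub> a) \<otimes>\<^bsub>M\<^esub> b" using b c by simp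
    also have "\<dots> = (b \<otimes>\<^bsub>M\<^esub> a) \<otimes>\<^bsub>M\<^esub> (c \<otimes>\<^bsub>M\<^esub> a) \<otimes>\<^bsub>M\<^esub> b" using a b(1) c(1) by (simp add: m_assoc)
    also have "(b \<otimes>\<^bsub>M\<^esub> a) \<otimes>\<^bsub>M\<^esub> (c \<otimes>\<^bsub>M\<^esub> a) = (c \<otimes>\<^bsub>M\<^esub> a) \<otimes>\<^bsub>M\<^esub> (b \<otimes>\<^bsub>M\<^esub> a)"
      using a b c by (intro comm idem) auto
    also have "\<dots> \<otimes>\<^bsub>M\<^esub> b = c \<otimes>\<^bsub>M\<^esub> a \<otimes>\<^bsub>M\<^esub> (b \<otimes>\<^bsub>M\<^esub> a \<otimes>\<^bsub>M\<^esub> b)" using a b(1) c(1) by (simp add: m_assoc)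
    finally have 1: "b = c \<otimes>\<^bsub>M\<^esub> a \<otimes>\<^bsub>M\<^esub> b" using b by simp
    have "c = c \<otimes>\<^bsub>M\<^esub> (a \<otimes>\<^bsub>M\<^esub> b \<otimes>\<^bsub>M\<^esub> a) \<otimes>\<^bsub>M\<^esub> c" using b c by simp
    also have "\<dots> = c \<otimes>\<^bsub>M\<^esub> ((a \<otimes>\<^bsub>M\<^esub> b) \<otimes>\<^bsub>M\<^esub> (a \<otimes>\<^bsub>M\<^esub> c))" using a b(1) c(1) by (simp add: m_assoc)
    also have "(a \<otimes>\<^bsub>M\<^esub> b) \<otimes>\<^bsub>M\<^esub> (a \<otimes>\<^bsub>M\<^esub> c) = (a \<otimes>\<^bsub>M\<^esub> c) \<otimes>\<^bsub>M\<^esub> (a \<otimes>\<^bsub>M\<^esub> b)"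
      using a b c by (intro comm idem) auto
    also have "c \<otimes>\<^bsub>M\<^esub> \<dots> = (c \<otimes>\<^bsub>M\<^esub> a \<otimes>\<^bsub>M\<^esub> c) \<otimes>\<^bsub>M\<^esub> a \<otimes>\<^bsub>M\<^esub> b" using a b(1) c(1) by (simp add: m_assoc)
    finally have "c = c \<otimes>\<^bsub>M\<^esub> a \<otimes>\<^bsub>M\<^esub> b" using c by simp
    with 1 show "b = c" by simp
  qed
  then show ?thesis using assms(1) by (simp add: inverse_monoid_def)
qed

lemma mult_trivial:
  assumes "A \<subseteq> {..n}" "B \<subseteq> {..n}" "0 \<in> A" "0 \<in> B"
  shows "cls (Suc n) (trivial_arcs A) \<otimes>\<^bsub>IB_B n\<^esub> cls (Suc n) (trivial_arcs B) =
    cls (Suc n) (trivial_arcs (A \<inter> B))"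
proof -
  have "trivial_arcs B |` A = trivial_arcs (A \<inter> B)"
    by (auto simp: trivial_arcs_def restrict_map_def fun_eq_iff)
  then show ?thesis
    using stack_trivial_left[of "Suc n" "trivial_arcs B" A] assms
    by (simp add: mult_cls_B barc_trivial lessThan_Suc_atMost arc_system_trivial cls_eqI)
qed

text \<open>Time reversal gives regularity. Idempotents are trivial partial braids, and these
  multiply by intersecting their sets of strings, hence commute.\<close>

lemma inverse_monoid_IB_B: "inverse_monoid (IB_B n)"
proof (rule inverse_monoidI[OF monoid_IB_B])
  fix x assume "x \<in> carrier (IB_B n)"
  then obtain b where b: "x = cls (Suc n) b" "barc n b" by (auto simp: carrier_IB_B)
  note as = barc_arc_system[OF b(2)]
  have "(stack (stack b (inv_arcs b)) b, stack (trivial_arcs (dom b)) b) \<in> isotopy_rel (Suc n)"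
    by (intro stack_cong stack_inv_right isotopy_rel_refl as)
  moreover have "b |` dom b = b"
    by (simp add: restrict_map_id)
  ultimately have "(stack (stack b (inv_arcs b)) b, b) \<in> isotopy_rel (Suc n)"
    using stack_trivial_left[OF as arc_systemD(1)[OF as]] isotopy_rel_trans by metis
  then show "\<exists>y\<in>carrier (IB_B n). x \<otimes>\<^bsub>IB_B n\<^esub> y \<otimes>\<^bsub>IB_B n\<^esub> x = x"
    using b barc_inv[OF b(2)] unfolding carrier_IB_B
    by (intro bexI[of _ "cls (Suc n) (inv_arcs b)"]) (auto simp: mult_cls_B barc_stack cls_eqI)
next
  have *: "\<exists>A. A \<subseteq> {..n} \<and> 0 \<in> A \<and> e = cls (Suc n) (trivial_arcs A)"
    if e: "e \<in> carrier (IB_B n)" "e \<otimes>\<^bsub>IB_B n\<^esub> e = e" for e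
  proof -
    obtain b where b: "e = cls (Suc n) b" "barc n b" using e(1) by (auto simp: carrier_IB_B)
    note as = barc_arc_system[OF b(2)]
    have "(stack b b, b) \<in> isotopy_rel (Suc n)"
      using e(2) b as by (simp add: mult_cls_B cls_eq_iff arc_system_stack)
    then have "e = cls (Suc n) (trivial_arcs (dom b))"
      using idempotent_arcs[OF as] b(1) cls_eqI by metis
    then show ?thesis using b(2) barc_dom[OF b(2)] by (auto simp: barc_def)
  qed
  fix e f assume "e \<in> carrier (IB_B n)" "f \<in> carrier (IB_B n)"
    "e \<otimes>\<^bsub>IB_B n\<^esub> e = e" "f \<otimes>\<^bsub>IB_B n\<^esub> f = f"
  then obtain A B where "A \<subseteq> {..n}" "0 \<in> A" "e = cls (Suc n) (trivial_arcs A)"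
    "B \<subseteq> {..n}" "0 \<in> B" "f = cls (Suc n) (trivial_arcs B)"
    using * by metis
  then show "e \<otimes>\<^bsub>IB_B n\<^esub> f = f \<otimes>\<^bsub>IB_B n\<^esub> e"
    by (simp add: mult_trivial Int_commute)
qed

text \<open>A product has no more strings than its first factor, so units are full. Conversely the
  end indices of a full braid form an injection of a finite set into itself, hence hit every lower
  point, and the reversed braid is a two-sided inverse.\<close>

lemma Units_IB_B: "Units (IB_B n) = cls (Suc n) ` {b. barc n b \<and> dom b = {..n}}"
proof (intro equalityI subsetI)
  fix x assume "x \<in> Units (IB_B n)"
  then obtain y where "x \<in> carrier (IB_B n)" "y \<in> carrier (IB_B n)" "x \<otimes>\<^bsub>IB_B n\<^esub> y = \<one>\<^bsub>IB_B n\<^esub>"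
    by (auto simp: Units_def)
  then obtain b c where b: "x = cls (Suc n) b" "barc n b" and c: "barc n c"
    and "cls (Suc n) (stack b c) = cls (Suc n) (trivial_arcs {..n})"
    unfolding carrier_IB_B one_IB_B by (auto simp: mult_cls_B)
  then have "(stack b c, trivial_arcs {..n}) \<in> isotopy_rel (Suc n)"
    using barc_arc_system[OF barc_stack[OF b(2) c]] barc_arc_system[OF barc_trivial[of "{..n}" n]]
    by (simp add: cls_eq_iff)
  then have "sdom b c = {..n}" using isotopy_relD(3) by (fastforce simp: dom_stack)
  then have "dom b = {..n}" using barc_dom[OF b(2)] by (auto simp: sdom_def)
  then show "x \<in> cls (Suc n) ` {b. barc n b \<and> dom b = {..n}}" using b by blast
next
  fix x assume "x \<in> cls (Suc n) ` {b. barc n b \<and> dom b = {..n}}"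
  then obtain b where b: "x = cls (Suc n) b" "barc n b" "dom b = {..n}" by blast
  note as = barc_arc_system[OF b(2)]
  have "endp b ` dom b \<subseteq> {..n}" using endp(2)[OF as] by fastforce
  then have im: "endp b ` dom b = {..n}"
    using b(3) inj_on_endp[OF as] by (intro card_subset_eq) (auto simp: card_image)
  then have "cls (Suc n) b \<otimes>\<^bsub>IB_B n\<^esub> cls (Suc n) (inv_arcs b) = \<one>\<^bsub>IB_B n\<^esub>"
    "cls (Suc n) (inv_arcs b) \<otimes>\<^bsub>IB_B n\<^esub> cls (Suc n) b = \<one>\<^bsub>IB_B n\<^esub>"
    using cls_eqI[OF stack_inv_right[OF as, unfolded b(3)]] cls_eqI[OF stack_inv_left[OF as, unfolded im]]
      b(2) barc_inv[OF b(2)]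
    by (simp_all only: mult_cls_B one_IB_B)
  then show "x \<in> Units (IB_B n)"
    using b barc_inv[OF b(2)] unfolding Units_def carrier_IB_B by blast
qed

section \<open>Odd configurations\<close>

text \<open>The two square roots of the marked point at |x|, told apart by the sign of
  \<open>x\<close>.\<close>

definition sroot :: "int \<Rightarrow> complex" where
  "sroot x = of_real (of_int (sgn x) * sqrt (of_int \<bar>x\<bar>))"

lemma sroot_0 [simp]: "sroot 0 = 0"
  by (simp add: sroot_def)

lemma sroot_minus [simp]: "sroot (- x) = - sroot x"
  by (simp add: sroot_def)

lemma sroot_power2: "(sroot x)\<^sup>2 = of_int \<bar>x\<bar>"
proof -
  have "(of_int (sgn x) * sqrt (of_int \<bar>x\<bar>))\<^sup>2 = of_int \<bar>x\<bar>"
    by (auto simp: power_mult_distrib sgn_if)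
  then show ?thesis
    unfolding sroot_def by (metis of_real_of_int_eq of_real_power)
qed

lemma Re_sroot: "Re (sroot x) = of_int (sgn x) * sqrt (of_int \<bar>x\<bar>)"
  by (simp add: sroot_def)

lemma Re_sroot_less: "x < y \<Longrightarrow> Re (sroot x) < Re (sroot y)"
proof -
  assume "x < y"
  consider "0 \<le> x" | "x < 0" "0 < y" | "x < 0" "y = 0" | "y < 0" using \<open>x < y\<close> by linarith
  then show ?thesis
  proof cases
    case 1 then show ?thesis using \<open>x < y\<close> by (cases "x = 0") (auto simp: Re_sroot)
  next
    case 2
    then have "Re (sroot x) < 0" "0 < Re (sroot y)" by (auto simp: Re_sroot)
    then show ?thesis by linarith
  qed (use \<open>x < y\<close> in \<open>auto simp: Re_sroot\<close>)
qed

lemma sroot_eq_iff [simp]: "sroot x = sroot y \<longleftrightarrow> x = y"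
  using Re_sroot_less[of x y] Re_sroot_less[of y x] by (cases x y rule: linorder_cases) auto

definition std :: "nat \<Rightarrow> int \<Rightarrow> complex" where
  "std n x = (if \<bar>x\<bar> \<le> int n then sroot x else 0)"

text \<open>A configuration \<open>w\<^sub>1, \<dots>, w\<^sub>n\<close> is encoded as an odd function on the integers, with
  \<open>c i = w\<^sub>i\<close> and \<open>c (- i) = - w\<^sub>i\<close>; then all conditions \<open>w\<^sub>i \<noteq> 0\<close>, \<open>w\<^sub>i \<noteq> \<plusminus> w\<^sub>j\<close> together say
  that \<open>c\<close> is injective, and signed permutations act by precomposition.\<close>

definition oddconf :: "nat \<Rightarrow> (int \<Rightarrow> complex) set" where
  "oddconf n = {c. (\<forall>x. c (- x) = - c x) \<and> inj_on c {- int n..int n} \<and> (\<forall>x. int n < \<bar>x\<bar> \<longrightarrow> c x = 0)}"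

text \<open>The Weyl group of type B, its elements extended by the identity to all integers so that
  composition and inversion are those of total functions.\<close>

definition signed_perms :: "nat \<Rightarrow> (int \<Rightarrow> int) set" where
  "signed_perms n = {g. g permutes {- int n..int n} \<and> (\<forall>x. g (- x) = - g x)}"

lemma signed_permsD:
  assumes "g \<in> signed_perms n"
  shows "g permutes {- int n..int n}" "g (- x) = - g x" "g 0 = 0" "\<bar>g x\<bar> \<le> int n \<longleftrightarrow> \<bar>x\<bar> \<le> int n"
    "g x = 0 \<longleftrightarrow> x = 0" "inj g"
proof -
  show p: "g permutes {- int n..int n}" "g (- x) = - g x" for x
    using assms by (auto simp: signed_perms_def)
  show g0: "g 0 = 0" using p(2)[of 0] by simp
  show "inj g" using permutes_inj[OF p(1)] .
  then show "g x = 0 \<longleftrightarrow> x = 0" using g0 by (metis injD)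
  show "\<bar>g x\<bar> \<le> int n \<longleftrightarrow> \<bar>x\<bar> \<le> int n"
    using permutes_in_image[OF p(1), of x] by (auto simp: abs_le_iff)
qed

lemma signed_perms_id [simp]: "id \<in> signed_perms n"
  by (simp add: signed_perms_def permutes_id)

lemma signed_perms_comp: "g \<in> signed_perms n \<Longrightarrow> h \<in> signed_perms n \<Longrightarrow> h \<circ> g \<in> signed_perms n"
  by (auto simp: signed_perms_def intro: permutes_compose)

abbreviation finv :: "(int \<Rightarrow> int) \<Rightarrow> int \<Rightarrow> int" where
  "finv \<equiv> inv_into UNIV"

lemma signed_perms_inv:
  assumes "g \<in> signed_perms n"
  shows "finv g \<in> signed_perms n" "finv g \<circ> g = id" "g \<circ> finv g = id"
proof -
  note p = signed_permsD(1)[OF assms]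
  show "finv g \<circ> g = id" "g \<circ> finv g = id"
    using permutes_inv_o[OF p] by auto
  have "finv g (- x) = - finv g x" for x
    using signed_permsD(2)[OF assms, of "finv g x"] p by (metis permutes_inverses)
  then show "finv g \<in> signed_perms n"
    using permutes_inv[OF p] by (simp add: signed_perms_def)
qed

lemma oddconf_0: "c \<in> oddconf n \<Longrightarrow> c 0 = 0"
proof -
  assume "c \<in> oddconf n"
  then have "c (- 0) = - c 0" unfolding oddconf_def by blast
  then show ?thesis by simp
qed

lemma std_in_oddconf: "std n \<in> oddconf n"
  by (auto simp: oddconf_def std_def inj_on_def split: if_splits)

lemma oddconf_comp:
  assumes "c \<in> oddconf n" "g \<in> signed_perms n"
  shows "c \<circ> g \<in> oddconf n"
  unfolding oddconf_def
proof (intro CollectI conjI allI impI)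
  show "(c \<circ> g) (- x) = - (c \<circ> g) x" for x
    using assms signed_permsD(2)[OF assms(2)] by (simp add: oddconf_def)
  show "inj_on (c \<circ> g) {- int n..int n}"
    using assms permutes_image[OF signed_permsD(1)[OF assms(2)]] permutes_inj_on[OF signed_permsD(1)[OF assms(2)]]
    by (intro comp_inj_on) (auto simp: oddconf_def)
  show "(c \<circ> g) x = 0" if "int n < \<bar>x\<bar>" for x
    using that signed_permsD(4)[OF assms(2), of x] assms(1) by (auto simp: oddconf_def)
qed

lemma continuous_on_precomp: "continuous_on S (\<lambda>c::int \<Rightarrow> complex. c \<circ> g)"
  by (intro continuous_on_coordinatewise_then_product)
    (auto simp: o_def intro: continuous_on_subset[OF continuous_on_product_coordinates])

lemma homotopic_paths_precomp:
  assumes "homotopic_paths (oddconf n) p q" "g \<in> signed_perms n"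
  shows "homotopic_paths (oddconf n) (\<lambda>t. p t \<circ> g) (\<lambda>t. q t \<circ> g)"
  using homotopic_paths_continuous_image[OF assms(1) continuous_on_precomp, of g "oddconf n"]
    oddconf_comp[OF _ assms(2)] by (auto simp: o_def)

lemma path_precomp:
  assumes "path p" "path_image p \<subseteq> oddconf n" "g \<in> signed_perms n"
  shows "path (\<lambda>t. p t \<circ> g)" "path_image (\<lambda>t. p t \<circ> g) \<subseteq> oddconf n"
  using homotopic_paths_precomp[of n p p g] assms by auto

text \<open>Passes from square roots back to the points themselves. As odd functions vanish at 0,
  the fixed string is put at the origin.\<close>

definition sqm :: "nat \<Rightarrow> (int \<Rightarrow> complex) \<Rightarrow> nat \<Rightarrow> complex" where
  "sqm n c i = (if i \<le> n then (c (int i))\<^sup>2 else 0)"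

text \<open>Equal squares mean c i = c j or c i = - c j, and the latter is c (- j) by oddness;
  injectivity on the signed indices excludes both when i and j differ.\<close>

lemma sqm_in_conf:
  assumes "c \<in> oddconf n"
  shows "sqm n c \<in> conf {..n}"
proof -
  have "i = j" if "i \<le> n" "j \<le> n" "(c (int i))\<^sup>2 = (c (int j))\<^sup>2" for i j
  proof -
    have "c (int i) = c (int j) \<or> c (int i) = c (- int j)"
      using that(3) assms by (simp add: oddconf_def power2_eq_iff)
    moreover have "inj_on c {- int n..int n}" using assms by (simp add: oddconf_def)
    ultimately have "int i = int j \<or> int i = - int j"
      using that(1,2) by (auto dest!: inj_onD)
    then show ?thesis by auto
  qed
  then show ?thesis by (auto simp: conf_def sqm_def inj_on_def)
qed

lemma continuous_on_sqm: "continuous_on S (sqm n)"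
proof (rule continuous_on_coordinatewise_then_product)
  show "continuous_on S (\<lambda>c. sqm n c i)" for i
    by (cases "i \<le> n")
      (auto simp: sqm_def intro!: continuous_intros intro: continuous_on_subset[OF continuous_on_product_coordinates])
qed

section \<open>Full braids as paths of odd configurations\<close>

text \<open>All the configurations \<open>std n \<circ> g\<close> have the marked points as squares,
  so such a path squares to a full braid, and \<open>g\<close> records the permutation together with
  the signs.\<close>

definition bpath :: "nat \<Rightarrow> (real \<Rightarrow> int \<Rightarrow> complex) \<Rightarrow> (int \<Rightarrow> int) \<Rightarrow> bool" where
  "bpath n p g \<longleftrightarrow> path p \<and> path_image p \<subseteq> oddconf n \<and> p 0 = std n \<and> g \<in> signed_perms n \<and> p 1 = std n \<circ> g"

definition barcs :: "nat \<Rightarrow> (real \<Rightarrow> int \<Rightarrow> complex) \<Rightarrow> arcs" where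
  "barcs n p = arcs_of {..n} (sqm n \<circ> p)"

definition cl :: "nat \<Rightarrow> (real \<Rightarrow> int \<Rightarrow> complex) \<Rightarrow> arcs set" where
  "cl n p = cls (Suc n) (barcs n p)"

lemma dom_barcs [simp]: "dom (barcs n p) = {..n}"
  by (simp add: barcs_def)

lemma pth_barcs: "pth (barcs n p) = sqm n \<circ> p"
  by (auto simp: barcs_def pth_arcs_of fun_eq_iff sqm_def)

lemma
  assumes "bpath n p g"
  shows barc_barcs: "barc n (barcs n p)"
    and endp_barcs: "i \<le> n \<Longrightarrow> endp (barcs n p) i = nat \<bar>g (int i)\<bar>"
proof -
  have g: "g \<in> signed_perms n" using assms by (simp add: bpath_def)
  have e: "pth (barcs n p) 1 i = of_nat (nat \<bar>g (int i)\<bar>)" if "i \<le> n" for i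
    using that assms signed_permsD(4)[OF g, of "int i"]
    by (simp add: pth_barcs sqm_def bpath_def std_def sroot_power2)
  then show E: "endp (barcs n p) i = nat \<bar>g (int i)\<bar>" if "i \<le> n" for i
    using that by (intro endp_eqI) auto
  have "homotopic_paths (conf {..n}) (sqm n \<circ> p) (sqm n \<circ> p)"
    by (rule homotopic_paths_continuous_image[where S = "oddconf n"])
      (use assms in \<open>auto simp: bpath_def continuous_on_sqm sqm_in_conf\<close>)
  moreover have "pth (barcs n p) 0 i = of_nat i" "pth (barcs n p) 1 i \<in> of_nat ` {..<Suc n}" if "i \<le> n" for i
  proof -
    show "pth (barcs n p) 0 i = of_nat i"
      using that assms by (simp add: pth_barcs sqm_def bpath_def std_def sroot_power2)
    have "nat \<bar>g (int i)\<bar> < Suc n" using that signed_permsD(4)[OF g, of "int i"] by auto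
    then show "pth (barcs n p) 1 i \<in> of_nat ` {..<Suc n}" unfolding e[OF that] by (intro imageI) simp
  qed
  ultimately have "arc_system (Suc n) (barcs n p)"
    unfolding arc_system_iff by (auto simp: pth_barcs)
  then show "barc n (barcs n p)"
    using E[of 0] signed_permsD(3)[OF g] by (simp add: barc_def)
qed

lemma cl_in_Units: "bpath n p g \<Longrightarrow> cl n p \<in> Units (IB_B n)"
  unfolding Units_IB_B cl_def using barc_barcs by auto

lemma bpath_homotopic:
  assumes "bpath n p g" "homotopic_paths (oddconf n) p q"
  shows "bpath n q g" "cl n q = cl n p"
proof -
  show "bpath n q g"
    using assms(1) homotopic_paths_imp_path[OF assms(2)] homotopic_paths_imp_subset[OF assms(2)]
      homotopic_paths_imp_pathstart[OF assms(2)] homotopic_paths_imp_pathfinish[OF assms(2)]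
    by (auto simp: bpath_def pathstart_def pathfinish_def)
  have "(barcs n p, barcs n q) \<in> isotopy_rel (Suc n)"
  proof (rule isotopy_relI)
    show "homotopic_paths (conf (dom (barcs n p))) (pth (barcs n p)) (pth (barcs n q))"
      unfolding pth_barcs dom_barcs
      by (rule homotopic_paths_continuous_image[OF assms(2)]) (auto simp: continuous_on_sqm sqm_in_conf)
  qed (use barc_arc_system[OF barc_barcs[OF assms(1)]] in auto)
  then show "cl n q = cl n p" unfolding cl_def by (rule cls_eqI[symmetric])
qed

text \<open>The second path has to be translated by \<open>g\<close> to start where the first ends.
  After squaring, the translation is the renumbering made by stacking: string i continues as string
  |g i|, and the sign disappears.\<close>

lemma
  assumes p: "bpath n p g" and q: "bpath n q h"
  shows bpath_comp: "bpath n (p +++ (\<lambda>t. q t \<circ> g)) (h \<circ> g)"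
    and cl_comp: "cl n (p +++ (\<lambda>t. q t \<circ> g)) = cl n p \<otimes>\<^bsub>IB_B n\<^esub> cl n q"
proof -
  have g: "g \<in> signed_perms n" and h: "h \<in> signed_perms n" using p q by (auto simp: bpath_def)
  have "path (\<lambda>t. q t \<circ> g)" "path_image (\<lambda>t. q t \<circ> g) \<subseteq> oddconf n"
    using path_precomp[of q n g] q g by (auto simp: bpath_def)
  then show "bpath n (p +++ (\<lambda>t. q t \<circ> g)) (h \<circ> g)"
    using p q signed_perms_comp[OF g h] path_join_imp[of p "\<lambda>t. q t \<circ> g"]
      subset_path_image_join[of p "oddconf n" "\<lambda>t. q t \<circ> g"]
    unfolding bpath_def by (simp add: pathfinish_def pathstart_def joinpaths_def[of p] o_assoc)
  have "(stack (barcs n p) (barcs n q), barcs n (p +++ (\<lambda>t. q t \<circ> g))) \<in> isotopy_rel (Suc n)"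
  proof (rule isotopy_rel_pth_eqI)
    show "arc_system (Suc n) (stack (barcs n p) (barcs n q))"
      by (intro arc_system_stack barc_arc_system barc_barcs[OF p] barc_barcs[OF q])
    have s: "sdom (barcs n p) (barcs n q) = {..n}"
      using signed_permsD(4)[OF g] by (auto simp: sdom_def endp_barcs[OF p] nat_le_iff)
    then show "dom (stack (barcs n p) (barcs n q)) = dom (barcs n (p +++ (\<lambda>t. q t \<circ> g)))"
      by (simp add: dom_stack)
    have sq: "(q t \<bar>g (int i)\<bar>)\<^sup>2 = (q t (g (int i)))\<^sup>2" if "t \<in> {0..1}" for t i
    proof -
      have "q t \<in> oddconf n" using q that by (auto simp: bpath_def path_image_def)
      then have "q t (- g (int i)) = - q t (g (int i))" unfolding oddconf_def by blast
      then show ?thesis by (cases "g (int i) \<ge> 0") auto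
    qed
    fix t :: real and i assume "t \<in> {0..1}" "i \<in> dom (stack (barcs n p) (barcs n q))"
    then show "pth (stack (barcs n p) (barcs n q)) t i = pth (barcs n (p +++ (\<lambda>t. q t \<circ> g))) t i"
      using sq[of "2 * t - 1" i] signed_permsD(4)[OF g, of "int i"] unfolding dom_stack s
      by (simp add: pth_stack s pth_barcs joinpaths_def pull_def sqm_def endp_barcs[OF p] nat_le_iff)
  qed
  then show "cl n (p +++ (\<lambda>t. q t \<circ> g)) = cl n p \<otimes>\<^bsub>IB_B n\<^esub> cl n q"
    unfolding cl_def using barc_barcs[OF p] barc_barcs[OF q] cls_eqI by (metis mult_cls_B)
qed

lemma bpath_const: "bpath n (\<lambda>t. std n) id"
  by (auto simp: bpath_def path_def path_image_def std_in_oddconf)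

lemma cl_const: "cl n (\<lambda>t. std n) = \<one>\<^bsub>IB_B n\<^esub>"
proof -
  have "barcs n (\<lambda>t. std n) = trivial_arcs {..n}"
    by (auto simp: fun_eq_iff barcs_def arcs_of_def trivial_arcs_def sqm_def std_def sroot_power2)
  then show ?thesis by (simp add: cl_def one_IB_B)
qed

lemma
  assumes p: "bpath n p g"
  shows bpath_inv: "bpath n (\<lambda>t. reversepath p t \<circ> finv g) (finv g)"
    and cl_inv: "cl n p \<otimes>\<^bsub>IB_B n\<^esub> cl n (\<lambda>t. reversepath p t \<circ> finv g) = \<one>\<^bsub>IB_B n\<^esub>"
proof -
  have g: "g \<in> signed_perms n" using p by (auto simp: bpath_def)
  note i = signed_perms_inv[OF g]
  let ?q = "\<lambda>t. reversepath p t \<circ> finv g"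
  have "path (reversepath p)" "path_image (reversepath p) \<subseteq> oddconf n"
    using p by (auto simp: bpath_def)
  from path_precomp[OF this i(1)] show q: "bpath n ?q (finv g)"
    using p i by (auto simp: bpath_def reversepath_def o_assoc[symmetric])
  have "(\<lambda>t. ?q t \<circ> g) = reversepath p"
    using i by (auto simp: fun_eq_iff)
  moreover have "homotopic_paths (oddconf n) (p +++ reversepath p) (\<lambda>t. std n)"
    using p by (intro homotopic_paths_reversepath_right) (auto simp: bpath_def pathstart_def)
  ultimately show "cl n p \<otimes>\<^bsub>IB_B n\<^esub> cl n ?q = \<one>\<^bsub>IB_B n\<^esub>"
    using cl_comp[OF p q] bpath_homotopic(2)[OF bpath_comp[OF p q], of "\<lambda>t. std n"] cl_const by simp
qed

lemma conf_neq: "c \<in> conf A \<Longrightarrow> i \<in> A \<Longrightarrow> j \<in> A \<Longrightarrow> i \<noteq> j \<Longrightarrow> c i \<noteq> c j"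
  by (auto simp: conf_def inj_on_def)

section \<open>Square root lifts\<close>

text \<open>A relation, since the root \<open>w\<close> has to be found by lifting. The sign of
  \<open>x\<close> chooses the initial root, and the sign of \<open>y\<close> is the one carried to
  the lower end.\<close>

definition lift :: "arcs \<Rightarrow> int \<Rightarrow> int \<Rightarrow> bool" where
  "lift b x y \<longleftrightarrow> (\<exists>w. path w \<and> (\<forall>t\<in>{0..1}. (w t)\<^sup>2 = pth b t (nat \<bar>x\<bar>) - pth b t 0) \<and>
     w 0 = sroot x \<and> w 1 = sroot y)"

lemma strand_diff:
  assumes "barc n b" "i \<in> dom b" "i \<noteq> 0"
  shows "path (\<lambda>t. pth b t i - pth b t 0)" "path_image (\<lambda>t. pth b t i - pth b t 0) \<subseteq> - {0}"
proof -
  note as = barc_arc_system[OF assms(1)]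
  show "path (\<lambda>t. pth b t i - pth b t 0)"
    using arc_systemD(2)[OF as] by (auto simp: path_fun_iff path_def intro: continuous_on_diff)
  have "pth b t i \<noteq> pth b t 0" if "t \<in> {0..1}" for t
    using conf_neq[OF pth_in_conf[OF as that] assms(2) _ assms(3)] assms(1) by (simp add: barc_def)
  then show "path_image (\<lambda>t. pth b t i - pth b t 0) \<subseteq> - {0}"
    by (auto simp: path_image_def)
qed

text \<open>The difference of a string and the fixed string avoids 0, and squaring is a covering of
  the punctured plane, so the path lifts from the root \<open>sroot x\<close>.\<close>

lemma strand_lift:
  assumes "barc n b" "i \<in> dom b" "i \<noteq> 0" "\<bar>x\<bar> = int i"
  obtains w y where "path w" "\<forall>t\<in>{0..1}. (w t)\<^sup>2 = pth b t i - pth b t 0"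
    "w 0 = sroot x" "w 1 = sroot y" "\<bar>y\<bar> = int (endp b i)"
proof -
  note as = barc_arc_system[OF assms(1)]
  have b0: "0 \<in> dom b" "endp b 0 = 0" using assms(1) by (auto simp: barc_def)
  have start: "pth b 0 i - pth b 0 0 = (sroot x)\<^sup>2"
    using arc_systemD(4)[OF as] assms b0 by (simp add: sroot_power2)
  have "sroot x \<in> - {0}" using assms by (metis ComplI abs_0 of_nat_0_eq_iff singletonD sroot_0 sroot_eq_iff)
  then obtain w where w: "path w" "path_image w \<subseteq> - {0}" "pathstart w = sroot x"
    "\<And>t. t \<in> {0..1} \<Longrightarrow> (w t)\<^sup>2 = pth b t i - pth b t 0"
    using covering_space_lift_path_strong[OF covering_space_square_punctured_plane _
        strand_diff[OF assms(1-3)], of "sroot x"] start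
    by (auto simp: pathstart_def)
  \<comment> \<open>The square of the lift ends at a marked point, so the lift itself ends at one of
    the two signed roots of that point.\<close>
  have "(w 1)\<^sup>2 = (sroot (int (endp b i)))\<^sup>2"
    using w(4)[of 1] endp(1)[OF as] assms(2) b0 by (simp add: sroot_power2)
  then have "w 1 = sroot (int (endp b i)) \<or> w 1 = sroot (- int (endp b i))"
    by (simp add: power2_eq_iff)
  then obtain y where "w 1 = sroot y" "\<bar>y\<bar> = int (endp b i)"
    by (metis abs_minus_cancel abs_of_nat)
  with w show thesis using that[of w y] by (auto simp: pathstart_def)
qed

lemma lift_end:
  assumes "barc n b" "lift b x y" "nat \<bar>x\<bar> \<in> dom b"
  shows "nat \<bar>y\<bar> = endp b (nat \<bar>x\<bar>)"
proof -
  obtain w where "(w (1::real))\<^sup>2 = pth b 1 (nat \<bar>x\<bar>) - pth b 1 0" "w 1 = sroot y"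
    using assms(2) unfolding lift_def by (metis atLeastAtMost_iff order_refl zero_le_one)
  then have "(sroot y)\<^sup>2 = pth b 1 (nat \<bar>x\<bar>) - pth b 1 0" by simp
  also have "\<dots> = of_nat (endp b (nat \<bar>x\<bar>))"
    using endp(1)[OF barc_arc_system[OF assms(1)]] assms by (simp add: barc_def)
  finally show ?thesis by (simp add: sroot_power2 flip: of_nat_nat)
qed

lemma lift_minus: "lift b x y \<Longrightarrow> lift b (- x) (- y)"
  unfolding lift_def by (elim exE conjE, rule_tac x="\<lambda>t. - w t" in exI)
    (auto simp: path_def intro: continuous_on_minus)

text \<open>An isotopy induces a homotopy of difference paths in the punctured plane, and by
  monodromy lifts of homotopic paths with the same start have the same end.\<close>

lemma lift_isotopic:
  assumes "(b, b') \<in> isotopy_rel (Suc n)" "barc n b" "nat \<bar>x\<bar> \<in> dom b" "x \<noteq> 0"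
    and "lift b x y" "lift b' x y'"
  shows "y = y'"
proof -
  let ?i = "nat \<bar>x\<bar>"
  let ?D = "\<lambda>b t. pth b t ?i - pth b t 0"
  have b': "barc n b'" using barc_cong[OF assms(1,2)] .
  have d: "dom b' = dom b" using isotopy_relD(3)[OF assms(1)] .
  have i0: "?i \<noteq> 0" using assms(4) by simp
  note s = strand_diff[OF assms(2,3) i0] strand_diff[OF b', unfolded d, OF assms(3) i0]
  obtain w where w: "path w" "\<And>t. t \<in> {0..1} \<Longrightarrow> (w t)\<^sup>2 = ?D b t" "w 0 = sroot x" "w 1 = sroot y"
    using assms(5) unfolding lift_def by blast
  obtain w' where w': "path w'" "\<And>t. t \<in> {0..1} \<Longrightarrow> (w' t)\<^sup>2 = ?D b' t" "w' 0 = sroot x" "w' 1 = sroot y'"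
    using assms(6) unfolding lift_def by blast
  have "homotopic_paths (- {0}) ((\<lambda>c. c ?i - c 0) \<circ> pth b) ((\<lambda>c. c ?i - c 0) \<circ> pth b')"
  proof (rule homotopic_paths_continuous_image[OF isotopy_relD(4)[OF assms(1)]])
    show "continuous_on (conf (dom b)) (\<lambda>c. c ?i - c 0)"
      by (intro continuous_on_diff) (auto intro: continuous_on_subset[OF continuous_on_product_coordinates])
    show "(\<lambda>c. c ?i - c 0) \<in> conf (dom b) \<rightarrow> - {0}"
      using conf_neq[OF _ assms(3) _ i0] assms(2) by (simp add: barc_def)
  qed
  then have "homotopic_paths (- {0}) (?D b) (?D b')" by (simp add: o_def)
  moreover have "path_image w \<subseteq> - {0}" "path_image w' \<subseteq> - {0}"
    using w(2) w'(2) s(2,4) by (fastforce simp: path_image_def)+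
  ultimately have "pathfinish w = pathfinish w'"
    using w w' s by (intro covering_space_monodromy[OF covering_space_square_punctured_plane, of "?D b" "?D b'" w w'])
      (auto simp: pathstart_def)
  then show ?thesis using w w' by (simp add: pathfinish_def)
qed

lemma lift_unique:
  assumes "barc n b" "nat \<bar>x\<bar> \<in> dom b" "x \<noteq> 0" "lift b x y" "lift b x y'"
  shows "y = y'"
  using lift_isotopic[OF isotopy_rel_refl[OF barc_arc_system]] assms by blast

lemma lift_exists:
  assumes "barc n b" "nat \<bar>x\<bar> \<in> dom b" "x \<noteq> 0"
  shows "\<exists>y. lift b x y"
proof -
  have "nat \<bar>x\<bar> \<noteq> 0" "\<bar>x\<bar> = int (nat \<bar>x\<bar>)" using assms(3) by auto
  then obtain w y where "path w" "\<forall>t\<in>{0..1}. (w t)\<^sup>2 = pth b t (nat \<bar>x\<bar>) - pth b t 0"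
    "w 0 = sroot x" "w 1 = sroot y"
    by (rule strand_lift[OF assms(1,2)])
  then show ?thesis
    unfolding lift_def by blast
qed

lemma lift_stack:
  assumes a: "barc n a" and b: "barc n b" and x: "nat \<bar>x\<bar> \<in> dom a" "nat \<bar>y\<bar> \<in> dom b" "x \<noteq> 0"
    and "lift a x y" "lift b y z"
  shows "lift (stack a b) x z"
proof -
  obtain u where u: "path u" "\<And>t. t \<in> {0..1} \<Longrightarrow> (u t)\<^sup>2 = pth a t (nat \<bar>x\<bar>) - pth a t 0"
    "u 0 = sroot x" "u 1 = sroot y"
    using assms(6) unfolding lift_def by blast
  obtain v where v: "path v" "\<And>t. t \<in> {0..1} \<Longrightarrow> (v t)\<^sup>2 = pth b t (nat \<bar>y\<bar>) - pth b t 0"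
    "v 0 = sroot y" "v 1 = sroot z"
    using assms(7) unfolding lift_def by blast
  have e: "endp a (nat \<bar>x\<bar>) = nat \<bar>y\<bar>" using lift_end[OF a assms(6) x(1)] by simp
  have s: "nat \<bar>x\<bar> \<in> sdom a b" "0 \<in> sdom a b"
    using x e a b by (auto simp: sdom_def barc_def)
  show ?thesis unfolding lift_def
  proof (intro exI[of _ "u +++ v"] conjI ballI)
    show "path (u +++ v)" using u v by (intro path_join_imp) (auto simp: pathfinish_def pathstart_def)
    show "((u +++ v) t)\<^sup>2 = pth (stack a b) t (nat \<bar>x\<bar>) - pth (stack a b) t 0" if "t \<in> {0..1}" for t
      using that u(2)[of "2 * t"] v(2)[of "2 * t - 1"] s e a
      by (simp add: pth_stack joinpaths_def pull_def barc_def)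
  qed (use u v in \<open>auto simp: joinpaths_def\<close>)
qed

text \<open>The coordinate \<open>x\<close> of the path of odd configurations is itself the required
  square root.\<close>

lemma lift_barcs:
  assumes "bpath n p g" "\<bar>x\<bar> \<le> int n"
  shows "lift (barcs n p) x (g x)"
  unfolding lift_def
proof (intro exI[of _ "\<lambda>t. p t x"] conjI ballI)
  have g: "g \<in> signed_perms n" using assms by (auto simp: bpath_def)
  show "path (\<lambda>t. p t x)" using assms by (simp add: bpath_def path_fun_iff)
  show "p 0 x = sroot x" "p 1 x = sroot (g x)"
    using assms signed_permsD(4)[OF g, of x] by (auto simp: bpath_def std_def)
  fix t :: real assume "t \<in> {0..1}"
  then have t: "p t \<in> oddconf n" using assms by (auto simp: bpath_def path_image_def)
  then have "p t (- x) = - p t x" unfolding oddconf_def by blast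
  then have "(p t \<bar>x\<bar>)\<^sup>2 = (p t x)\<^sup>2" by (cases "x \<ge> 0") auto
  then show "(p t x)\<^sup>2 = pth (barcs n p) t (nat \<bar>x\<bar>) - pth (barcs n p) t 0"
    using assms(2) oddconf_0[OF t] by (simp add: pth_barcs sqm_def)
qed

text \<open>Injectivity of a configuration is invariant under translation, so the fixed string may
  be straightened gradually; the ends do not move because it starts and ends at 0.\<close>

lemma translate_arcs:
  assumes b: "barc n b"
  shows "(b, arcs_of (dom b) (\<lambda>t i. pth b t i - pth b t 0)) \<in> isotopy_rel (Suc n)"
proof (rule isotopy_relI)
  note as = barc_arc_system[OF b]
  define h where "h = (\<lambda>z i. if i \<in> dom b then pth b (snd z) i - of_real (fst z) * pth b (snd z) 0 else 0)"
  have p: "continuous_on {0..1} (\<lambda>t. pth b t i)" for i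
    using arc_systemD(2)[OF as] by (auto simp: path_fun_iff path_def)
  have "0 \<in> dom b" "endp b 0 = 0" using b by (auto simp: barc_def)
  then have z: "pth b 0 0 = 0" "pth b 1 0 = 0" using arc_systemD(4)[OF as] endp(1)[OF as] by auto
  show "homotopic_paths (conf (dom b)) (pth b) (pth (arcs_of (dom b) (\<lambda>t i. pth b t i - pth b t 0)))"
  proof (rule homotopic_pathsI[of h])
    show "continuous_on ({0..1} \<times> {0..1}) h"
    proof (rule continuous_on_coordinatewise_then_product)
      show "continuous_on ({0..1} \<times> {0..1}) (\<lambda>z. h z i)" for i
        by (cases "i \<in> dom b") (auto simp: h_def intro!: continuous_intros continuous_on_compose2[OF p])
    qed
    show "h (s, t) \<in> conf (dom b)" if "s \<in> {0..1}" "t \<in> {0..1}" for s t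
      using pth_in_conf[OF as that(2)] by (auto simp: h_def conf_def inj_on_def)
  qed (auto simp: h_def fun_eq_iff pth_arcs_of pth_notin z)
qed (use barc_arc_system[OF b] in auto)

text \<open>The lifts that start at the positive roots are extended oddly. The squares recover the
  strings, which separates indices of different absolute value. The result represents the braid with
  its fixed string straightened.\<close>

lemma Units_eq_cl:
  assumes "X \<in> Units (IB_B n)"
  obtains p g where "bpath n p g" "X = cl n p"
proof -
  obtain b where b: "X = cls (Suc n) b" "barc n b" "dom b = {..n}"
    using assms unfolding Units_IB_B by auto
  note as = barc_arc_system[OF b(2)]
  have "\<exists>w y. path w \<and> (\<forall>t\<in>{0..1}. (w t)\<^sup>2 = pth b t i - pth b t 0) \<and> w 0 = sroot (int i) \<and>
      w 1 = sroot y \<and> \<bar>y\<bar> = int (endp b i)" if "i \<in> {1..n}" for i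
  proof -
    have "i \<in> dom b" "i \<noteq> 0" "\<bar>int i\<bar> = int i" using that b(3) by auto
    then obtain w y where "path w" "\<forall>t\<in>{0..1}. (w t)\<^sup>2 = pth b t i - pth b t 0"
      "w 0 = sroot (int i)" "w 1 = sroot y" "\<bar>y\<bar> = int (endp b i)"
      by (rule strand_lift[OF b(2)])
    then show ?thesis by blast
  qed
  then have "\<forall>i\<in>{1..n}. \<exists>w y. path w \<and> (\<forall>t\<in>{0..1}. (w t)\<^sup>2 = pth b t i - pth b t 0) \<and>
      w 0 = sroot (int i) \<and> w 1 = sroot y \<and> \<bar>y\<bar> = int (endp b i)" ..
  from bchoice[OF this] obtain w where "\<forall>i\<in>{1..n}. \<exists>y. path (w i) \<and>
      (\<forall>t\<in>{0..1}. (w i t)\<^sup>2 = pth b t i - pth b t 0) \<and>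
      w i 0 = sroot (int i) \<and> w i 1 = sroot y \<and> \<bar>y\<bar> = int (endp b i)" ..
  from bchoice[OF this] obtain y where "\<forall>i\<in>{1..n}. path (w i) \<and>
      (\<forall>t\<in>{0..1}. (w i t)\<^sup>2 = pth b t i - pth b t 0) \<and>
      w i 0 = sroot (int i) \<and> w i 1 = sroot (y i) \<and> \<bar>y i\<bar> = int (endp b i)" ..
  then have w: "\<And>i. i \<in> {1..n} \<Longrightarrow> path (w i)"
    "\<And>i t. i \<in> {1..n} \<Longrightarrow> t \<in> {0..1} \<Longrightarrow> (w i t)\<^sup>2 = pth b t i - pth b t 0"
    "\<And>i. i \<in> {1..n} \<Longrightarrow> w i 0 = sroot (int i)" "\<And>i. i \<in> {1..n} \<Longrightarrow> w i 1 = sroot (y i)"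
    "\<And>i. i \<in> {1..n} \<Longrightarrow> \<bar>y i\<bar> = int (endp b i)"
    by blast+
  define g where "g = (\<lambda>x. if x \<noteq> 0 \<and> \<bar>x\<bar> \<le> int n then sgn x * y (nat \<bar>x\<bar>) else x)"
  define p where "p = (\<lambda>t x. if x \<noteq> 0 \<and> \<bar>x\<bar> \<le> int n then of_int (sgn x) * w (nat \<bar>x\<bar>) t else 0)"
  have np: "nat \<bar>x\<bar> \<in> {1..n}" if "x \<noteq> 0" "\<bar>x\<bar> \<le> int n" for x using that by auto
  have ag: "\<bar>g x\<bar> = int (endp b (nat \<bar>x\<bar>))" if "\<bar>x\<bar> \<le> int n" for x
  proof (cases "x = 0")
    case True then show ?thesis using b(2) by (simp add: g_def barc_def)
  next
    case False then show ?thesis using w(5)[OF np[OF False that]] that by (simp add: g_def abs_mult)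
  qed
  have gi: "\<bar>x\<bar> = \<bar>x'\<bar>" if "\<bar>x\<bar> \<le> int n" "\<bar>x'\<bar> \<le> int n" "\<bar>g x\<bar> = \<bar>g x'\<bar>" for x x'
  proof -
    have "endp b (nat \<bar>x\<bar>) = endp b (nat \<bar>x'\<bar>)"
      using ag[OF that(1)] ag[OF that(2)] that(3) by linarith
    then have "nat \<bar>x\<bar> = nat \<bar>x'\<bar>"
      using inj_on_eq_iff[OF inj_on_endp[OF as], of "nat \<bar>x\<bar>" "nat \<bar>x'\<bar>"] that(1,2) b(3) by auto
    then show ?thesis by simp
  qed
  have gm: "g (- x) = - g x" for x by (simp add: g_def)
  have gp: "g \<in> signed_perms n"
  proof -
    have "inj_on g {- int n..int n}"
    proof (rule inj_onI)
      fix x x' assume xx: "x \<in> {- int n..int n}" "x' \<in> {- int n..int n}" "g x = g x'"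
      then have "\<bar>x\<bar> = \<bar>x'\<bar>" by (intro gi[of x x']) auto
      then consider "x = x'" | "x = - x'" by linarith
      then show "x = x'"
      proof cases
        \<comment> \<open>By oddness, equal values at opposite indices force the value 0, which is
          taken at the index 0 alone.\<close>
        case 2
        then have "g x = 0" using gm[of x'] xx by simp
        moreover have "g 0 = 0" by (simp add: g_def)
        ultimately have "\<bar>x\<bar> = \<bar>0::int\<bar>" using xx by (intro gi[of x 0]) auto
        then show ?thesis using 2 by simp
      qed
    qed
    moreover have "g ` {- int n..int n} \<subseteq> {- int n..int n}"
    proof clarify
      fix x assume "x \<in> {- int n..int n}"
      then have "\<bar>x\<bar> \<le> int n" "nat \<bar>x\<bar> \<in> dom b" using b(3) by auto
      then have "\<bar>g x\<bar> \<le> int n" using ag[of x] endp(2)[OF as, of "nat \<bar>x\<bar>"] by linarith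
      then show "g x \<in> {- int n..int n}" by auto
    qed
    ultimately have "bij_betw g {- int n..int n} {- int n..int n}"
      by (simp add: bij_betw_def endo_inj_surj)
    moreover have "g x = x" if "x \<notin> {- int n..int n}" for x
      using that by (auto simp: g_def)
    ultimately have "g permutes {- int n..int n}" by (rule bij_imp_permutes)
    then show ?thesis using gm by (simp add: signed_perms_def)
  qed
  have psq: "(p t x)\<^sup>2 = pth b t (nat \<bar>x\<bar>) - pth b t 0" if "t \<in> {0..1}" "\<bar>x\<bar> \<le> int n" for t x
    using w(2)[OF np, of x t] that by (cases "x = 0") (auto simp: p_def power_mult_distrib sgn_if)
  have pm: "p t (- x) = - p t x" for t x by (simp add: p_def)
  have pX: "p t \<in> oddconf n" if t: "t \<in> {0..1}" for t
  proof -
    have inj: "inj_on (pth b t) {..n}" using pth_in_conf[OF as t] b(3) by (simp add: conf_def)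
    have sq: "\<bar>x\<bar> = \<bar>x'\<bar>" if "\<bar>x\<bar> \<le> int n" "\<bar>x'\<bar> \<le> int n" "(p t x)\<^sup>2 = (p t x')\<^sup>2" for x x'
    proof -
      have "pth b t (nat \<bar>x\<bar>) = pth b t (nat \<bar>x'\<bar>)" using psq t that by simp
      then have "nat \<bar>x\<bar> = nat \<bar>x'\<bar>" using inj_on_eq_iff[OF inj, of "nat \<bar>x\<bar>" "nat \<bar>x'\<bar>"] that(1,2) by auto
      then show ?thesis by simp
    qed
    have "inj_on (p t) {- int n..int n}"
    proof (rule inj_onI)
      fix x x' assume xx: "x \<in> {- int n..int n}" "x' \<in> {- int n..int n}" "p t x = p t x'"
      then have "\<bar>x\<bar> = \<bar>x'\<bar>" by (intro sq[of x x']) auto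
      then consider "x = x'" | "x = - x'" by linarith
      then show "x = x'"
      proof cases
        case 2
        then have "p t x = 0" using pm[of t x'] xx by simp
        then have "\<bar>x\<bar> = \<bar>0::int\<bar>" using xx by (intro sq[of x 0]) (auto simp: p_def)
        then show ?thesis using 2 by simp
      qed
    qed
    then show ?thesis using pm by (auto simp: oddconf_def p_def)
  qed
  have "path (\<lambda>t. p t x)" for x
    using w(1)[OF np[of x]] unfolding p_def path_def
    by (cases "x \<noteq> 0 \<and> \<bar>x\<bar> \<le> int n") (auto intro!: continuous_intros)
  then have "path p" by (simp add: path_fun_iff)
  moreover have "p 0 = std n"
    using w(3)[OF np] by (auto simp: fun_eq_iff p_def std_def sroot_def abs_mult sgn_mult)
  moreover have "p 1 = std n \<circ> g"
  proof
    fix x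
    have *: "of_int (sgn x) * sroot y = sroot (sgn x * y)" if "x \<noteq> 0" for y
      using that by (auto simp: sgn_if)
    show "p 1 x = (std n \<circ> g) x"
      using w(4)[OF np, of x] signed_permsD(4)[OF gp, of x] *
      by (auto simp: p_def std_def g_def)
  qed
  ultimately have bp: "bpath n p g" using pX gp by (auto simp: bpath_def path_image_def)
  note translate_arcs[OF b(2)]
  also have "(arcs_of (dom b) (\<lambda>t i. pth b t i - pth b t 0), barcs n p) \<in> isotopy_rel (Suc n)"
    using isotopy_relD(2)[OF translate_arcs[OF b(2)]] psq[of _ "int _"] b(3)
    by (intro isotopy_rel_pth_eqI) (auto simp: pth_barcs pth_arcs_of sqm_def)
  finally have "X = cl n p" unfolding b(1) cl_def by (rule cls_eqI)
  then show thesis using that bp by blast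
qed

section \<open>Signed partial permutations\<close>

text \<open>The conditions in terms of graphs. Oddness in one direction is enough for the symmetry
  of the domain, as negation is an involution.\<close>

lemma carrier_I_B:
  "s \<in> carrier (I_B n) \<longleftrightarrow>
     (\<forall>x y. s x = Some y \<longrightarrow> x \<in> SN n \<and> y \<in> SN n \<and> s (- x) = Some (- y)) \<and>
     (\<forall>x x' y. s x = Some y \<longrightarrow> s x' = Some y \<longrightarrow> x = x')" (is "?L \<longleftrightarrow> ?R")
proof
  assume L: ?L
  then have s: "dom s \<subseteq> SN n" "ran s \<subseteq> SN n" "inj_on s (dom s)" "\<And>x. x \<in> dom s \<longleftrightarrow> - x \<in> dom s"
    "\<And>x. x \<in> dom s \<Longrightarrow> the (s (- x)) = - the (s x)"
    by (auto simp: I_B_def)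
  have "s (- x) = Some (- y)" if "s x = Some y" for x y
    using s(4,5)[of x] that by (auto simp: dom_def)
  moreover have "x = x'" if "s x = Some y" "s x' = Some y" for x x' y
    using inj_onD[OF s(3), of x x'] that by (simp add: domI)
  moreover have "x \<in> SN n" "y \<in> SN n" if "s x = Some y" for x y
    using subsetD[OF s(1) domI[of s, OF that]] subsetD[OF s(2) ranI[of s, OF that]] by auto
  ultimately show ?R by simp
next
  assume R: ?R
  have "inj_on s (dom s)" using R by (intro inj_onI) (auto simp: dom_def)
  moreover have "x \<in> dom s \<longleftrightarrow> - x \<in> dom s" for x
  proof -
    have "- x \<in> dom s" if "x \<in> dom s" for x using R that by (auto simp: dom_def)
    from this[of x] this[of "- x"] show ?thesis by auto
  qed
  moreover have "the (s (- x)) = - the (s x)" if "x \<in> dom s" for x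
    using R that by (auto simp: dom_def)
  ultimately show ?L using R by (auto simp: I_B_def dom_def ran_def)
qed

lemma I_B_simps [simp]:
  "a \<otimes>\<^bsub>I_B n\<^esub> b = b \<circ>\<^sub>m a" "\<one>\<^bsub>I_B n\<^esub> = (\<lambda>x. if x \<in> SN n then Some x else None)"
  by (simp_all add: I_B_def)

lemma map_comp_eq_Some: "(b \<circ>\<^sub>m a) x = Some z \<longleftrightarrow> (\<exists>y. a x = Some y \<and> b y = Some z)"
  by (rule map_comp_Some_iff)

lemma map_eqI: "(\<And>x y. f x = Some y \<longleftrightarrow> g x = Some y) \<Longrightarrow> f = g"
  by (rule ext) (metis option.exhaust)

lemma monoid_I_B: "monoid (I_B n)"
proof (rule monoidI)
  fix a b assume "a \<in> carrier (I_B n)" "b \<in> carrier (I_B n)"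
  then show "a \<otimes>\<^bsub>I_B n\<^esub> b \<in> carrier (I_B n)"
    unfolding carrier_I_B I_B_simps map_comp_eq_Some by blast
next
  show "\<one>\<^bsub>I_B n\<^esub> \<in> carrier (I_B n)"
    unfolding carrier_I_B by (auto simp: SN_def split: if_splits)
next
  fix a b c
  show "a \<otimes>\<^bsub>I_B n\<^esub> b \<otimes>\<^bsub>I_B n\<^esub> c = a \<otimes>\<^bsub>I_B n\<^esub> (b \<otimes>\<^bsub>I_B n\<^esub> c)"
    by (rule map_eqI) (auto simp: map_comp_eq_Some)
next
  fix a assume a: "a \<in> carrier (I_B n)"
  show "\<one>\<^bsub>I_B n\<^esub> \<otimes>\<^bsub>I_B n\<^esub> a = a" "a \<otimes>\<^bsub>I_B n\<^esub> \<one>\<^bsub>I_B n\<^esub> = a"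
    using a unfolding carrier_I_B by (intro map_eqI; auto simp: map_comp_eq_Some split: if_splits)+
qed

definition pinv :: "(int \<rightharpoonup> int) \<Rightarrow> int \<rightharpoonup> int" where
  "pinv s y = (if \<exists>x. s x = Some y then Some (THE x. s x = Some y) else None)"

lemma pinv_eq_Some:
  assumes "s \<in> carrier (I_B n)"
  shows "pinv s y = Some x \<longleftrightarrow> s x = Some y"
proof -
  have "(THE x. s x = Some y) = x" if "s x = Some y" for x
    using assms that unfolding carrier_I_B by (intro the_equality) blast+
  then show ?thesis by (auto simp: pinv_def)
qed

lemma pinv_in_carrier:
  assumes "s \<in> carrier (I_B n)"
  shows "pinv s \<in> carrier (I_B n)"
  using assms unfolding carrier_I_B pinv_eq_Some[OF assms] by simp

lemma inverse_monoid_I_B: "inverse_monoid (I_B n)"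
proof (rule inverse_monoidI[OF monoid_I_B])
  fix a assume a: "a \<in> carrier (I_B n)"
  have "a \<otimes>\<^bsub>I_B n\<^esub> pinv a \<otimes>\<^bsub>I_B n\<^esub> a = a"
  proof (rule map_eqI)
    fix x y
    show "(a \<otimes>\<^bsub>I_B n\<^esub> pinv a \<otimes>\<^bsub>I_B n\<^esub> a) x = Some y \<longleftrightarrow> a x = Some y"
      using a unfolding I_B_simps map_comp_eq_Some pinv_eq_Some[OF a] carrier_I_B by metis
  qed
  then show "\<exists>b\<in>carrier (I_B n). a \<otimes>\<^bsub>I_B n\<^esub> b \<otimes>\<^bsub>I_B n\<^esub> a = a"
    using pinv_in_carrier[OF a] by blast
next
  \<comment> \<open>If an idempotent sends x to y, it also sends y to y, and injectivity gives x =
    y: idempotents are partial identities.\<close>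
  have *: "x = y" if "e \<in> carrier (I_B n)" "e \<otimes>\<^bsub>I_B n\<^esub> e = e" "e x = Some y" for e x y
  proof -
    have "(e \<circ>\<^sub>m e) x = Some y" using that by simp
    then have "e y = Some y" using that(3) by (simp add: map_comp_def)
    then show ?thesis using that(1,3) unfolding carrier_I_B by blast
  qed
  fix e f assume e: "e \<in> carrier (I_B n)" "e \<otimes>\<^bsub>I_B n\<^esub> e = e" and f: "f \<in> carrier (I_B n)" "f \<otimes>\<^bsub>I_B n\<^esub> f = f"
  show "e \<otimes>\<^bsub>I_B n\<^esub> f = f \<otimes>\<^bsub>I_B n\<^esub> e"
  proof (rule map_eqI)
    show "(e \<otimes>\<^bsub>I_B n\<^esub> f) x = Some y \<longleftrightarrow> (f \<otimes>\<^bsub>I_B n\<^esub> e) x = Some y" for x y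
      using *[OF e] *[OF f] unfolding I_B_simps map_comp_eq_Some by metis
  qed
qed

lemma Units_I_B: "Units (I_B n) = {s \<in> carrier (I_B n). dom s = SN n \<and> ran s = SN n}"
proof (intro equalityI subsetI)
  fix s assume "s \<in> Units (I_B n)"
  then obtain t where s: "s \<in> carrier (I_B n)" and st: "t \<circ>\<^sub>m s = \<one>\<^bsub>I_B n\<^esub>" "s \<circ>\<^sub>m t = \<one>\<^bsub>I_B n\<^esub>"
    by (auto simp: Units_def)
  have "x \<in> dom s \<and> x \<in> ran s" if "x \<in> SN n" for x
  proof -
    have "(t \<circ>\<^sub>m s) x = Some x" "(s \<circ>\<^sub>m t) x = Some x" using st that by auto
    then show ?thesis unfolding map_comp_eq_Some by (auto simp: dom_def ran_def)
  qed
  then show "s \<in> {s \<in> carrier (I_B n). dom s = SN n \<and> ran s = SN n}"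
    using s unfolding carrier_I_B by (auto simp: dom_def ran_def)
next
  fix s assume "s \<in> {s \<in> carrier (I_B n). dom s = SN n \<and> ran s = SN n}"
  then have s: "s \<in> carrier (I_B n)" and d: "\<And>x. x \<in> SN n \<longleftrightarrow> (\<exists>y. s x = Some y)"
    "\<And>y. y \<in> SN n \<longleftrightarrow> (\<exists>x. s x = Some y)"
    by (auto simp: dom_def ran_def)
  have "s \<otimes>\<^bsub>I_B n\<^esub> pinv s = \<one>\<^bsub>I_B n\<^esub>"
  proof (rule map_eqI)
    show "(s \<otimes>\<^bsub>I_B n\<^esub> pinv s) x = Some y \<longleftrightarrow> \<one>\<^bsub>I_B n\<^esub> x = Some y" for x y
      using s unfolding I_B_simps map_comp_eq_Some pinv_eq_Some[OF s] carrier_I_B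
      by (auto simp: d(1))
  qed
  moreover have "pinv s \<otimes>\<^bsub>I_B n\<^esub> s = \<one>\<^bsub>I_B n\<^esub>"
  proof (rule map_eqI)
    show "(pinv s \<otimes>\<^bsub>I_B n\<^esub> s) x = Some y \<longleftrightarrow> \<one>\<^bsub>I_B n\<^esub> x = Some y" for x y
      unfolding I_B_simps map_comp_eq_Some pinv_eq_Some[OF s] by (auto simp: d(2))
  qed
  ultimately show "s \<in> Units (I_B n)"
    unfolding Units_def using s pinv_in_carrier[OF s] by blast
qed

lemma units_of_I_B: "units_of (I_B n) = W_B n"
  unfolding units_of_def Units_I_B W_B_def by (simp add: I_B_def)

definition smap :: "nat \<Rightarrow> (int \<Rightarrow> int) \<Rightarrow> int \<rightharpoonup> int" where
  "smap n g = (\<lambda>x. if x \<in> SN n then Some (g x) else None)"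

text \<open>Surjectivity onto the Weyl group is shown with total signed permutations, so elements
  given as partial maps are extended by the identity.\<close>

lemma W_B_smap:
  assumes "s \<in> carrier (W_B n)"
  obtains g where "g \<in> signed_perms n" "s = smap n g"
proof -
  have s: "s \<in> carrier (I_B n)" and d: "dom s = SN n"
    using assms by (auto simp: W_B_def)
  define g where "g = (\<lambda>x. case s x of None \<Rightarrow> x | Some y \<Rightarrow> y)"
  have gs: "g x \<in> SN n \<and> s x = Some (g x) \<and> g (- x) = - g x" if "x \<in> SN n" for x
    using that d s unfolding carrier_I_B g_def by (auto simp: dom_def split: option.splits)
  have gn: "g x = x" if "x \<notin> SN n" for x
    using that d unfolding g_def by (auto simp: dom_def split: option.splits)
  have inj: "inj_on g (SN n)"
  proof (rule inj_onI)
    fix x y assume "x \<in> SN n" "y \<in> SN n" "g x = g y"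
    then have "s x = Some (g x)" "s y = Some (g x)" using gs by auto
    then show "x = y" using s unfolding carrier_I_B by blast
  qed
  have fin: "finite (SN n)"
    by (rule finite_subset[of _ "{- int n..int n}"]) (auto simp: SN_def)
  have "bij_betw g (SN n) (SN n)"
    using inj gs endo_inj_surj[OF fin _ inj] by (auto simp: bij_betw_def)
  then have "g permutes SN n" using gn by (rule bij_imp_permutes)
  then have "g permutes {- int n..int n}"
    by (rule permutes_subset) (auto simp: SN_def)
  moreover have "g (- x) = - g x" for x
    using gs[of x] gn[of x] gn[of "- x"] by (cases "x \<in> SN n") (auto simp: SN_def)
  moreover have "s = smap n g"
    using gs d by (auto simp: smap_def fun_eq_iff domIff)
  ultimately show thesis using that by (auto simp: signed_perms_def)
qed

section \<open>The homomorphism\<close>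

text \<open>A homomorphism carries the two equations that characterise the generalised inverse into
  the target, where they have a unique solution.\<close>

lemma inverse_monoid_homI:
  assumes "inverse_monoid M" "inverse_monoid N" "h \<in> hom M N" "h \<one>\<^bsub>M\<^esub> = \<one>\<^bsub>N\<^esub>"
  shows "inverse_monoid_hom M N h"
  unfolding inverse_monoid_hom_def
proof (intro conjI ballI assms)
  fix a assume a: "a \<in> carrier M"
  let ?P = "\<lambda>M a b. b \<in> carrier M \<and> a = a \<otimes>\<^bsub>M\<^esub> b \<otimes>\<^bsub>M\<^esub> a \<and> b = b \<otimes>\<^bsub>M\<^esub> a \<otimes>\<^bsub>M\<^esub> b"
  interpret M: monoid M using assms(1) by (simp add: inverse_monoid_def)
  note hm = hom_mult[OF assms(3)] and hc = hom_in_carrier[OF assms(3)]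
  have ex: "\<exists>!b. ?P M a b" using assms(1) a by (simp add: inverse_monoid_def)
  then obtain b where P: "?P M a b" by blast
  then have g: "gen_inv M a = b" unfolding gen_inv_def using ex by (intro the1_equality)
  from P have b: "b \<in> carrier M" "a \<otimes>\<^bsub>M\<^esub> b \<otimes>\<^bsub>M\<^esub> a = a" "b \<otimes>\<^bsub>M\<^esub> a \<otimes>\<^bsub>M\<^esub> b = b" by auto
  have "h (a \<otimes>\<^bsub>M\<^esub> b \<otimes>\<^bsub>M\<^esub> a) = h a \<otimes>\<^bsub>N\<^esub> h b \<otimes>\<^bsub>N\<^esub> h a"
    "h (b \<otimes>\<^bsub>M\<^esub> a \<otimes>\<^bsub>M\<^esub> b) = h b \<otimes>\<^bsub>N\<^esub> h a \<otimes>\<^bsub>N\<^esub> h b"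
    using a b(1) by (simp_all add: hm)
  then have "?P N (h a) (h b)" unfolding b(2,3) using hc[OF b(1)] by blast
  moreover have "\<exists>!b. ?P N (h a) b" using assms(2) hc[OF a] by (simp add: inverse_monoid_def)
  ultimately have "gen_inv N (h a) = h b"
    unfolding gen_inv_def by (intro the1_equality)
  then show "h (gen_inv M a) = gen_inv N (h a)" using g by simp
qed

definition rho_arcs :: "arcs \<Rightarrow> int \<rightharpoonup> int" where
  "rho_arcs b x = (if x \<noteq> 0 \<and> nat \<bar>x\<bar> \<in> dom b then Some (THE y. lift b x y) else None)"

text \<open>The chosen representative does not matter, by \<open>rho_cls\<close>.\<close>

definition rho :: "arcs set \<Rightarrow> int \<rightharpoonup> int" where
  "rho X = rho_arcs (SOME b. b \<in> X)"

lemma rho_arcs_eq_Some: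
  assumes "barc n b"
  shows "rho_arcs b x = Some y \<longleftrightarrow> x \<noteq> 0 \<and> nat \<bar>x\<bar> \<in> dom b \<and> lift b x y"
proof -
  show ?thesis
  proof (cases "x \<noteq> 0 \<and> nat \<bar>x\<bar> \<in> dom b")
    case True
    then obtain z where z: "lift b x z" using lift_exists[OF assms] by blast
    then have u: "lift b x y \<longleftrightarrow> y = z" for y using lift_unique[OF assms] True by blast
    then have "(THE y. lift b x y) = z" by simp
    then show ?thesis using True u by (auto simp: rho_arcs_def)
  qed (auto simp: rho_arcs_def)
qed

lemma rho_cls:
  assumes b: "barc n b"
  shows "rho (cls (Suc n) b) = rho_arcs b"
proof -
  have "rho_arcs b' = rho_arcs b" if b': "b' \<in> cls (Suc n) b" for b'
  proof (rule map_eqI)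
    fix x y
    have r: "(b, b') \<in> isotopy_rel (Suc n)" using b' by (simp add: cls_def)
    note d = isotopy_relD(3)[OF r] and bb = barc_cong[OF r b]
    have "lift b' x y \<longleftrightarrow> lift b x y" if x: "x \<noteq> 0" "nat \<bar>x\<bar> \<in> dom b"
      using lift_exists[OF b x(2,1)] lift_exists[OF bb, unfolded d, OF x(2,1)]
        lift_isotopic[OF r b x(2,1)] by blast
    then show "rho_arcs b' x = Some y \<longleftrightarrow> rho_arcs b x = Some y"
      unfolding rho_arcs_eq_Some[OF b] rho_arcs_eq_Some[OF bb] d by blast
  qed
  moreover have "b \<in> cls (Suc n) b"
    using isotopy_rel_refl[OF barc_arc_system[OF b]] by (simp add: cls_def)
  ultimately show ?thesis
    unfolding rho_def by (metis someI)
qed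

text \<open>The absolute value of an image is the end index of the string, so points with the same
  image can differ only by sign; opposite points have opposite images, and these differ because no
  other string ends at the point 0.\<close>

lemma rho_arcs_in_carrier:
  assumes b: "barc n b"
  shows "rho_arcs b \<in> carrier (I_B n)"
  unfolding carrier_I_B rho_arcs_eq_Some[OF b]
proof (intro conjI allI impI)
  note as = barc_arc_system[OF b]
  fix x y assume xy: "x \<noteq> 0 \<and> nat \<bar>x\<bar> \<in> dom b \<and> lift b x y"
  show "x \<in> SN n" using xy barc_dom[OF b] by (auto simp: SN_def)
  have e: "nat \<bar>y\<bar> = endp b (nat \<bar>x\<bar>)" using lift_end[OF b] xy by blast
  have "y \<noteq> 0"
  proof
    assume "y = 0"
    then have "endp b (nat \<bar>x\<bar>) = endp b 0" "0 \<in> dom b" using e b by (auto simp: barc_def)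
    then have "nat \<bar>x\<bar> = 0" using inj_onD[OF inj_on_endp[OF as]] xy by blast
    then show False using xy by simp
  qed
  then show "y \<in> SN n" using e endp(2)[OF as, of "nat \<bar>x\<bar>"] xy by (auto simp: SN_def)
  show "- x \<noteq> 0" "nat \<bar>- x\<bar> \<in> dom b" "lift b (- x) (- y)" using xy lift_minus by auto
  fix x' assume xy': "x' \<noteq> 0 \<and> nat \<bar>x'\<bar> \<in> dom b \<and> lift b x' y"
  then have "endp b (nat \<bar>x'\<bar>) = endp b (nat \<bar>x\<bar>)" using lift_end[OF b] e by metis
  then have "nat \<bar>x'\<bar> = nat \<bar>x\<bar>" using inj_onD[OF inj_on_endp[OF as]] xy xy' by blast
  then consider "x = x'" | "x' = - x" by linarith
  then show "x = x'"
  proof cases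
    case 2
    then have "y = - y" using lift_unique[OF b, of x' y "- y"] xy xy' lift_minus by blast
    then show ?thesis using \<open>y \<noteq> 0\<close> by simp
  qed
qed

text \<open>Lifts can be concatenated, and uniqueness forces a given lift through the product to be
  the concatenation of the lifts through the factors.\<close>

lemma rho_arcs_stack:
  assumes a: "barc n a" and b: "barc n b"
  shows "rho_arcs (stack a b) = rho_arcs b \<circ>\<^sub>m rho_arcs a"
proof (rule map_eqI)
  fix x z
  have "(\<exists>y. (x \<noteq> 0 \<and> nat \<bar>x\<bar> \<in> dom a \<and> lift a x y) \<and> y \<noteq> 0 \<and> nat \<bar>y\<bar> \<in> dom b \<and> lift b y z) \<longleftrightarrow>
      x \<noteq> 0 \<and> nat \<bar>x\<bar> \<in> sdom a b \<and> lift (stack a b) x z" (is "?L \<longleftrightarrow> ?R")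
  proof
    assume ?L
    then show ?R using lift_end[OF a] lift_stack[OF a b] by (auto simp: sdom_def)
  next
    assume R: ?R
    then have x: "x \<noteq> 0" "nat \<bar>x\<bar> \<in> dom a" "endp a (nat \<bar>x\<bar>) \<in> dom b" by (auto simp: sdom_def)
    obtain y where y: "lift a x y" using lift_exists[OF a x(2,1)] by blast
    have "y \<in> SN n"
      using rho_arcs_in_carrier[OF a] rho_arcs_eq_Some[OF a, of x y] x y unfolding carrier_I_B by blast
    then have y0: "y \<noteq> 0" by (simp add: SN_def)
    have yb: "nat \<bar>y\<bar> \<in> dom b" using lift_end[OF a y x(2)] x by simp
    obtain z' where z': "lift b y z'" using lift_exists[OF b yb y0] by blast
    have "z' = z"
      using lift_stack[OF a b x(2) yb x(1) y z'] lift_unique[OF barc_stack[OF a b]] R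
      unfolding dom_stack by blast
    then show ?L using x y y0 yb z' by blast
  qed
  then show "rho_arcs (stack a b) x = Some z \<longleftrightarrow> (rho_arcs b \<circ>\<^sub>m rho_arcs a) x = Some z"
    unfolding map_comp_eq_Some rho_arcs_eq_Some[OF a] rho_arcs_eq_Some[OF b]
      rho_arcs_eq_Some[OF barc_stack[OF a b]] dom_stack by simp
qed

lemma rho_arcs_trivial:
  assumes "A \<subseteq> {..n}" "0 \<in> A"
  shows "rho_arcs (trivial_arcs A) = (\<lambda>x. if x \<noteq> 0 \<and> nat \<bar>x\<bar> \<in> A then Some x else None)"
proof (rule map_eqI)
  note b = barc_trivial[OF assms]
  have l: "lift (trivial_arcs A) x x" if "nat \<bar>x\<bar> \<in> A" for x
    unfolding lift_def using that assms(2)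
    by (intro exI[of _ "\<lambda>t. sroot x"]) (auto simp: pth_trivial_arcs sroot_power2 path_def)
  fix x y
  show "rho_arcs (trivial_arcs A) x = Some y \<longleftrightarrow>
      (if x \<noteq> 0 \<and> nat \<bar>x\<bar> \<in> A then Some x else None) = Some y"
  proof (cases "x \<noteq> 0 \<and> nat \<bar>x\<bar> \<in> A")
    case True
    then have "lift (trivial_arcs A) x y \<longleftrightarrow> y = x"
      using l[of x] lift_unique[OF b, of x y x] by auto
    then show ?thesis unfolding rho_arcs_eq_Some[OF b] using True by auto
  qed (auto simp: rho_arcs_eq_Some[OF b])
qed

lemma rho_hom: "inverse_monoid_hom (IB_B n) (I_B n) rho"
proof (rule inverse_monoid_homI[OF inverse_monoid_IB_B inverse_monoid_I_B])
  show "rho \<in> hom (IB_B n) (I_B n)"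
  proof (rule homI)
    show "rho X \<in> carrier (I_B n)" if "X \<in> carrier (IB_B n)" for X
      using that rho_arcs_in_carrier by (auto simp: carrier_IB_B rho_cls)
    show "rho (X \<otimes>\<^bsub>IB_B n\<^esub> Y) = rho X \<otimes>\<^bsub>I_B n\<^esub> rho Y"
      if "X \<in> carrier (IB_B n)" "Y \<in> carrier (IB_B n)" for X Y
      using that by (auto simp: carrier_IB_B mult_cls_B rho_cls barc_stack rho_arcs_stack)
  qed
  have "x \<noteq> 0 \<and> nat \<bar>x\<bar> \<in> {..n} \<longleftrightarrow> x \<in> SN n" for x by (auto simp: SN_def)
  then show "rho \<one>\<^bsub>IB_B n\<^esub> = \<one>\<^bsub>I_B n\<^esub>"
    using rho_arcs_trivial[of "{..n}" n] by (simp add: one_IB_B rho_cls barc_trivial)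
qed

lemma rho_cl:
  assumes "bpath n p g"
  shows "rho (cl n p) = smap n g"
proof (rule map_eqI)
  note b = barc_barcs[OF assms]
  fix x y
  show "rho (cl n p) x = Some y \<longleftrightarrow> smap n g x = Some y"
  proof (cases "x \<in> SN n")
    case True
    then have x: "x \<noteq> 0" "\<bar>x\<bar> \<le> int n" "nat \<bar>x\<bar> \<in> dom (barcs n p)" by (auto simp: SN_def)
    then have "lift (barcs n p) x y \<longleftrightarrow> y = g x"
      using lift_barcs[OF assms x(2)] lift_unique[OF b x(3,1), of y "g x"] by auto
    then show ?thesis
      unfolding cl_def rho_cls[OF b] rho_arcs_eq_Some[OF b] smap_def using True x by auto
  next
    case False
    then show ?thesis
      unfolding cl_def rho_cls[OF b] rho_arcs_eq_Some[OF b] by (auto simp: smap_def SN_def)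
  qed
qed

lemma rho_epsilon:
  assumes "1 \<le> i" "i \<le> n"
  shows "rho (epsilon n i) = epsilon_map n i"
proof -
  have A: "{..n} - {i} \<subseteq> {..n}" "0 \<in> {..n} - {i}" using assms by auto
  have "epsilon n i = cls (Suc n) (trivial_arcs ({..n} - {i}))" by (simp add: epsilon_def cls_def)
  moreover have "x \<noteq> 0 \<and> nat \<bar>x\<bar> \<in> {..n} - {i} \<longleftrightarrow> x \<in> SN n \<and> \<bar>x\<bar> \<noteq> int i" for x
    by (auto simp: SN_def)
  ultimately show ?thesis
    by (simp add: rho_cls[OF barc_trivial[OF A]] rho_arcs_trivial[OF A] epsilon_map_def)
qed

section \<open>Straight segments and star-shaped sets of configurations\<close>

definition lin :: "(int \<Rightarrow> complex) \<Rightarrow> (int \<Rightarrow> complex) \<Rightarrow> real \<Rightarrow> int \<Rightarrow> complex" where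
  "lin a b t x = of_real (1 - t) * a x + of_real t * b x"

lemma lin_0 [simp]: "lin a b 0 = a" and lin_1 [simp]: "lin a b 1 = b"
  by (auto simp: lin_def fun_eq_iff)

lemma lin_refl [simp]: "lin a a t = a"
  by (auto simp: lin_def fun_eq_iff algebra_simps)

lemma lin_comp: "lin a b t \<circ> g = lin (a \<circ> g) (b \<circ> g) t"
  by (auto simp: lin_def fun_eq_iff)

lemma path_lin: "path (lin a b)"
  unfolding path_fun_iff path_def lin_def by (intro allI continuous_intros)

text \<open>Both paths are deformed into the path from the common start to \<open>z\<close> and on to the common
  end.\<close>

lemma star_homotopic:
  assumes star: "\<And>c t. c \<in> U \<Longrightarrow> t \<in> {0..1} \<Longrightarrow> lin z c t \<in> U"
    and p: "path p" "path_image p \<subseteq> U" and q: "path q" "path_image q \<subseteq> U"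
    and e: "p 0 = q 0" "p 1 = q 1"
  shows "homotopic_paths U p q"
proof -
  \<comment> \<open>At stage s the path runs at speed 1 + 2s. It waits at its start while
    \<open>\<nu>\<close> falls from 1 to 1 - s, is traversed with \<open>\<nu>\<close> = 1 - s, that
    is, pulled towards \<open>z\<close>, and waits at its end while \<open>\<nu>\<close> returns to
    1.\<close>
  define \<mu> where "\<mu> = (\<lambda>s t::real. max 0 (min 1 (t * (1 + 2 * s) - s)))"
  define \<nu> where "\<nu> = (\<lambda>s t::real. 1 - min s (min (t * (1 + 2 * s)) ((1 - t) * (1 + 2 * s))))"
  have m: "\<mu> s t \<in> {0..1}" for s t by (auto simp: \<mu>_def)
  have n: "\<nu> s t \<in> {0..1}" if "s \<in> {0..1}" "t \<in> {0..1}" for s t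
    using that by (auto simp: \<nu>_def min_def)
  define cone where "cone = (\<lambda>(p::real \<Rightarrow> int \<Rightarrow> complex) s t. lin z (p (\<mu> s t)) (\<nu> s t))"
  have *: "homotopic_paths U p (cone p 1)" if p: "path p" "path_image p \<subseteq> U" for p
  proof (rule homotopic_pathsI[of "\<lambda>(s, t). cone p s t"])
    have "continuous_on ({0..1} \<times> {0..1}) (\<lambda>z. p (\<mu> (fst z) (snd z)) x)" for x
    proof (rule continuous_on_compose2[of "{0..1}" "\<lambda>t. p t x"])
      show "continuous_on {0..1} (\<lambda>t. p t x)" using p(1) by (simp add: path_fun_iff path_def)
      show "continuous_on ({0..1} \<times> {0..1}) (\<lambda>z. \<mu> (fst z) (snd z))"
        unfolding \<mu>_def by (intro continuous_intros)
    qed (use m in auto)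
    moreover have "continuous_on ({0..1} \<times> {0..1}) (\<lambda>z. \<nu> (fst z) (snd z))"
      unfolding \<nu>_def by (intro continuous_intros)
    ultimately show "continuous_on ({0..1} \<times> {0..1}) (\<lambda>(s, t). cone p s t)"
      unfolding cone_def lin_def case_prod_beta
      by (intro continuous_on_coordinatewise_then_product continuous_intros)
    show "(case (s, t) of (s, t) \<Rightarrow> cone p s t) \<in> U" if "s \<in> {0..1}" "t \<in> {0..1}" for s t
    proof -
      have "p (\<mu> s t) \<in> U" using m p(2) by (auto simp: path_image_def)
      then show ?thesis unfolding cone_def using star n[OF that] by simp
    qed
    show "(case (0, t) of (s, t) \<Rightarrow> cone p s t) = p t" if "t \<in> {0..1}" for t
    proof -
      have "\<mu> 0 t = t" "\<nu> 0 t = 1" using that by (auto simp: \<mu>_def \<nu>_def min_def max_def)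
      then show ?thesis by (simp add: cone_def)
    qed
    show "(case (s, 0) of (s, t) \<Rightarrow> cone p s t) = p 0" if "s \<in> {0..1}" for s
    proof -
      have "\<mu> s 0 = 0" "\<nu> s 0 = 1" using that by (auto simp: \<mu>_def \<nu>_def min_def max_def)
      then show ?thesis by (simp add: cone_def)
    qed
    show "(case (s, 1) of (s, t) \<Rightarrow> cone p s t) = p 1" if "s \<in> {0..1}" for s
    proof -
      have "\<mu> s 1 = 1" "\<nu> s 1 = 1" using that by (auto simp: \<mu>_def \<nu>_def min_def max_def)
      then show ?thesis by (simp add: cone_def)
    qed
  qed simp
  \<comment> \<open>At stage 1 the middle third rests at \<open>z\<close>, and the outer thirds
    involve only the common ends of the two paths.\<close>
  have "cone p 1 t = cone q 1 t" if "t \<in> {0..1}" for t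
  proof -
    consider "3 * t \<le> 1" | "1 \<le> 3 * t" "3 * t \<le> 2" | "2 \<le> 3 * t" by linarith
    then show ?thesis
    proof cases
      case 1
      then have "\<mu> 1 t = 0" using that by (simp add: \<mu>_def)
      then show ?thesis using e by (simp add: cone_def)
    next
      case 2
      then have "\<nu> 1 t = 0" using that by (simp add: \<nu>_def)
      then show ?thesis by (simp add: cone_def)
    next
      case 3
      then have "\<mu> 1 t = 1" using that by (simp add: \<mu>_def)
      then show ?thesis using e by (simp add: cone_def)
    qed
  qed
  moreover have "path (cone p 1)" "path_image (cone p 1) \<subseteq> U"
    using homotopic_paths_imp_path[OF *[OF p]] homotopic_paths_imp_subset[OF *[OF p]] by auto
  ultimately have "homotopic_paths U (cone p 1) (cone q 1)"
    by (intro homotopic_paths_eq)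
  from homotopic_paths_trans[OF homotopic_paths_trans[OF *[OF p] this] homotopic_paths_sym[OF *[OF q]]]
  show ?thesis .
qed

section \<open>Chambers and walls\<close>

text \<open>The simple reflections of type B, numbered so that reflection \<open>k\<close> belongs
  to the wall on which the neighbours \<open>k\<close> and \<open>k + 1\<close> have the same real
  part. For \<open>k = 0\<close> this is the wall where the first coordinate becomes
  imaginary.\<close>

definition srefl :: "nat \<Rightarrow> int \<Rightarrow> int" where
  "srefl k x = (if k = 0 then (if \<bar>x\<bar> = 1 then - x else x)
    else sgn x * (if \<bar>x\<bar> = int k then int k + 1 else if \<bar>x\<bar> = int k + 1 then int k else \<bar>x\<bar>))"

lemma srefl_minus: "srefl k (- x) = - srefl k x"
  by (auto simp: srefl_def)

lemma srefl_refl [simp]: "srefl k (srefl k x) = x"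
  by (cases "k = 0"; cases x "0::int" rule: linorder_cases) (auto simp: srefl_def sgn_if)

lemma srefl_in_signed_perms:
  assumes "k < n"
  shows "srefl k \<in> signed_perms n"
proof -
  have "srefl k permutes {- int n..int n}"
  proof (rule bij_imp_permutes)
    have "srefl k x \<in> {- int n..int n}" if "x \<in> {- int n..int n}" for x
      using that assms by (cases "k = 0"; cases x "0::int" rule: linorder_cases) (auto simp: srefl_def sgn_if)
    then have "srefl k ` {- int n..int n} \<subseteq> {- int n..int n}" by (rule image_subsetI)
    then show "bij_betw (srefl k) {- int n..int n} {- int n..int n}"
      by (intro bij_betw_byWitness[where f' = "srefl k"]) simp_all
    show "srefl k x = x" if "x \<notin> {- int n..int n}" for x
      using that assms by (cases "k = 0"; cases x "0::int" rule: linorder_cases) (auto simp: srefl_def sgn_if)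
  qed
  then show ?thesis by (simp add: signed_perms_def srefl_minus)
qed

text \<open>A simple reflection disturbs the order only at its own wall. For \<open>k = 0\<close>
  the index 0 lies between -1 and 1, so pairs involving 0 appear besides the pair -1, 1.\<close>

lemma srefl_inversion:
  assumes "x < y" "\<not> srefl k x < srefl k y"
  shows "k = 0 \<and> x \<in> {- 1, 0} \<and> y \<in> {0, 1} \<or>
    k > 0 \<and> (x = int k \<and> y = int k + 1 \<or> x = - int k - 1 \<and> y = - int k)"
  using assms
  by (cases "k = 0"; cases x "0::int" rule: linorder_cases; cases y "0::int" rule: linorder_cases)
    (auto simp: srefl_def sgn_if split: if_splits)

text \<open>When the order of a pair is kept, the old and new positions of the first point both lie
  before those of the second. This keeps points in order while each moves between its two
  positions.\<close>

lemma srefl_cross: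
  assumes "x < y" "srefl k x < srefl k y"
  shows "x < srefl k y" "srefl k x < y"
  using assms
  by (cases "k = 0"; cases x "0::int" rule: linorder_cases; cases y "0::int" rule: linorder_cases;
      auto simp: srefl_def sgn_if split: if_splits)+

text \<open>The linear space containing \<open>oddconf n\<close>; dropping injectivity makes it
  closed under straight segments.\<close>

definition oddfun :: "nat \<Rightarrow> (int \<Rightarrow> complex) set" where
  "oddfun n = {c. (\<forall>x. c (- x) = - c x) \<and> (\<forall>x. int n < \<bar>x\<bar> \<longrightarrow> c x = 0)}"

text \<open>The fundamental Weyl chamber in terms of real parts: since odd functions vanish at 0,
  the first coordinate has positive real part and the following ones increase.\<close>

definition chamber :: "nat \<Rightarrow> (int \<Rightarrow> complex) set" where
  "chamber n = {c \<in> oddfun n. \<forall>x y. - int n \<le> x \<longrightarrow> x < y \<longrightarrow> y \<le> int n \<longrightarrow> Re (c x) < Re (c y)}"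

text \<open>The sign \<open>e\<close> tells on which side of each other the two points that exchange their real
  parts pass.\<close>

definition wall :: "nat \<Rightarrow> nat \<Rightarrow> real \<Rightarrow> (int \<Rightarrow> complex) set" where
  "wall n k e = {c \<in> oddfun n.
     (\<forall>x y. - int n \<le> x \<longrightarrow> x < y \<longrightarrow> y \<le> int n \<longrightarrow> srefl k x < srefl k y \<longrightarrow> Re (c x) < Re (c y)) \<and>
     (Re (c (int k + 1) - c (int k)) = 0 \<longrightarrow> 0 < e * Im (c (int k + 1) - c (int k)))}"

lemma oddfun_0: "c \<in> oddfun n \<Longrightarrow> c 0 = 0"
proof -
  assume "c \<in> oddfun n"
  then have "c (- 0) = - c 0" unfolding oddfun_def by blast
  then show ?thesis by simp
qed

lemma oddconf_oddfun: "oddconf n \<subseteq> oddfun n"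
  by (auto simp: oddconf_def oddfun_def)

lemma oddfun_comp: "c \<in> oddfun n \<Longrightarrow> g \<in> signed_perms n \<Longrightarrow> c \<circ> g \<in> oddfun n"
  using signed_permsD(2,4)[of g n] by (auto simp: oddfun_def not_le[symmetric])

lemma oddfun_lin: "a \<in> oddfun n \<Longrightarrow> b \<in> oddfun n \<Longrightarrow> lin a b t \<in> oddfun n"
  by (auto simp: oddfun_def lin_def)

lemma oddconfI:
  assumes "c \<in> oddfun n" "\<And>x y. - int n \<le> x \<Longrightarrow> x < y \<Longrightarrow> y \<le> int n \<Longrightarrow> c x \<noteq> c y"
  shows "c \<in> oddconf n"
proof -
  have "inj_on c {- int n..int n}"
    by (rule linorder_inj_onI) (use assms(2) in auto)
  then show ?thesis using assms(1) by (auto simp: oddconf_def oddfun_def)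
qed

lemma std_in_chamber: "std n \<in> chamber n"
  using std_in_oddconf[of n] oddconf_oddfun[of n] by (auto simp: chamber_def std_def Re_sroot_less)

lemma Re_lin_less:
  assumes "Re (a x) < Re (a y)" "Re (b x) < Re (b y)" "t \<in> {0..1}"
  shows "Re (lin a b t x) < Re (lin a b t y)"
proof (cases "t = 0")
  case False
  have "(1 - t) * Re (a x) \<le> (1 - t) * Re (a y)" "t * Re (b x) < t * Re (b y)"
    using assms False by (auto intro: mult_left_mono)
  then show ?thesis by (simp add: lin_def)
qed (use assms in simp)

lemma chamber_lin: "a \<in> chamber n \<Longrightarrow> b \<in> chamber n \<Longrightarrow> t \<in> {0..1} \<Longrightarrow> lin a b t \<in> chamber n"
  unfolding chamber_def using oddfun_lin Re_lin_less by blast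

text \<open>Pairs whose order the reflection keeps are separated by their real parts. The others
  reduce by oddness to the pair \<open>k\<close>, \<open>k + 1\<close>, which is separated by the
  imaginary part whenever the real parts agree.\<close>

lemma wall_oddconf:
  assumes "k < n"
  shows "wall n k e \<subseteq> oddconf n"
proof
  fix c assume c: "c \<in> wall n k e"
  then have o: "c \<in> oddfun n" by (simp add: wall_def)
  have d: "c (int k + 1) \<noteq> c (int k)" using c by (auto simp: wall_def)
  have m: "c (- x) = - c x" for x using o by (simp add: oddfun_def)
  note z = oddfun_0[OF o]
  show "c \<in> oddconf n"
  proof (rule oddconfI[OF o])
    fix x y assume xy: "- int n \<le> x" "x < y" "y \<le> int n"
    show "c x \<noteq> c y"
    proof (cases "srefl k x < srefl k y")
      case True
      then have "Re (c x) < Re (c y)" using c xy by (simp add: wall_def)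
      then show ?thesis by auto
    next
      case False
      from srefl_inversion[OF xy(2) this] show ?thesis
      proof (elim disjE conjE)
        assume "k = 0" "x \<in> {- 1, 0}" "y \<in> {0, 1}"
        then show ?thesis using d z m[of 1] xy(2) by auto
      next
        assume "x = - int k - 1" "y = - int k"
        then show ?thesis using d m[of "int k"] m[of "int k + 1"] by simp
      qed (use d in auto)
    qed
  qed
qed

lemma chamber_wall:
  assumes "k < n"
  shows "chamber n \<subseteq> wall n k e"
proof
  fix c assume c: "c \<in> chamber n"
  then have "Re (c (int k)) < Re (c (int k + 1))" using assms by (simp add: chamber_def)
  then show "c \<in> wall n k e" using c by (auto simp: wall_def chamber_def)
qed

lemma chamber_oddconf: "chamber n \<subseteq> oddconf n"
proof
  fix c assume c: "c \<in> chamber n"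
  then have "c \<in> oddfun n" by (simp add: chamber_def)
  then show "c \<in> oddconf n"
  proof (rule oddconfI)
    fix x y assume "- int n \<le> x" "x < y" "y \<le> int n"
    then have "Re (c x) < Re (c y)" using c by (simp add: chamber_def)
    then show "c x \<noteq> c y" by auto
  qed
qed

lemma srefl_bounds: "k < n \<Longrightarrow> - int n \<le> srefl k x \<and> srefl k x \<le> int n \<longleftrightarrow> - int n \<le> x \<and> x \<le> int n"
  using signed_permsD(4)[OF srefl_in_signed_perms, of k n x] by (simp add: abs_le_iff) linarith

lemma srefl_k: "srefl k (int k + 1) = (if k = 0 then - 1 else int k)" "srefl k (int k) = (if k = 0 then 0 else int k + 1)"
  by (auto simp: srefl_def)

text \<open>Together with \<open>chamber_wall\<close>: the wall neighbourhood contains the chambers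
  on both of its sides, whichever way \<open>e\<close> the points pass.\<close>

lemma chamber_refl_wall:
  assumes "k < n" "c \<in> chamber n"
  shows "c \<circ> srefl k \<in> wall n k e"
proof -
  have "srefl k (int k + 1) < srefl k (int k)" by (simp add: srefl_k)
  moreover have "- int n \<le> srefl k (int k + 1)" "srefl k (int k) \<le> int n"
    using assms(1) by (auto simp: srefl_k)
  ultimately have "Re (c (srefl k (int k + 1))) < Re (c (srefl k (int k)))"
    using assms(2) by (simp add: chamber_def)
  moreover have "Re (c (srefl k x)) < Re (c (srefl k y))"
    if "- int n \<le> x" "x < y" "y \<le> int n" "srefl k x < srefl k y" for x y
  proof -
    have "- int n \<le> srefl k x" "srefl k y \<le> int n"
      using srefl_bounds[OF assms(1), of x] srefl_bounds[OF assms(1), of y] that by auto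
    then show ?thesis using assms(2) that by (simp add: chamber_def)
  qed
  moreover have "c \<circ> srefl k \<in> oddfun n"
    using assms srefl_in_signed_perms by (intro oddfun_comp) (auto simp: chamber_def)
  ultimately show ?thesis by (simp add: wall_def)
qed

text \<open>The difference of the two exchanged coordinates ranges over the plane slit along a
  closed vertical ray from 0, which is star-shaped from any point of the opposite ray. The remaining
  conditions are convex.\<close>

lemma wall_star:
  assumes "k < n" "e \<in> {1, - 1}"
  obtains z where "z \<in> wall n k e" "\<forall>c\<in>wall n k e. \<forall>t\<in>{0..1}. lin z c t \<in> wall n k e"
proof -
  let ?s = "std n \<circ> srefl k"
  \<comment> \<open>The midpoint of the base configurations of the two chambers gives the exchanged
    pair the same real part. The sign term is odd, vanishes at unmoved indices, and puts the pair on
    the side prescribed by \<open>e\<close>.\<close>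
  define z where "z = (\<lambda>x. (std n x + ?s x) / 2 + of_real (e * of_int (sgn (x - srefl k x))) * \<i>)"
  have so: "std n \<in> oddfun n" "?s \<in> oddfun n"
    using std_in_chamber[of n] oddfun_comp[OF _ srefl_in_signed_perms[OF assms(1)], of "std n"]
    by (auto simp: chamber_def)
  have "x - srefl k x = 0" if "int n < \<bar>x\<bar>" for x
  proof -
    have "x \<notin> {- int n..int n}" using that by auto
    from permutes_not_in[OF signed_permsD(1)[OF srefl_in_signed_perms[OF assms(1)]] this]
    show ?thesis by simp
  qed
  moreover have "sgn (srefl k x - x) = - sgn (x - srefl k x)" for x
    by (simp add: sgn_if)
  ultimately have zo: "z \<in> oddfun n"
    using so by (auto simp: z_def oddfun_def srefl_minus field_simps)
  have Re_z: "Re (z x) = (Re (std n x) + Re (?s x)) / 2" for x by (simp add: z_def)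
  have Re_d: "Re (z (int k + 1) - z (int k)) = 0"
    using so by (auto simp: Re_z srefl_k oddfun_0 oddfun_def std_def)
  have Im_d: "0 < e * Im (z (int k + 1) - z (int k))"
    using assms(2) by (auto simp: z_def srefl_k std_def sroot_def)
  have ord: "Re (z x) < Re (z y)" if "- int n \<le> x" "x < y" "y \<le> int n" "srefl k x < srefl k y" for x y
  proof -
    have "- int n \<le> srefl k x" "srefl k y \<le> int n"
      using srefl_bounds[OF assms(1), of x] srefl_bounds[OF assms(1), of y] that by auto
    then have "Re (?s x) < Re (?s y)" "Re (std n x) < Re (std n y)"
      using std_in_chamber[of n] that by (auto simp: chamber_def)
    then show ?thesis by (simp add: Re_z)
  qed
  have zw: "z \<in> wall n k e" using zo ord Im_d by (simp add: wall_def)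
  moreover have "lin z c t \<in> wall n k e" if c: "c \<in> wall n k e" and t: "t \<in> {0..1}" for c t
  proof -
    let ?d = "\<lambda>c. c (int k + 1) - c (int k)"
    have ld: "?d (lin z c t) = of_real (1 - t) * ?d z + of_real t * ?d c"
      by (simp add: lin_def algebra_simps)
    have "0 < e * Im (?d (lin z c t))" if 0: "Re (?d (lin z c t)) = 0"
    proof (cases "t = 0")
      case False
      have "t * Re (?d c) = 0" using 0 Re_d unfolding ld by simp
      then have "Re (?d c) = 0" using False by simp
      then have "0 < e * Im (?d c)" using c by (simp add: wall_def)
      then have "0 < t * (e * Im (?d c))" using False t by simp
      moreover have "0 \<le> (1 - t) * (e * Im (?d z))" using Im_d t mult_nonneg_nonneg[of "1 - t" "e * Im (?d z)"] by simp
      moreover have "e * Im (?d (lin z c t)) = (1 - t) * (e * Im (?d z)) + t * (e * Im (?d c))"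
        unfolding ld by (simp add: algebra_simps)
      ultimately show ?thesis by linarith
    qed (use Im_d in simp)
    moreover have "Re (lin z c t x) < Re (lin z c t y)"
      if "- int n \<le> x" "x < y" "y \<le> int n" "srefl k x < srefl k y" for x y
      using ord[OF that] c that t by (intro Re_lin_less) (auto simp: wall_def)
    moreover have "lin z c t \<in> oddfun n" using zo c by (intro oddfun_lin) (auto simp: wall_def)
    ultimately show ?thesis by (simp add: wall_def)
  qed
  ultimately show thesis using that by blast
qed

text \<open>Along the segment the real part of the difference is affine and changes sign, so it
  vanishes only once; a single \<open>e\<close> therefore describes the passage.\<close>

lemma lin_in_wall:
  assumes k: "k < n" and b: "b \<in> chamber n" and b2: "b2 \<in> chamber n"
    and l: "\<And>t. t \<in> {0..1} \<Longrightarrow> lin b (b2 \<circ> srefl k) t \<in> oddconf n"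
  shows "\<exists>e\<in>{1, - 1}. \<forall>t\<in>{0..1}. lin b (b2 \<circ> srefl k) t \<in> wall n k e"
proof -
  let ?c = "lin b (b2 \<circ> srefl k)" and ?d = "\<lambda>c. c (int k + 1) - c (int k)"
  have w: "b \<in> wall n k 1" "b2 \<circ> srefl k \<in> wall n k 1"
    using chamber_wall[OF k] chamber_refl_wall[OF k b2] b by auto
  have ord: "Re (?c t x) < Re (?c t y)"
    if "- int n \<le> x" "x < y" "y \<le> int n" "srefl k x < srefl k y" "t \<in> {0..1}" for x y t
    using w that by (intro Re_lin_less) (auto simp: wall_def)
  have od: "?c t \<in> oddfun n" for t
    using w by (intro oddfun_lin) (auto simp: wall_def)
  have p: "Re (?d b) > 0" using b k by (simp add: chamber_def)
  have m: "Re (?d (b2 \<circ> srefl k)) < 0"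
    using b2 k by (simp add: chamber_def srefl_k)
  have Re_d: "Re (?d (?c t)) = (1 - t) * Re (?d b) + t * Re (?d (b2 \<circ> srefl k))" for t
    by (simp add: lin_def algebra_simps)
  define t0 where "t0 = Re (?d b) / (Re (?d b) - Re (?d (b2 \<circ> srefl k)))"
  have t0: "t0 \<in> {0..1}" using p m by (auto simp: t0_def field_simps)
  have u: "t = t0" if "Re (?d (?c t)) = 0" for t
    using that p m unfolding Re_d t0_def by (simp add: field_simps)
  \<comment> \<open>At time \<open>t0\<close> the two points are distinct, so if their real parts
    agree their imaginary parts differ, and the sign of that difference is the side of the
    passage.\<close>
  define e where "e = (if Im (?d (?c t0)) \<ge> 0 then 1 else - 1 :: real)"
  have "0 < e * Im (?d (?c t0))" if "Re (?d (?c t0)) = 0"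
  proof -
    have "?c t0 (int k + 1) \<noteq> ?c t0 (int k)"
      using l[OF t0] k by (auto simp: oddconf_def dest!: inj_onD)
    then have "Im (?d (?c t0)) \<noteq> 0" using that by (auto simp: complex_eq_iff)
    then show ?thesis by (auto simp: e_def)
  qed
  then have "?c t \<in> wall n k e" if "t \<in> {0..1}" for t
    using ord[OF _ _ _ _ that] od[of t] u[of t] by (simp add: wall_def) blast
  moreover have "e \<in> {1, - 1}" by (simp add: e_def)
  ultimately show ?thesis by blast
qed

section \<open>The standard generators\<close>

text \<open>The square root lift of a generator. For \<open>k = 0\<close> the first coordinate makes
  half a turn about 0, so its square makes the full turn of tau; for \<open>k > 0\<close> principal
  roots of the half twist are taken, which is possible as its points stay in the right
  half-plane.\<close>

definition hpath :: "nat \<Rightarrow> nat \<Rightarrow> real \<Rightarrow> int \<Rightarrow> complex" where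
  "hpath n k t x =
    (if k = 0 then (if \<bar>x\<bar> = 1 then of_int x * cis (pi * t) else std n x)
     else if \<bar>x\<bar> = int k then of_int (sgn x) * csqrt (of_nat k + 1/2 - cis (pi * t) / 2)
     else if \<bar>x\<bar> = int k + 1 then of_int (sgn x) * csqrt (of_nat k + 1/2 + cis (pi * t) / 2)
     else std n x)"

text \<open>The square of the real part of the principal root of z is the mean of |z| and Re
  z.\<close>

lemma Re_csqrt_bounds:
  assumes "a \<le> Re z" "cmod z \<le> b"
  shows "sqrt a \<le> Re (csqrt z)" "Re (csqrt z) \<le> sqrt b"
proof -
  have "Re z \<le> cmod z" by (rule complex_Re_le_cmod)
  then have "a \<le> (cmod z + Re z) / 2" "(cmod z + Re z) / 2 \<le> b" using assms by auto
  then show "sqrt a \<le> Re (csqrt z)" "Re (csqrt z) \<le> sqrt b" by simp_all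
qed

lemma Im_csqrt_sign:
  shows "0 < Im z \<Longrightarrow> 0 < Im (csqrt z)" "Im z < 0 \<Longrightarrow> Im (csqrt z) < 0"
proof -
  define a b where "a = Re (csqrt z)" and "b = Im (csqrt z)"
  have "z = (csqrt z)\<^sup>2" by simp
  then have "Im z = 2 * a * b" unfolding a_def b_def by (metis Im_power2)
  moreover have "0 \<le> a" using csqrt_principal[of z] by (auto simp: a_def simp del: csqrt.sel)
  ultimately show "0 < Im z \<Longrightarrow> 0 < Im (csqrt z)" "Im z < 0 \<Longrightarrow> Im (csqrt z) < 0"
    unfolding b_def[symmetric] by (auto simp: zero_less_mult_iff mult_less_0_iff)
qed

lemma half_twist_point:
  fixes k :: nat
  assumes "cmod w = 1"
  shows "real k \<le> Re (of_nat k + 1/2 + w / 2)" "cmod (of_nat k + 1/2 + w / 2) \<le> real k + 1"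
proof -
  have "\<bar>Re w\<bar> \<le> 1" using abs_Re_le_cmod[of w] assms by simp
  then show "real k \<le> Re (of_nat k + 1/2 + w / 2)" by simp
  have e: "of_nat k + 1/2 = (of_real (real k + 1/2) :: complex)" by simp
  have "cmod (of_real (real k + 1/2) + w / 2) \<le> cmod (of_real (real k + 1/2)) + cmod (w / 2)"
    by (rule norm_triangle_ineq)
  also have "\<dots> = real k + 1"
    using assms by (simp only: norm_of_real norm_divide) simp
  finally show "cmod (of_nat k + 1/2 + w / 2) \<le> real k + 1" unfolding e .
qed

lemma csqrt_half_twist_bounds:
  "sqrt k \<le> Re (csqrt (of_nat k + 1/2 + cis a / 2))" "Re (csqrt (of_nat k + 1/2 + cis a / 2)) \<le> sqrt (k + 1)"
  "sqrt k \<le> Re (csqrt (of_nat k + 1/2 - cis a / 2))" "Re (csqrt (of_nat k + 1/2 - cis a / 2)) \<le> sqrt (k + 1)"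
  using half_twist_point[of "cis a" k] half_twist_point[of "- cis a" k]
    Re_csqrt_bounds[of "real k" "of_nat k + 1/2 + cis a / 2" "real k + 1"]
    Re_csqrt_bounds[of "real k" "of_nat k + 1/2 + (- cis a) / 2" "real k + 1"]
  by (simp_all del: csqrt.sel add: algebra_simps)

lemma csqrt_nat: "csqrt (of_nat k) = of_real (sqrt (real k))"
  by (metis csqrt_of_real_nonneg of_nat_0_le_iff of_real_of_nat_eq Re_complex_of_real Im_complex_of_real)

lemma hpath_minus: "hpath n k t (- x) = - hpath n k t x"
  using std_in_oddconf[of n] by (auto simp: hpath_def oddconf_def simp del: csqrt.sel)

lemma hpath_oddfun: "k < n \<Longrightarrow> hpath n k t \<in> oddfun n"
  by (auto simp: oddfun_def hpath_minus) (auto simp: hpath_def std_def)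

lemma sroot_sgn: "x \<noteq> 0 \<Longrightarrow> sroot (sgn x * int j) = of_int (sgn x) * of_real (sqrt (real j))"
  by (auto simp: sroot_def sgn_if)

lemma std_abs: "\<bar>x\<bar> = int j \<Longrightarrow> j \<le> n \<Longrightarrow> std n x = of_int (sgn x) * of_real (sqrt (real j))"
  by (simp add: std_def sroot_def)

lemma hpath_0:
  assumes "k < n"
  shows "hpath n k 0 = std n"
proof
  fix x
  have e: "of_nat k + 1/2 + cis (pi * 0) / 2 = (of_nat (k + 1) :: complex)"
    "of_nat k + 1/2 - cis (pi * 0) / 2 = (of_nat k :: complex)"
    by simp_all
  consider "k = 0" "x = 1 \<or> x = - 1" | "k = 0" "\<bar>x\<bar> \<noteq> 1" | "k > 0" "\<bar>x\<bar> = int k" | "k > 0" "\<bar>x\<bar> = int (k + 1)"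
    | "k > 0" "\<bar>x\<bar> \<noteq> int k" "\<bar>x\<bar> \<noteq> int k + 1"
    by linarith
  then show "hpath n k 0 x = std n x"
  proof cases
    case 1
    then show ?thesis using assms by (auto simp: hpath_def std_def sroot_def)
  next
    case 3
    then have "hpath n k 0 x = of_int (sgn x) * csqrt (of_nat k)" unfolding hpath_def e by simp
    then show ?thesis using std_abs[OF 3(2), of n] assms by (simp add: csqrt_nat del: csqrt.sel)
  next
    case 4
    then have "hpath n k 0 x = of_int (sgn x) * csqrt (of_nat (k + 1))" unfolding hpath_def e by simp
    then show ?thesis using std_abs[OF 4(2), of n] assms by (simp only: csqrt_nat)
  qed (simp_all add: hpath_def)
qed

lemma hpath_1:
  assumes "k < n"
  shows "hpath n k 1 = std n \<circ> srefl k"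
proof
  fix x
  have e: "of_nat k + 1/2 + cis (pi * 1) / 2 = (of_nat k :: complex)"
    "of_nat k + 1/2 - cis (pi * 1) / 2 = (of_nat (k + 1) :: complex)"
    by simp_all
  consider "k = 0" "x = 1 \<or> x = - 1" | "k = 0" "\<bar>x\<bar> \<noteq> 1" | "k > 0" "\<bar>x\<bar> = int k" | "k > 0" "\<bar>x\<bar> = int k + 1"
    | "k > 0" "\<bar>x\<bar> \<noteq> int k" "\<bar>x\<bar> \<noteq> int k + 1"
    by linarith
  then show "hpath n k 1 x = (std n \<circ> srefl k) x"
  proof cases
    case 1
    then show ?thesis using assms by (auto simp: hpath_def std_def sroot_def srefl_def)
  next
    case 2
    then show ?thesis by (simp add: hpath_def srefl_def)
  next
    case 3
    then have "srefl k x = sgn x * int (k + 1)" "x \<noteq> 0" by (auto simp: srefl_def)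
    then have "std n (srefl k x) = of_int (sgn x) * of_real (sqrt (real (k + 1)))"
      using assms sroot_sgn[of x "k + 1"] by (simp add: std_def abs_mult)
    moreover have "hpath n k 1 x = of_int (sgn x) * csqrt (of_nat (k + 1))"
      using 3 unfolding hpath_def e by simp
    ultimately show ?thesis by (simp only: csqrt_nat o_apply)
  next
    case 4
    then have "srefl k x = sgn x * int k" "x \<noteq> 0" by (auto simp: srefl_def)
    then have "std n (srefl k x) = of_int (sgn x) * of_real (sqrt (real k))"
      using assms sroot_sgn[of x k] by (simp add: std_def abs_mult)
    moreover have "hpath n k 1 x = of_int (sgn x) * csqrt (of_nat k)"
      using 4 unfolding hpath_def e by simp
    ultimately show ?thesis by (simp only: csqrt_nat o_apply)
  next
    case 5
    then have "srefl k x = x" by (simp add: srefl_def mult.commute abs_mult_sgn)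
    then show ?thesis using 5 by (simp add: hpath_def)
  qed
qed

text \<open>For \<open>k > 0\<close> both radicands have positive real part and so avoid the branch
  cut of \<open>csqrt\<close>.\<close>

lemma path_hpath: "path (hpath n k)"
  unfolding path_fun_iff
proof
  fix x
  let ?u = "\<lambda>t. of_nat k + 1/2 + cis (pi * t) / 2" and ?v = "\<lambda>t. of_nat k + 1/2 - cis (pi * t) / 2"
  have c: "continuous_on {0..1} (\<lambda>t. cis (pi * t))"
    by (intro continuous_intros)
  have "continuous_on {0..1} (\<lambda>t. csqrt (?u t))" "continuous_on {0..1} (\<lambda>t. csqrt (?v t))" if "k > 0"
  proof -
    have "0 < Re (?u t)" "0 < Re (?v t)" for t
    proof -
      have "1 \<le> real k" using that by simp
      moreover have "Re (?u t) = real k + 1/2 + cos (pi * t) / 2" "Re (?v t) = real k + 1/2 - cos (pi * t) / 2"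
        by simp_all
      ultimately show "0 < Re (?u t)" "0 < Re (?v t)"
        using cos_le_one[of "pi * t"] cos_ge_minus_one[of "pi * t"] by linarith+
    qed
    then have "?u ` {0..1} \<subseteq> - \<real>\<^sub>\<le>\<^sub>0" "?v ` {0..1} \<subseteq> - \<real>\<^sub>\<le>\<^sub>0"
      unfolding complex_nonpos_Reals_iff image_subset_iff Compl_iff by (meson not_le)+
    then show "continuous_on {0..1} (\<lambda>t. csqrt (?u t))" "continuous_on {0..1} (\<lambda>t. csqrt (?v t))"
      using c by (auto intro!: continuous_on_compose2[OF continuous_on_csqrt] continuous_intros)
  qed
  then show "path (\<lambda>t. hpath n k t x)"
    unfolding path_def hpath_def using c
    by (cases "k = 0"; cases "\<bar>x\<bar> = 1"; cases "\<bar>x\<bar> = int k"; cases "\<bar>x\<bar> = int k + 1")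
      (simp_all add: continuous_on_mult_left del: csqrt.sel)
qed

text \<open>Real parts stay between their initial and final values, and \<open>srefl_cross\<close>
  then keeps all pairs in order except the exchanged one. That pair passes with \<open>k + 1\<close>
  above \<open>k\<close>, as the rotation is counterclockwise.\<close>

lemma hpath_wall:
  assumes k: "k < n" and t: "t \<in> {0..1}"
  shows "hpath n k t \<in> wall n k 1"
proof -
  let ?c = "hpath n k t"
  let ?s = "\<lambda>x. Re (std n x)"
  have st: "?s x < ?s y" if "- int n \<le> x" "x < y" "y \<le> int n" for x y
    using std_in_chamber[of n] that by (simp add: chamber_def)
  \<comment> \<open>The radicands lie in the disc with diameter from k to k + 1, so the real parts
    of their roots lie between the roots of k and k + 1.\<close>
  have bnd: "min (?s x) (?s (srefl k x)) \<le> Re (?c x) \<and> Re (?c x) \<le> max (?s x) (?s (srefl k x))"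
    if "- int n \<le> x" "x \<le> int n" for x
  proof -
    let ?A = "Re (csqrt (of_nat k + 1/2 - cis (pi * t) / 2))" and ?B = "Re (csqrt (of_nat k + 1/2 + cis (pi * t) / 2))"
    note B = csqrt_half_twist_bounds[of k "pi * t"]
    consider "k = 0" "x = 1 \<or> x = - 1" | "k = 0" "\<bar>x\<bar> \<noteq> 1" | "k > 0" "\<bar>x\<bar> = int k" | "k > 0" "\<bar>x\<bar> = int k + 1"
      | "k > 0" "\<bar>x\<bar> \<noteq> int k" "\<bar>x\<bar> \<noteq> int k + 1"
      by linarith
    then show ?thesis
    proof cases
      case 1
      then show ?thesis
        using k by (auto simp: hpath_def srefl_def std_def sroot_def)
    next
      case 3
      then have sx: "srefl k x = sgn x * int (k + 1)" "x \<noteq> 0" by (auto simp: srefl_def)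
      have "?s x = of_int (sgn x) * sqrt k" using std_abs[OF 3(2), of n] k by simp
      moreover have "?s (srefl k x) = of_int (sgn x) * sqrt (k + 1)"
        using sroot_sgn[OF sx(2), of "k + 1"] sx k by (simp add: std_def abs_mult)
      moreover have "Re (?c x) = of_int (sgn x) * ?A"
        using 3 by (simp add: hpath_def del: csqrt.sel)
      ultimately show ?thesis
        using B(3,4) sx(2) by (cases "x > 0") (auto simp: sgn_if add.commute simp del: csqrt.sel)
    next
      case 4
      then have sx: "srefl k x = sgn x * int k" "x \<noteq> 0" by (auto simp: srefl_def)
      have "?s x = of_int (sgn x) * sqrt (k + 1)" using std_abs[of x "k + 1" n] 4(2) k by simp
      moreover have "?s (srefl k x) = of_int (sgn x) * sqrt k"
        using sroot_sgn[OF sx(2), of k] sx k by (simp add: std_def abs_mult)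
      moreover have "Re (?c x) = of_int (sgn x) * ?B"
        using 4 by (simp add: hpath_def del: csqrt.sel)
      ultimately show ?thesis
        using B(1,2) sx(2) by (cases "x > 0") (auto simp: sgn_if add.commute simp del: csqrt.sel)
    next
      case 5
      then have "srefl k x = x" by (simp add: srefl_def mult.commute abs_mult_sgn)
      then show ?thesis using 5 by (simp add: hpath_def)
    qed (simp add: hpath_def srefl_def)
  qed
  have "Re (?c x) < Re (?c y)" if xy: "- int n \<le> x" "x < y" "y \<le> int n" "srefl k x < srefl k y" for x y
  proof -
    have b: "- int n \<le> srefl k x" "srefl k y \<le> int n"
      using srefl_bounds[OF k, of x] srefl_bounds[OF k, of y] xy by auto
    note cr = srefl_cross[OF xy(2,4)]
    have "?s x < ?s y" "?s (srefl k x) < ?s (srefl k y)" "?s x < ?s (srefl k y)" "?s (srefl k x) < ?s y"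
      using xy b cr by (auto intro!: st)
    then show ?thesis using bnd[of x] bnd[of y] xy by linarith
  qed
  moreover have "0 < Im (?c (int k + 1) - ?c (int k))" if R: "Re (?c (int k + 1) - ?c (int k)) = 0"
  proof -
    have sin: "0 \<le> sin (pi * t)" using t by (intro sin_ge_zero) auto
    show ?thesis
    proof (cases "k = 0")
      case True
      then have d: "?c (int k + 1) - ?c (int k) = cis (pi * t)" by (simp add: hpath_def std_def)
      then have "cos (pi * t) = 0" using R by simp
      then have "sin (pi * t) \<noteq> 0" using sin_zero_abs_cos_one by fastforce
      then show ?thesis using sin unfolding d by simp
    next
      case False
      let ?A = "csqrt (of_nat k + 1/2 - cis (pi * t) / 2)" and ?B = "csqrt (of_nat k + 1/2 + cis (pi * t) / 2)"
      have d: "?c (int k + 1) - ?c (int k) = ?B - ?A"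
        using False by (simp add: hpath_def del: csqrt.sel)
      \<comment> \<open>The sine vanishes only when the two points occupy the marked places, and
        there the real parts of their roots differ.\<close>
      have "sin (pi * t) \<noteq> 0"
      proof
        assume s0: "sin (pi * t) = 0"
        then have "cos (pi * t) = 1 \<or> cos (pi * t) = - 1" using sin_zero_abs_cos_one[of "pi * t"] by linarith
        then have "cis (pi * t) = 1 \<or> cis (pi * t) = - 1" using s0 by (auto simp: complex_eq_iff)
        then have "Re ?A \<noteq> Re ?B"
        proof
          assume c: "cis (pi * t) = 1"
          have "of_nat k + 1/2 - (1::complex) / 2 = of_nat k" "of_nat k + 1/2 + (1::complex) / 2 = of_nat (k + 1)" by simp_all
          then show ?thesis unfolding c by (simp only: csqrt_nat) simp
        next
          assume c: "cis (pi * t) = - 1"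
          have "of_nat k + 1/2 - (- 1::complex) / 2 = of_nat (k + 1)" "of_nat k + 1/2 + (- 1::complex) / 2 = of_nat k" by simp_all
          then show ?thesis unfolding c by (simp only: csqrt_nat) simp
        qed
        then show False using R unfolding d by (simp del: csqrt.sel)
      qed
      then have "0 < sin (pi * t)" using sin by simp
      then have "Im ?A < 0" "0 < Im ?B" by (auto intro!: Im_csqrt_sign simp del: csqrt.sel)
      then show ?thesis unfolding d by (simp del: csqrt.sel)
    qed
  qed
  ultimately show ?thesis using hpath_oddfun[OF k] by (simp add: wall_def)
qed

lemma bpath_hpath:
  assumes "k < n"
  shows "bpath n (hpath n k) (srefl k)"
  using assms path_hpath hpath_0 hpath_1 srefl_in_signed_perms hpath_wall[OF assms] wall_oddconf[OF assms, of 1]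
  unfolding bpath_def by (auto simp: path_image_def)

text \<open>Squaring undoes \<open>csqrt\<close> exactly, so the systems of arcs are equal and not
  merely isotopic.\<close>

lemma cl_hpath_sigma:
  assumes "1 \<le> k" "k < n"
  shows "cl n (hpath n k) = sigma n k"
proof -
  have "barcs n (hpath n k) = half_twist_arcs (Suc n) k"
  proof
    fix j
    show "barcs n (hpath n k) j = half_twist_arcs (Suc n) k j"
      using assms by (auto simp: barcs_def arcs_of_def half_twist_arcs_def sqm_def hpath_def fun_eq_iff
          std_def sroot_power2 power_mult_distrib simp del: csqrt.sel)
  qed
  then show ?thesis by (simp add: cl_def cls_def sigma_def half_twist_def)
qed

lemma pth_half_twist:
  "pth (half_twist_arcs m k) t j = (if m \<le> j then 0 else if j = k then of_nat k + 1/2 - cis (pi * t) / 2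
     else if j = k + 1 then of_nat k + 1/2 + cis (pi * t) / 2 else of_nat j)"
  by (simp add: pth_def half_twist_arcs_def)

lemma dom_half_twist [simp]: "dom (half_twist_arcs m k) = {..<m}"
  by (auto simp: half_twist_arcs_def dom_def)

text \<open>This half twist moves the fixed string, so it lies outside the type B monoid and is
  treated without odd configurations. The points 0 and 1 stay in the unit disc at distance 1 from
  each other; the others have modulus at least 2.\<close>

lemma arc_system_half_twist_0:
  assumes "1 \<le> n"
  shows "arc_system (Suc n) (half_twist_arcs (Suc n) 0)"
proof -
  let ?H = "half_twist_arcs (Suc n) 0"
  have n1: "cmod (1/2 - cis a / 2) \<le> 1" "cmod (1/2 + cis a / 2) \<le> 1" for a
    using half_twist_point(2)[of "cis a" 0] half_twist_point(2)[of "- cis a" 0] by auto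
  have "path (\<lambda>t. pth ?H t j)" for j
    unfolding path_def pth_half_twist
    by (cases "Suc n \<le> j"; cases "j = 0"; cases "j = 1") (auto intro!: continuous_intros)
  moreover have "pth ?H t \<in> conf {..<Suc n}" for t
  proof -
    have ne: "pth ?H t i \<noteq> pth ?H t j" if "i < j" "j < Suc n" for i j
    proof (cases "j = 1")
      case True
      have "pth ?H t 1 - pth ?H t 0 = cis (pi * t)" using that True by (simp add: pth_half_twist)
      then show ?thesis using that True cis_neq_zero[of "pi * t"] by auto
    next
      case False
      then have "cmod (pth ?H t j) = real j" using that by (simp add: pth_half_twist)
      moreover have "cmod (pth ?H t i) < real j"
        using n1[of "pi * t"] that False by (cases "i = 0"; cases "i = 1") (auto simp: pth_half_twist)
      ultimately show ?thesis by auto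
    qed
    have "inj_on (pth ?H t) {..<Suc n}"
      by (rule linorder_inj_onI) (use ne in auto)
    then show ?thesis by (simp add: conf_def pth_half_twist)
  qed
  moreover have "pth ?H 0 j = of_nat j \<and> pth ?H 1 j \<in> of_nat ` {..<Suc n}" if "j < Suc n" for j
  proof -
    have "pth ?H 1 j = of_nat (if j = 0 then 1 else if j = 1 then 0 else j)" using that by (simp add: pth_half_twist)
    moreover have "(if j = 0 then 1 else if j = 1 then 0 else j) < Suc n" using that assms by simp
    ultimately show ?thesis using that by (auto simp: pth_half_twist simp del: of_nat_Suc)
  qed
  ultimately show ?thesis unfolding arc_system_iff by (auto simp: path_fun_iff path_image_def)
qed

text \<open>The square of the half twist turns the points 0 and 1 once about their midpoint. Sliding
  the centre of rotation to 0 makes the point 1 turn about a resting point 0, which is the square of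
  the lifted path.\<close>

lemma cl_hpath_tau:
  assumes "1 \<le> n"
  shows "cl n (hpath n 0) = tau n"
proof -
  let ?H = "half_twist_arcs (Suc n) 0"
  note aH = arc_system_half_twist_0[OF assms]
  define F where "F = (\<lambda>(t::real) j::nat. if j = 0 then 1/2 - cis (2 * pi * t) / 2
    else if j = 1 then 1/2 + cis (2 * pi * t) / 2 else of_nat j)"
  have e: "endp ?H j = (if j = 0 then 1 else if j = 1 then 0 else j)" if "j \<le> n" for j
    using that by (intro endp_eqI) (auto simp: pth_half_twist)
  have s: "sdom ?H ?H = {..n}"
    using e assms by (auto simp: sdom_def)
  have "(stack ?H ?H, arcs_of {..n} F) \<in> isotopy_rel (Suc n)"
  proof (rule isotopy_rel_pth_eqI)
    show "arc_system (Suc n) (stack ?H ?H)" by (intro arc_system_stack aH)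
    show "dom (stack ?H ?H) = dom (arcs_of {..n} F)" by (simp add: dom_stack s)
    fix t :: real and j assume "t \<in> {0..1}" "j \<in> dom (stack ?H ?H)"
    then have j: "j \<le> n" by (simp add: dom_stack s)
    \<comment> \<open>In the second half twist the two points have exchanged places; the sign
      compensates for this, so both halves fit into the single rotation \<open>F\<close>.\<close>
    have c: "cis (pi * (2 * t - 1)) = - cis (2 * pi * t)"
      using cis_mult[of "2 * pi * t" "- pi"] by (simp add: algebra_simps complex_eq_iff)
    show "pth (stack ?H ?H) t j = pth (arcs_of {..n} F) t j"
      using j assms unfolding pth_stack s
      by (auto simp: joinpaths_def pull_def e pth_half_twist pth_arcs_of F_def c mult.assoc mult.left_commute)
  qed
  also have "(arcs_of {..n} F, barcs n (hpath n 0)) \<in> isotopy_rel (Suc n)"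
  proof (rule isotopy_relI)
    show "arc_system (Suc n) (arcs_of {..n} F)"
      using isotopy_relD(2)[OF calculation] .
    \<comment> \<open>The difference of the points 1 and 0 is cis (2 pi t) at every stage, so they
      never meet, and both remain in the unit disc, away from the other points.\<close>
    define h where "h = (\<lambda>z j. if n < j then 0 else if j = 0 then of_real (1 - fst z) * (1/2 - cis (2 * pi * snd z) / 2)
      else if j = 1 then of_real (1 - fst z) / 2 + of_real (1 + fst z) * cis (2 * pi * snd z) / 2 else of_nat j)"
    have "homotopic_paths (conf {..n}) (pth (arcs_of {..n} F)) (pth (barcs n (hpath n 0)))"
    proof (rule homotopic_pathsI[of h])
      show "continuous_on ({0..1} \<times> {0..1}) h"
      proof (rule continuous_on_coordinatewise_then_product)
        show "continuous_on ({0..1} \<times> {0..1}) (\<lambda>z. h z j)" for j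
          unfolding h_def
          by (cases "n < j"; cases "j = 0"; cases "j = 1") (auto intro!: continuous_intros)
      qed
      show "h (s, t) \<in> conf {..n}" if st: "s \<in> {0..1}" "t \<in> {0..1}" for s t
      proof -
        let ?C = "cis (2 * pi * t)"
        have n0: "cmod (h (s, t) 0) \<le> 1"
        proof -
          have "cmod (h (s, t) 0) = (1 - s) * cmod (1/2 - ?C / 2)"
            using st by (simp add: h_def norm_mult flip: of_real_diff)
          also have "\<dots> \<le> 1 * 1"
            using st half_twist_point(2)[of "- ?C" 0] by (intro mult_mono) auto
          finally show ?thesis by simp
        qed
        have n1: "cmod (h (s, t) 1) \<le> 1" if "1 \<le> n"
        proof -
          have "cmod (h (s, t) 1) \<le> cmod (of_real ((1 - s) / 2)) + cmod (of_real ((1 + s) / 2) * ?C)"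
            using that norm_triangle_ineq[of "of_real ((1 - s) / 2)" "of_real ((1 + s) / 2) * ?C"] by (simp add: h_def)
          also have "\<dots> = 1" using st by (simp only: norm_mult norm_of_real norm_cis) (simp add: field_simps)
          finally show ?thesis .
        qed
        have ne: "h (s, t) i \<noteq> h (s, t) j" if "i < j" "j \<le> n" for i j
        proof (cases "j = 1")
          case True
          have "h (s, t) 1 - h (s, t) 0 = ?C" using that True by (simp add: h_def field_simps)
          then show ?thesis using that True cis_neq_zero[of "2 * pi * t"] by auto
        next
          case False
          then have "cmod (h (s, t) j) = real j" using that by (simp add: h_def)
          moreover have "cmod (h (s, t) i) < real j"
          proof -
            consider "i = 0" | "i = 1" | "1 < i" by linarith
            then show ?thesis
              using n0 n1 that False by cases (auto simp: h_def)
          qed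
          ultimately show ?thesis by auto
        qed
        have "inj_on (h (s, t)) {..n}"
          by (rule linorder_inj_onI) (use ne in auto)
        then show ?thesis by (simp add: conf_def h_def)
      qed
      have c2: "(cis (pi * t))\<^sup>2 = cis (2 * pi * t)" for t
        by (simp add: power2_eq_square cis_mult algebra_simps)
      show "h (0, t) = pth (arcs_of {..n} F) t" for t
        by (auto simp: fun_eq_iff h_def pth_arcs_of F_def)
      show "h (1, t) = pth (barcs n (hpath n 0)) t" for t
        by (auto simp: fun_eq_iff h_def pth_barcs sqm_def hpath_def std_def sroot_power2 c2)
      have "cis (pi * 2) = 1" by (metis cis_2pi mult.commute)
      then show "h (s, 0) = pth (arcs_of {..n} F) 0" "h (s, 1) = pth (arcs_of {..n} F) 1" for s
        by (auto simp: fun_eq_iff h_def pth_arcs_of F_def field_simps)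
    qed
    then show "homotopic_paths (conf (dom (arcs_of {..n} F))) (pth (arcs_of {..n} F)) (pth (barcs n (hpath n 0)))"
      by simp
  qed simp
  finally have "cls (Suc n) (stack ?H ?H) = cl n (hpath n 0)"
    unfolding cl_def by (rule cls_eqI)
  then show ?thesis
    using mult_cls[OF aH aH] by (simp add: tau_def half_twist_def flip: cls_def)
qed

section \<open>Paths in the generated subgroup\<close>

definition gens :: "nat \<Rightarrow> arcs set set" where
  "gens n = sigma n ` {1..<n} \<union> {tau n}"

lemma group_Br_B: "group (Br_B n)"
  unfolding Br_B_def by (rule monoid.units_group[OF monoid_IB_B])

lemma carrier_Br_B: "carrier (Br_B n) = Units (IB_B n)"
  by (simp add: Br_B_def units_of_def)

lemma mult_Br_B: "mult (Br_B n) = mult (IB_B n)" and one_Br_B: "one (Br_B n) = one (IB_B n)"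
  by (simp_all add: Br_B_def units_of_def)

lemma cl_hpath_gens: "k < n \<Longrightarrow> cl n (hpath n k) \<in> gens n"
  using cl_hpath_sigma[of k n] cl_hpath_tau[of n] by (cases "k = 0") (auto simp: gens_def)

lemma gens_in_carrier:
  assumes "1 \<le> n"
  shows "gens n \<subseteq> carrier (Br_B n)"
proof -
  have "cl n (hpath n k) \<in> carrier (Br_B n)" if "k < n" for k
    using cl_in_Units[OF bpath_hpath[OF that]] by (simp add: carrier_Br_B)
  then show ?thesis
    using cl_hpath_sigma[of _ n] cl_hpath_tau[OF assms] assms unfolding gens_def
    by (auto simp: Suc_le_eq) (metis One_nat_def Suc_le_eq)+
qed

definition genp :: "nat \<Rightarrow> (real \<Rightarrow> int \<Rightarrow> complex) \<Rightarrow> (int \<Rightarrow> int) \<Rightarrow> bool" where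
  "genp n p g \<longleftrightarrow> bpath n p g \<and> cl n p \<in> generate (Br_B n) (gens n)"

lemma genp_homotopic: "genp n p g \<Longrightarrow> homotopic_paths (oddconf n) p q \<Longrightarrow> genp n q g"
  using bpath_homotopic unfolding genp_def by auto

lemma genp_const: "genp n (\<lambda>t. std n) id"
  unfolding genp_def using bpath_const[of n] generate.one[of "Br_B n" "gens n"]
  by (simp add: cl_const one_Br_B)

lemma genp_comp: "genp n p g \<Longrightarrow> genp n q h \<Longrightarrow> genp n (p +++ (\<lambda>t. q t \<circ> g)) (h \<circ> g)"
  unfolding genp_def using bpath_comp[of n p g q h] cl_comp[of n p g q h] generate.eng[of "cl n p" "Br_B n" "gens n" "cl n q"]
  by (simp add: mult_Br_B)

lemma genp_inv:
  assumes "genp n p g" "1 \<le> n"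
  shows "genp n (\<lambda>t. reversepath p t \<circ> finv g) (finv g)"
proof -
  interpret group "Br_B n" by (rule group_Br_B)
  let ?q = "\<lambda>t. reversepath p t \<circ> finv g"
  have p: "bpath n p g" using assms by (simp add: genp_def)
  note q = bpath_inv[OF p]
  have c: "cl n p \<in> carrier (Br_B n)" "cl n ?q \<in> carrier (Br_B n)"
    using cl_in_Units[OF p] cl_in_Units[OF q] by (auto simp: carrier_Br_B)
  have "cl n p \<otimes>\<^bsub>Br_B n\<^esub> cl n ?q = \<one>\<^bsub>Br_B n\<^esub>"
    using cl_inv[OF p] by (simp add: mult_Br_B one_Br_B)
  then have "inv\<^bsub>Br_B n\<^esub> (cl n ?q) = cl n p" using c inv_equality by blast
  then have "cl n ?q = inv\<^bsub>Br_B n\<^esub> (cl n p)" using c by (metis inv_inv)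
  then show ?thesis
    using assms q generate_m_inv_closed[OF gens_in_carrier[OF assms(2)], of "cl n p"] by (simp add: genp_def)
qed

lemma genp_hpath: "k < n \<Longrightarrow> genp n (hpath n k) (srefl k)"
  unfolding genp_def using bpath_hpath cl_hpath_gens by (auto intro: generate.incl)

lemma wall_refl:
  assumes k: "k < n" and c: "c \<in> wall n k 1"
  shows "c \<circ> srefl k \<in> wall n k (- 1)"
proof -
  have o: "c \<in> oddfun n" using c by (simp add: wall_def)
  have d: "c (srefl k (int k + 1)) - c (srefl k (int k)) = - (c (int k + 1) - c (int k))"
  proof (cases "k = 0")
    case True
    have "c (- 1) = - c 1" using o unfolding oddfun_def by blast
    then show ?thesis using True oddfun_0[OF o] by (simp add: srefl_def)
  qed (simp add: srefl_k)
  have "Re (c (srefl k x)) < Re (c (srefl k y))"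
    if "- int n \<le> x" "x < y" "y \<le> int n" "srefl k x < srefl k y" for x y
  proof -
    have "- int n \<le> srefl k x" "srefl k y \<le> int n"
      using srefl_bounds[OF k, of x] srefl_bounds[OF k, of y] that by auto
    then show ?thesis using c that by (simp add: wall_def)
  qed
  moreover have "c \<circ> srefl k \<in> oddfun n"
    using oddfun_comp[OF o srefl_in_signed_perms[OF k]] .
  moreover have "0 < - Im (c (srefl k (int k + 1)) - c (srefl k (int k)))"
    if "Re (c (srefl k (int k + 1)) - c (srefl k (int k))) = 0"
    using c that unfolding d by (simp add: wall_def)
  ultimately show ?thesis by (simp add: wall_def)
qed

lemma finv_srefl: "finv (srefl k) = srefl k"
  by (rule inv_unique_comp) (auto simp: fun_eq_iff)

text \<open>The half twist passes on one side. Running it backwards and relabelling negates the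
  difference of the exchanged coordinates, so the inverse generator passes on the other
  side.\<close>

lemma genp_wall:
  assumes k: "k < n" and e: "e \<in> {1, - 1}"
  obtains \<gamma> where "genp n \<gamma> (srefl k)" "\<forall>t\<in>{0..1}. \<gamma> t \<in> wall n k e"
proof (cases "e = 1")
  case True
  then show thesis using that genp_hpath[OF k] hpath_wall[OF k] by blast
next
  case False
  then have e: "e = - 1" using e by simp
  let ?q = "\<lambda>t. reversepath (hpath n k) t \<circ> srefl k"
  have "genp n ?q (srefl k)"
    using genp_inv[OF genp_hpath[OF k]] k by (simp add: finv_srefl)
  moreover have "\<forall>t\<in>{0..1}. ?q t \<in> wall n k e"
    unfolding e reversepath_def by (intro ballI wall_refl[OF k] hpath_wall[OF k]) auto
  ultimately show thesis by (rule that)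
qed

section \<open>Tracking a path through the chambers\<close>

text \<open>The present chamber is named by \<open>h\<close>, and \<open>b\<close> is the present
  position carried back into the fundamental chamber. The straight segment closes \<open>v\<close>
  at the base configuration of the present chamber; being inside a convex chamber, it involves no
  choice up to homotopy.\<close>

definition track :: "nat \<Rightarrow> (real \<Rightarrow> int \<Rightarrow> complex) \<Rightarrow> (int \<Rightarrow> complex) \<Rightarrow> (int \<Rightarrow> int) \<Rightarrow> bool" where
  "track n v b h \<longleftrightarrow> path v \<and> path_image v \<subseteq> oddconf n \<and> v 1 = b \<circ> h \<and>
     b \<in> chamber n \<and> h \<in> signed_perms n \<and> genp n (v +++ lin (b \<circ> h) (std n \<circ> h)) h"

lemma lin_chamber_image: "a \<in> chamber n \<Longrightarrow> b \<in> chamber n \<Longrightarrow> path_image (lin a b) \<subseteq> chamber n"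
  unfolding path_image_def using chamber_lin by blast

lemma oddconf_lin_comp:
  assumes "a \<in> chamber n" "b \<in> chamber n" "h \<in> signed_perms n"
  shows "path_image (lin (a \<circ> h) (b \<circ> h)) \<subseteq> oddconf n"
proof -
  have "lin (a \<circ> h) (b \<circ> h) t \<in> oddconf n" if "t \<in> {0..1}" for t
    using oddconf_comp[OF _ assms(3), of "lin a b t"] chamber_lin[OF assms(1,2) that] chamber_oddconf[of n]
    by (auto simp: lin_comp)
  then show ?thesis by (auto simp: path_image_def)
qed

lemma track_homotopic:
  assumes "track n v b h" "homotopic_paths (oddconf n) v v'"
  shows "track n v' b h"
proof -
  have "pathfinish v' = pathfinish v" using homotopic_paths_imp_pathfinish[OF assms(2)] by simp
  then have f: "v' 1 = b \<circ> h" using assms(1) by (simp add: track_def pathfinish_def)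
  have "homotopic_paths (oddconf n) (v +++ lin (b \<circ> h) (std n \<circ> h)) (v' +++ lin (b \<circ> h) (std n \<circ> h))"
    using assms oddconf_lin_comp[OF _ std_in_chamber, of b n h]
    by (intro homotopic_paths_join) (auto simp: track_def path_lin pathfinish_def pathstart_def)
  then show ?thesis
    using assms(1) f homotopic_paths_imp_path[OF assms(2)] homotopic_paths_imp_subset[OF assms(2)]
    by (auto simp: track_def intro: genp_homotopic)
qed

text \<open>Both continuations run inside the same star-shaped set, hence are homotopic there; so the
  new return path differs from the old one by a generator.\<close>

lemma track_extend:
  assumes v: "track n v b h"
    and star: "\<forall>c\<in>K. \<forall>t\<in>{0..1}. lin z c t \<in> K" and K: "K \<subseteq> oddconf n" "chamber n \<subseteq> K"
    and \<gamma>: "genp n \<gamma> k" "path_image \<gamma> \<subseteq> K"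
    and s: "path s" "path_image s \<subseteq> K" "s 0 = b" "s 1 = b2 \<circ> k"
    and b2: "b2 \<in> chamber n" and k: "k \<in> signed_perms n" "\<And>c. c \<in> chamber n \<Longrightarrow> c \<circ> k \<in> K"
  shows "track n (v +++ (\<lambda>t. s t \<circ> h)) b2 (k \<circ> h)"
proof -
  have vv: "path v" "path_image v \<subseteq> oddconf n" "v 1 = b \<circ> h" "b \<in> chamber n" "h \<in> signed_perms n"
    "genp n (v +++ lin (b \<circ> h) (std n \<circ> h)) h"
    using v by (auto simp: track_def)
  have g: "path \<gamma>" "\<gamma> 0 = std n" "\<gamma> 1 = std n \<circ> k"
    using \<gamma>(1) by (auto simp: genp_def bpath_def)
  have L: "path_image (lin (b2 \<circ> k) (std n \<circ> k)) \<subseteq> K"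
    using k(2)[OF chamber_lin[OF b2 std_in_chamber]] by (auto simp: path_image_def lin_comp)
  have "homotopic_paths K (lin b (std n) +++ \<gamma>) (s +++ lin (b2 \<circ> k) (std n \<circ> k))"
  proof (rule star_homotopic[of K z])
    show "path (lin b (std n) +++ \<gamma>)" "path (s +++ lin (b2 \<circ> k) (std n \<circ> k))"
      using g s by (auto intro!: path_join_imp simp: path_lin pathfinish_def pathstart_def)
    show "path_image (lin b (std n) +++ \<gamma>) \<subseteq> K"
      using lin_chamber_image[OF vv(4) std_in_chamber] K(2) \<gamma>(2) by (intro subset_path_image_join) auto
    show "path_image (s +++ lin (b2 \<circ> k) (std n \<circ> k)) \<subseteq> K"
      using s(2) L by (intro subset_path_image_join)
  qed (use star g s in \<open>auto simp: joinpaths_def\<close>)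
  then have "homotopic_paths (oddconf n) (\<lambda>t. (lin b (std n) +++ \<gamma>) t \<circ> h)
      (\<lambda>t. (s +++ lin (b2 \<circ> k) (std n \<circ> k)) t \<circ> h)"
    by (intro homotopic_paths_precomp[OF _ vv(5)] homotopic_paths_subset[OF _ K(1)])
  moreover have "(\<lambda>t. (lin b (std n) +++ \<gamma>) t \<circ> h) = lin (b \<circ> h) (std n \<circ> h) +++ (\<lambda>t. \<gamma> t \<circ> h)"
    by (auto simp: joinpaths_def lin_def fun_eq_iff)
  moreover have "(\<lambda>t. (s +++ lin (b2 \<circ> k) (std n \<circ> k)) t \<circ> h) =
      (\<lambda>t. s t \<circ> h) +++ lin (b2 \<circ> (k \<circ> h)) (std n \<circ> (k \<circ> h))"
    by (auto simp: joinpaths_def lin_def fun_eq_iff)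
  ultimately have hp: "homotopic_paths (oddconf n) (lin (b \<circ> h) (std n \<circ> h) +++ (\<lambda>t. \<gamma> t \<circ> h))
      ((\<lambda>t. s t \<circ> h) +++ lin (b2 \<circ> (k \<circ> h)) (std n \<circ> (k \<circ> h)))" by simp
  have kh: "k \<circ> h \<in> signed_perms n" by (rule signed_perms_comp[OF vv(5) k(1)])
  have sh: "path (\<lambda>t. s t \<circ> h)" "path_image (\<lambda>t. s t \<circ> h) \<subseteq> oddconf n"
    using path_precomp[OF s(1) _ vv(5)] s(2) K(1) by auto
  have gh: "path (\<lambda>t. \<gamma> t \<circ> h)" "path_image (\<lambda>t. \<gamma> t \<circ> h) \<subseteq> oddconf n"
    using path_precomp[OF g(1) _ vv(5)] \<gamma>(2) K(1) by auto
  note im1 = oddconf_lin_comp[OF vv(4) std_in_chamber vv(5)] and im2 = oddconf_lin_comp[OF b2 std_in_chamber kh]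
  have "homotopic_paths (oddconf n) ((v +++ lin (b \<circ> h) (std n \<circ> h)) +++ (\<lambda>t. \<gamma> t \<circ> h))
      (v +++ (lin (b \<circ> h) (std n \<circ> h) +++ (\<lambda>t. \<gamma> t \<circ> h)))"
    using vv im1 gh g
    by (intro homotopic_paths_sym[OF homotopic_paths_assoc]) (auto simp: path_lin pathfinish_def pathstart_def)
  also have "homotopic_paths (oddconf n) \<dots>
      (v +++ ((\<lambda>t. s t \<circ> h) +++ lin (b2 \<circ> (k \<circ> h)) (std n \<circ> (k \<circ> h))))"
    using vv by (intro homotopic_paths_join hp) (auto simp: pathfinish_def pathstart_def joinpaths_def)
  also have "homotopic_paths (oddconf n) \<dots>
      ((v +++ (\<lambda>t. s t \<circ> h)) +++ lin (b2 \<circ> (k \<circ> h)) (std n \<circ> (k \<circ> h)))"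
    using vv im2 sh s
    by (intro homotopic_paths_assoc) (auto simp: path_lin pathfinish_def pathstart_def o_assoc)
  finally have "genp n ((v +++ (\<lambda>t. s t \<circ> h)) +++ lin (b2 \<circ> (k \<circ> h)) (std n \<circ> (k \<circ> h))) (k \<circ> h)"
    using genp_homotopic[OF genp_comp[OF vv(6) \<gamma>(1)]] by blast
  moreover have "path (v +++ (\<lambda>t. s t \<circ> h))" "path_image (v +++ (\<lambda>t. s t \<circ> h)) \<subseteq> oddconf n"
    using vv sh s by (auto intro!: path_join_imp simp: pathfinish_def pathstart_def)
      (use subset_path_image_join[OF vv(2) sh(2)] in blast)
  moreover have "(v +++ (\<lambda>t. s t \<circ> h)) 1 = b2 \<circ> (k \<circ> h)"
    using s by (simp add: joinpaths_def o_assoc)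
  ultimately show ?thesis using b2 kh by (simp add: track_def)
qed

text \<open>The case of \<open>track_extend\<close> in which the star-shaped set is the chamber
  itself and the generator is replaced by the constant path.\<close>

lemma track_same:
  assumes v: "track n v b h" and "b2 \<in> chamber n"
  shows "track n (v +++ lin (b \<circ> h) (b2 \<circ> h)) b2 h"
proof -
  have b: "b \<in> chamber n" using v by (simp add: track_def)
  have "track n (v +++ (\<lambda>t. lin b b2 t \<circ> h)) b2 (id \<circ> h)"
  proof (rule track_extend[OF v, of "chamber n" "std n" "\<lambda>t. std n"])
    show "\<forall>c\<in>chamber n. \<forall>t\<in>{0..1}. lin (std n) c t \<in> chamber n"
      using chamber_lin[OF std_in_chamber] by blast
  qed (use assms b chamber_oddconf lin_chamber_image[OF b assms(2)] genp_const std_in_chamber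
        in \<open>auto simp: path_lin path_image_def\<close>)
  then show ?thesis by (simp add: lin_comp)
qed

text \<open>The segment determines the side on which the points pass, and a generator or its inverse
  passes on the same side.\<close>

lemma track_cross:
  assumes v: "track n v b h" and b2: "b2 \<in> chamber n" and k: "k < n"
    and l: "\<And>t. t \<in> {0..1} \<Longrightarrow> lin b (b2 \<circ> srefl k) t \<in> oddconf n"
  shows "track n (v +++ lin (b \<circ> h) (b2 \<circ> srefl k \<circ> h)) b2 (srefl k \<circ> h)"
proof -
  have b: "b \<in> chamber n" using v by (simp add: track_def)
  obtain e where e: "e \<in> {1, - 1 :: real}" "\<forall>t\<in>{0..1}. lin b (b2 \<circ> srefl k) t \<in> wall n k e"
    using lin_in_wall[OF k b b2 l] by blast
  obtain z where z: "\<forall>c\<in>wall n k e. \<forall>t\<in>{0..1}. lin z c t \<in> wall n k e"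
    by (rule wall_star[OF k e(1)])
  obtain \<gamma> where \<gamma>: "genp n \<gamma> (srefl k)" "\<forall>t\<in>{0..1}. \<gamma> t \<in> wall n k e"
    by (rule genp_wall[OF k e(1)])
  have "track n (v +++ (\<lambda>t. lin b (b2 \<circ> srefl k) t \<circ> h)) b2 (srefl k \<circ> h)"
    using \<gamma> e(2)
    by (intro track_extend[OF v z wall_oddconf[OF k] chamber_wall[OF k] \<gamma>(1) _ path_lin _ _ _ b2
          srefl_in_signed_perms[OF k] chamber_refl_wall[OF k]])
      (auto simp: path_image_def)
  then show ?thesis by (simp add: lin_comp)
qed

lemma lin_lin_left: "lin a (lin a c s) t = lin a c (t * s)"
  by (auto simp: lin_def fun_eq_iff algebra_simps)

lemma lin_lin_right: "lin (lin a c s) c t = lin a c (s + t * (1 - s))"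
  by (auto simp: lin_def fun_eq_iff algebra_simps)

text \<open>A segment is star-shaped from its first end, so inside it all paths with the same ends
  are homotopic.\<close>

lemma lin_split:
  assumes "\<And>t. t \<in> {0..1} \<Longrightarrow> lin a c t \<in> U" and s: "s \<in> {0..1}"
  shows "homotopic_paths U (lin a (lin a c s) +++ lin (lin a c s) c) (lin a c)"
proof -
  let ?V = "lin a c ` {0..1}"
  have r: "t * s \<in> {0..1}" "s + t * (1 - s) \<in> {0..1}" if "t \<in> {0..1}" for t
  proof -
    show "t * s \<in> {0..1}" using that s by (auto intro: mult_le_one)
    have "t * (1 - s) \<le> 1 * (1 - s)" using that s by (intro mult_right_mono) auto
    then show "s + t * (1 - s) \<in> {0..1}" using that s by auto
  qed
  have "homotopic_paths ?V (lin a (lin a c s) +++ lin (lin a c s) c) (lin a c)"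
  proof (rule star_homotopic[of ?V a])
    fix d t assume "d \<in> ?V" and t: "t \<in> {0..1::real}"
    then obtain u where u: "u \<in> {0..1}" "d = lin a c u" by blast
    have "t * u \<in> {0..1}" using t u by (auto intro: mult_le_one)
    then show "lin a d t \<in> ?V" unfolding u(2) lin_lin_left by (rule imageI)
  next
    show "path (lin a (lin a c s) +++ lin (lin a c s) c)"
      by (intro path_join_imp path_lin) (simp add: pathfinish_def pathstart_def)
    show "path_image (lin a (lin a c s) +++ lin (lin a c s) c) \<subseteq> ?V"
    proof (rule subset_path_image_join)
      show "path_image (lin a (lin a c s)) \<subseteq> ?V" "path_image (lin (lin a c s) c) \<subseteq> ?V"
        unfolding path_image_def using r by (auto simp: lin_lin_left lin_lin_right)
    qed
  qed (auto simp: path_lin path_image_def joinpaths_def)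
  then show ?thesis by (rule homotopic_paths_subset) (use assms in auto)
qed

lemma track_trans:
  assumes "track n ((v +++ p) +++ q) b h" "homotopic_paths (oddconf n) (p +++ q) r"
    and "path v" "path_image v \<subseteq> oddconf n" "path p" "path_image p \<subseteq> oddconf n"
    "path q" "path_image q \<subseteq> oddconf n" "v 1 = p 0" "p 1 = q 0"
  shows "track n (v +++ r) b h"
proof (rule track_homotopic[OF assms(1)])
  have "homotopic_paths (oddconf n) ((v +++ p) +++ q) (v +++ (p +++ q))"
    using assms by (intro homotopic_paths_sym[OF homotopic_paths_assoc]) (auto simp: pathfinish_def pathstart_def)
  also have "homotopic_paths (oddconf n) \<dots> (v +++ r)"
    using assms by (intro homotopic_paths_join) (auto simp: pathfinish_def pathstart_def joinpaths_def)
  finally show "homotopic_paths (oddconf n) ((v +++ p) +++ q) (v +++ r)" .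
qed

text \<open>Oddness mirrors the inequalities between nonnegative neighbours to the negative side,
  and chaining neighbours gives all pairs.\<close>

lemma chamberI:
  assumes o: "c \<in> oddfun n" and s: "\<And>y. 0 \<le> y \<Longrightarrow> y < int n \<Longrightarrow> Re (c y) < Re (c (y + 1))"
  shows "c \<in> chamber n"
proof -
  have m: "c (- x) = - c x" for x using o by (simp add: oddfun_def)
  have step: "Re (c y) < Re (c (y + 1))" if "- int n \<le> y" "y < int n" for y
  proof (cases "0 \<le> y")
    case False
    then have "Re (c (- y - 1)) < Re (c (- y - 1 + 1))" using that by (intro s) auto
    moreover have "c (- y - 1) = - c (y + 1)" "c (- y - 1 + 1) = - c y"
      using m[of "y + 1"] m[of y] by simp_all
    ultimately show ?thesis by simp
  qed (use s that in simp)
  have "Re (c x) < Re (c y)" if "- int n \<le> x" "x < y" "y \<le> int n" for x y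
  proof -
    have "x + 1 \<le> y" using that by simp
    then have "y \<le> int n \<longrightarrow> Re (c x) < Re (c y)"
    proof (induction y rule: int_ge_induct)
      case base
      show ?case using step[of x] that by simp
    next
      case (step y)
      then show ?case using \<open>\<And>y. - int n \<le> y \<Longrightarrow> y < int n \<Longrightarrow> Re (c y) < Re (c (y + 1))\<close>[of y] that by auto
    qed
    then show ?thesis using that by simp
  qed
  then show ?thesis using o by (simp add: chamber_def)
qed

lemma srefl_nonneg:
  "0 \<le> y \<Longrightarrow> srefl k y = (if k = 0 then (if y = 1 then - 1 else y)
     else if y = int k then int k + 1 else if y = int k + 1 then int k else y)"
  by (auto simp: srefl_def sgn_if)

text \<open>Only the point at position \<open>x\<close> moves to the right, with its mirror image
  moving to the left. If it stays before its right neighbour, the chamber does not change. Otherwise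
  it is stopped just beyond that neighbour, the wall is crossed, and after relabelling it stands
  further to the right, so n - x decreases. Genericity of \<open>b'\<close> ensures that it does not
  come to rest vertically in line with a neighbour.\<close>

lemma track_move:
  assumes "track n v b h" "- int n \<le> x" "x \<le> int n" "b' \<in> oddfun n"
    and "\<And>y. y \<noteq> x \<Longrightarrow> y \<noteq> - x \<Longrightarrow> b' y = b y" "Re (b x) < Re (b' x)"
    and "\<And>t. t \<in> {0..1} \<Longrightarrow> lin b b' t \<in> oddconf n"
    and "\<And>y z. \<bar>y\<bar> \<le> int n \<Longrightarrow> \<bar>z\<bar> \<le> int n \<Longrightarrow> y \<noteq> z \<Longrightarrow> Re (b' y) \<noteq> Re (b' z)"
  shows "\<exists>b2 h2. track n (v +++ lin (b \<circ> h) (b' \<circ> h)) b2 h2"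
  using assms
proof (induction "nat (int n - x)" arbitrary: v b h b' x rule: less_induct)
  case less
  note v = less.prems(1) and x = less.prems(2,3) and o' = less.prems(4) and same = less.prems(5)
    and up = less.prems(6) and line = less.prems(7) and gen = less.prems(8)
  have bc: "b \<in> chamber n" using v by (simp add: track_def)
  then have o: "b \<in> oddfun n" by (simp add: chamber_def)
  have m: "b (- y) = - b y" "b' (- y) = - b' y" for y using o o' by (auto simp: oddfun_def)
  have B: "Re (b y) < Re (b z)" if "- int n \<le> y" "y < z" "z \<le> int n" for y z
    using bc that by (simp add: chamber_def)
  have x0: "x \<noteq> 0" using up oddfun_0[OF o] oddfun_0[OF o'] by auto
  have n1: "1 \<le> n" using x x0 by linarith
  show ?case
  proof (cases "x = int n \<or> Re (b' x) < Re (b (x + 1))")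
    case True
    have "b' \<in> chamber n"
    proof (rule chamberI[OF o'])
      fix y assume y: "0 \<le> y" "y < int n"
      consider "y = x" | "y + 1 = x" | "y = - x" | "y + 1 = - x"
        | "y \<noteq> x" "y \<noteq> - x" "y + 1 \<noteq> x" "y + 1 \<noteq> - x" by blast
      then show "Re (b' y) < Re (b' (y + 1))"
      proof cases
        case 1
        have "b' (y + 1) = b (y + 1)" using 1 y by (intro same) auto
        then show ?thesis using True 1 y by simp
      next
        case 2
        have "b' y = b y" using 2 by (intro same) presburger+
        then show ?thesis using B[of y x] y 2 x up by auto
      next
        case 3
        have "b' (y + 1) = b (y + 1)" using 3 by (intro same) presburger+
        moreover have "Re (b y) < Re (b (y + 1))" using y by (intro B) auto
        ultimately show ?thesis using m(1)[of x] m(2)[of x] 3 up by simp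
      next
        case 4
        have "b' y = b y" using 4 by (intro same) presburger+
        moreover have "b y = - b (x + 1)"
        proof -
          have y: "y = - (x + 1)" using 4 by simp
          show ?thesis unfolding y by (rule m(1))
        qed
        moreover have "b' (y + 1) = - b' x" using m(2)[of x] 4 by simp
        moreover have "x \<noteq> int n" using 4 y by auto
        ultimately show ?thesis using True by simp
      next
        case 5
        then have "b' y = b y" "b' (y + 1) = b (y + 1)" using same by auto
        then show ?thesis using B[of y "y + 1"] y by simp
      qed
    qed
    then show ?thesis using track_same[OF v] by blast
  next
    case False
    then have xn: "x < int n" and le: "Re (b (x + 1)) \<le> Re (b' x)" using x by auto
    have "b' (x + 1) = b (x + 1)" by (intro same) presburger+
    moreover have "Re (b' (x + 1)) \<noteq> Re (b' x)" using x xn by (intro gen) auto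
    ultimately have lt: "Re (b (x + 1)) < Re (b' x)" using le by simp
    \<comment> \<open>The neighbour after the one being passed. At position -1 the point passes 0
      and its own mirror image at the same moment, so the next obstacle is 2.\<close>
    define nx where "nx = (if x = - 1 then 2 else x + 2)"
    define M where "M = (if nx \<le> int n then min (Re (b' x)) (Re (b nx)) else Re (b' x))"
    have "nx \<le> int n \<longrightarrow> Re (b (x + 1)) < Re (b nx)" using x by (auto simp: nx_def intro!: B)
    then have "Re (b (x + 1)) < M" using lt by (auto simp: M_def)
    then obtain r where "Re (b (x + 1)) < r" "r < M" using dense by blast
    then have r: "Re (b (x + 1)) < r" "r < Re (b' x)" "nx \<le> int n \<Longrightarrow> r < Re (b nx)"
      by (auto simp: M_def split: if_splits)
    have rx: "Re (b x) < r" using r(1) B[of x "x + 1"] x xn by simp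
    \<comment> \<open>The time at which the moving point reaches real part \<open>r\<close>,
      strictly between the neighbour it has passed and the next one.\<close>
    define s where "s = (r - Re (b x)) / (Re (b' x) - Re (b x))"
    have s: "s \<in> {0..1}" using up rx r(2) by (auto simp: s_def field_simps)
    define c where "c = lin b b' s"
    have c_same: "c y = b y" if "y \<noteq> x" "y \<noteq> - x" for y
      using same[OF that] by (simp add: c_def lin_def algebra_simps)
    have "Re (c x) = Re (b x) + s * (Re (b' x) - Re (b x))"
      by (simp add: c_def lin_def algebra_simps)
    then have cx: "Re (c x) = r" using up by (simp add: s_def)
    have co: "c \<in> oddfun n" unfolding c_def by (rule oddfun_lin[OF o o'])
    have cm: "c (- y) = - c y" for y using co by (simp add: oddfun_def)
    \<comment> \<open>For positive \<open>x\<close> the wall lies between \<open>x\<close> and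
      \<open>x + 1\<close>; for \<open>x\<close> below -1 it is found at the mirror images
      \<open>- x - 1\<close> and \<open>- x\<close>.\<close>
    define k where "k = (if x = - 1 then 0 else if x > 0 then nat x else nat (- x - 1))"
    have k: "k < n" using x xn x0 n1 by (auto simp: k_def)
    define x' where "x' = (if x = - 1 then 1 else x + 1)"
    have sx: "srefl k x = x'" using x0 by (auto simp: k_def x'_def srefl_def sgn_if)
    have sx': "srefl k x' = x" using srefl_refl[of k x] by (simp add: sx)
    let ?b2 = "c \<circ> srefl k" and ?b3 = "b' \<circ> srefl k"
    have b2: "?b2 \<in> chamber n"
    proof (rule chamberI)
      show "?b2 \<in> oddfun n" by (rule oddfun_comp[OF co srefl_in_signed_perms[OF k]])
      fix y assume y: "0 \<le> y" "y < int n"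
      have By: "Re (b y) < Re (b (y + 1))" using y by (intro B) auto
      consider "x = - 1" | "x > 0" | "x \<le> - 2" using x0 by linarith
      then show "Re (?b2 y) < Re (?b2 (y + 1))"
      proof cases
        case 1
        then have "k = 0" by (simp add: k_def)
        consider "y = 0" | "y = 1" | "y \<ge> 2" using y by linarith
        then show ?thesis
        proof cases
          case [simp]: 1
          then show ?thesis
            using \<open>k = 0\<close> \<open>x = - 1\<close> cx r(1) oddfun_0[OF o] oddfun_0[OF co] by (simp add: srefl_nonneg)
        next
          case [simp]: 2
          have "c 2 = b 2" using \<open>x = - 1\<close> by (intro c_same) auto
          then show ?thesis
            using \<open>k = 0\<close> \<open>x = - 1\<close> cx r(3) y by (simp add: srefl_nonneg nx_def)
        next
          case 3
          then have "c y = b y" "c (y + 1) = b (y + 1)" using \<open>x = - 1\<close> by - ((rule c_same; presburger)+)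
          then show ?thesis
            using 3 \<open>k = 0\<close> By by (simp add: srefl_nonneg)
        qed
      next
        case 2
        then have kx: "int k = x" "k \<noteq> 0" by (auto simp: k_def)
        consider "y = x - 1" | "y = x" | "y = x + 1" | "y \<noteq> x - 1" "y \<noteq> x" "y \<noteq> x + 1" by blast
        then show ?thesis
        proof cases
          case 1
          have "c (x - 1) = b (x - 1)" "c (x + 1) = b (x + 1)" using 2 by - ((rule c_same; presburger)+)
          moreover have "Re (b (x - 1)) < Re (b (x + 1))" using x xn 2 by (intro B) auto
          ultimately show ?thesis using 1 kx y by (simp add: srefl_nonneg)
        next
          case y: 2
          have "c (x + 1) = b (x + 1)" using 2 by - ((rule c_same; presburger)+)
          then show ?thesis using y kx 2 r(1) cx by (simp add: srefl_nonneg)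
        next
          case 3
          have "c (x + 2) = b (x + 2)" using 2 by - ((rule c_same; presburger)+)
          then show ?thesis using 3 kx 2 r(3) cx y by (simp add: srefl_nonneg nx_def add.commute)
        next
          case 4
          then have "srefl k y = y" "srefl k (y + 1) = y + 1" using kx y by (auto simp: srefl_nonneg)
          moreover have "c y = b y" "c (y + 1) = b (y + 1)" using 4 2 y by - ((rule c_same; presburger)+)
          ultimately show ?thesis using By by simp
        qed
      next
        case 3
        then have kx: "int k = - x - 1" "k \<noteq> 0" by (auto simp: k_def)
        have cj: "Re (c (- x)) = - r" using cm[of x] cx by simp
        consider "y = - x - 2" | "y = - x - 1" | "y = - x" | "y \<noteq> - x - 2" "y \<noteq> - x - 1" "y \<noteq> - x" by blast
        then show ?thesis
        proof cases
          case 1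
          have "c (- x - 2) = b (- x - 2)" using 3 by - ((rule c_same; presburger)+)
          moreover have "b (- x - 2) = - b (x + 2)" using m(1)[of "x + 2"] by simp
          ultimately show ?thesis using 1 kx y 3 r(3) cj x by (simp add: srefl_nonneg nx_def)
        next
          case 2
          have "c (- x - 1) = b (- x - 1)" using 3 by - ((rule c_same; presburger)+)
          moreover have "b (- x - 1) = - b (x + 1)" using m(1)[of "x + 1"] by simp
          ultimately show ?thesis using 2 kx y 3 r(1) cj by (simp add: srefl_nonneg)
        next
          case y: 3
          have "c (- x - 1) = b (- x - 1)" "c (- x + 1) = b (- x + 1)" using 3 by - ((rule c_same; presburger)+)
          moreover have "Re (b (- x - 1)) < Re (b (- x + 1))"
            using \<open>y < int n\<close> y 3 x by (intro B) auto
          ultimately show ?thesis using y kx 3 by (simp add: srefl_nonneg)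
        next
          case 4
          then have "srefl k y = y" "srefl k (y + 1) = y + 1" using kx y by (auto simp: srefl_nonneg)
          moreover have "c y = b y" "c (y + 1) = b (y + 1)" using 4 3 y by - ((rule c_same; presburger)+)
          ultimately show ?thesis using By by simp
        qed
      qed
    qed
    \<comment> \<open>The relabelling of the configuration is undone by that of the chamber, so the
      path itself is unaffected and the induction continues it.\<close>
    have cc: "?b2 \<circ> srefl k = c" "?b2 \<circ> (srefl k \<circ> h) = c \<circ> h" "?b3 \<circ> (srefl k \<circ> h) = b' \<circ> h"
      by (auto simp: fun_eq_iff)
    have v1: "track n (v +++ lin (b \<circ> h) (c \<circ> h)) ?b2 (srefl k \<circ> h)"
    proof -
      have "lin b (?b2 \<circ> srefl k) t \<in> oddconf n" if "t \<in> {0..1}" for t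
        unfolding cc(1) unfolding c_def lin_lin_left using that s by (intro line) (auto intro: mult_le_one)
      from track_cross[OF v b2 k this] show ?thesis unfolding cc(1) .
    qed
    have "\<exists>b2 h2. track n ((v +++ lin (b \<circ> h) (c \<circ> h)) +++ lin (?b2 \<circ> (srefl k \<circ> h)) (?b3 \<circ> (srefl k \<circ> h))) b2 h2"
    proof (rule less.hyps[OF _ v1, of x'])
      show "nat (int n - x') < nat (int n - x)" "- int n \<le> x'" "x' \<le> int n"
        using x xn n1 by (auto simp: x'_def)
      show "?b3 \<in> oddfun n" by (rule oddfun_comp[OF o' srefl_in_signed_perms[OF k]])
      show "?b3 y = ?b2 y" if "y \<noteq> x'" "y \<noteq> - x'" for y
      proof -
        have inv: "y = srefl k (srefl k y)" by simp
        have "srefl k y \<noteq> x" using inv that(1) sx by metis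
        moreover have "srefl k y \<noteq> - x" using inv that(2) sx srefl_minus[of k x] by metis
        ultimately have "srefl k y \<noteq> x" "srefl k y \<noteq> - x" by auto
        then show ?thesis using c_same same by simp
      qed
      show "Re (?b2 x') < Re (?b3 x')" using cx r(2) by (simp add: sx')
      show "lin ?b2 ?b3 t \<in> oddconf n" if t: "t \<in> {0..1}" for t
      proof -
        have "t * (1 - s) \<le> 1 * (1 - s)" using t s by (intro mult_right_mono) auto
        then have "s + t * (1 - s) \<in> {0..1}" using t s by auto
        then have "lin c b' t \<in> oddconf n" unfolding c_def lin_lin_right by (rule line)
        then show ?thesis
          using oddconf_comp[OF _ srefl_in_signed_perms[OF k]] by (simp add: lin_comp[symmetric])
      qed
      show "Re (?b3 y) \<noteq> Re (?b3 z)" if "\<bar>y\<bar> \<le> int n" "\<bar>z\<bar> \<le> int n" "y \<noteq> z" for y z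
      proof -
        have "srefl k y \<noteq> srefl k z" using that(3) srefl_refl by metis
        then show ?thesis
          using that signed_permsD(4)[OF srefl_in_signed_perms[OF k]] by (simp add: gen)
      qed
    qed
    then obtain b2 h2 where T: "track n ((v +++ lin (b \<circ> h) (c \<circ> h)) +++ lin (c \<circ> h) (b' \<circ> h)) b2 h2"
      unfolding cc by blast
    have h: "h \<in> signed_perms n" "path v" "path_image v \<subseteq> oddconf n" "v 1 = b \<circ> h"
      using v by (auto simp: track_def)
    have lh: "lin (b \<circ> h) (b' \<circ> h) t \<in> oddconf n" if "t \<in> {0..1}" for t
      using oddconf_comp[OF line[OF that] h(1)] by (simp add: lin_comp)
    have ch: "c \<circ> h = lin (b \<circ> h) (b' \<circ> h) s" by (simp add: c_def lin_comp)
    have hp: "homotopic_paths (oddconf n) (lin (b \<circ> h) (c \<circ> h) +++ lin (c \<circ> h) (b' \<circ> h)) (lin (b \<circ> h) (b' \<circ> h))"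
      unfolding ch by (rule lin_split[OF lh s])
    have "path_image (lin (b \<circ> h) (c \<circ> h) +++ lin (c \<circ> h) (b' \<circ> h)) \<subseteq> oddconf n"
      using homotopic_paths_imp_subset[OF hp] by simp
    then have "path_image (lin (b \<circ> h) (c \<circ> h)) \<subseteq> oddconf n" "path_image (lin (c \<circ> h) (b' \<circ> h)) \<subseteq> oddconf n"
      by (subst (asm) path_image_join; simp add: pathfinish_def pathstart_def)+
    then have "track n (v +++ lin (b \<circ> h) (b' \<circ> h)) b2 h2"
      using h by (intro track_trans[OF T hp]) (auto simp: path_lin)
    then show ?thesis by blast
  qed
qed

definition mix :: "nat \<Rightarrow> (int \<Rightarrow> complex) \<Rightarrow> (int \<Rightarrow> complex) \<Rightarrow> int \<Rightarrow> complex" where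
  "mix j a b x = (if \<bar>x\<bar> \<le> int j then b x else a x)"

text \<open>Closure under \<open>mix\<close> allows one to move the coordinates one after the other.\<close>

definition convex_box :: "nat \<Rightarrow> (int \<Rightarrow> complex) set \<Rightarrow> bool" where
  "convex_box n B \<longleftrightarrow> B \<subseteq> oddconf n \<and> (\<forall>a\<in>B. \<forall>b\<in>B. \<forall>t\<in>{0..1}. lin a b t \<in> B) \<and>
     (\<forall>a\<in>B. \<forall>b\<in>B. \<forall>j. mix j a b \<in> B)"

lemma box_lin_image: "convex_box n B \<Longrightarrow> a \<in> B \<Longrightarrow> b \<in> B \<Longrightarrow> path_image (lin a b) \<subseteq> B"
  by (auto simp: convex_box_def path_image_def)

lemma box_homotopic:
  assumes "convex_box n B" "path p" "path_image p \<subseteq> B" "path q" "path_image q \<subseteq> B" "p 0 = q 0" "p 1 = q 1"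
  shows "homotopic_paths (oddconf n) p q"
proof -
  have "p 0 \<in> B" using assms(3) by (auto simp: path_image_def)
  then have "homotopic_paths B p q"
    using assms by (intro star_homotopic[of B "p 0"]) (auto simp: convex_box_def)
  then show ?thesis using assms(1) by (auto simp: convex_box_def intro: homotopic_paths_subset)
qed

section \<open>Straight moves inside convex boxes\<close>

text \<open>Precomposition with the inverse of \<open>h\<close> carries the move into the
  fundamental chamber. If the real part of the coordinate changes, one of the indices
  \<open>i\<close>, \<open>- i\<close> moves to the right, as \<open>track_move\<close> demands;
  otherwise the chamber is kept.\<close>

lemma track_step:
  assumes v: "track n v b h" and B: "convex_box n B" and c: "b \<circ> h = c" "c \<in> B" "c' \<in> B"
    and same: "\<And>y. \<bar>y\<bar> \<noteq> i \<Longrightarrow> c' y = c y"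
    and gen: "\<And>y z. \<bar>y\<bar> \<le> int n \<Longrightarrow> \<bar>z\<bar> \<le> int n \<Longrightarrow> y \<noteq> z \<Longrightarrow> Re (c' y) \<noteq> Re (c' z)"
  shows "\<exists>b2 h2. track n (v +++ lin c c') b2 h2"
proof -
  have h: "h \<in> signed_perms n" and b: "b \<in> chamber n" using v by (auto simp: track_def)
  note hi = signed_perms_inv[OF h]
  let ?b = "c' \<circ> finv h"
  have bh: "?b \<circ> h = c'" using hi(2) by (simp add: o_assoc[symmetric])
  have bb: "b = c \<circ> finv h" using c(1) hi(3) by (metis comp_assoc comp_id)
  have inv: "h (finv h y) = y" "finv h (h y) = y" for y
    using hi(2,3) by (auto simp: fun_eq_iff)
  have cc: "c \<in> oddfun n" "c' \<in> oddfun n"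
    using c B oddconf_oddfun[of n] by (auto simp: convex_box_def)
  have bo: "?b \<in> oddfun n" by (rule oddfun_comp[OF cc(2) hi(1)])
  have neg: "c (- y) = - c y" "c' (- y) = - c' y" for y using cc by (auto simp: oddfun_def)
  show ?thesis
  proof (cases "Re (c' i) = Re (c i)")
    case True
    have "Re (c' y) = Re (c y)" for y
    proof (cases "\<bar>y\<bar> = i")
      case yi: True
      then have "y = i \<or> y = - i" by linarith
      then show ?thesis using True neg[of i] by auto
    qed (simp add: same)
    then have "Re (?b y) = Re (b y)" for y by (simp add: bb)
    then have "?b \<in> chamber n" using b bo by (simp add: chamber_def)
    from track_same[OF v this] show ?thesis unfolding bh c(1) by blast
  next
    case False
    have "\<exists>k. (k = i \<or> k = - i) \<and> Re (c k) < Re (c' k)"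
    proof (cases "Re (c i) < Re (c' i)")
      case lt: False
      then have "Re (c (- i)) < Re (c' (- i))" using False neg[of i] by simp
      then show ?thesis by blast
    qed blast
    then obtain k where k: "k = i \<or> k = - i" "Re (c k) < Re (c' k)" by blast
    have kn: "\<bar>k\<bar> \<le> int n"
    proof (rule ccontr)
      assume "\<not> \<bar>k\<bar> \<le> int n"
      then have "c k = 0" "c' k = 0" using cc by (auto simp: oddfun_def)
      then show False using k by simp
    qed
    have "\<exists>b2 h2. track n (v +++ lin (b \<circ> h) (?b \<circ> h)) b2 h2"
    proof (rule track_move[OF v, of "h k"])
      show "- int n \<le> h k" "h k \<le> int n" using signed_permsD(4)[OF h, of k] kn by auto
      show "?b y = b y" if "y \<noteq> h k" "y \<noteq> - h k" for y
      proof -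
        have "finv h y \<noteq> k" "finv h y \<noteq> - k"
          using that inv(1)[of y] signed_permsD(2)[OF h, of k] by auto
        then have "\<bar>finv h y\<bar> \<noteq> i" using k(1) by linarith
        then show ?thesis using same by (simp add: bb)
      qed
      show "Re (b (h k)) < Re (?b (h k))" using k(2) by (simp add: bb inv)
      show "lin b ?b t \<in> oddconf n" if "t \<in> {0..1}" for t
      proof -
        have "lin c c' t \<in> oddconf n" using B c that by (auto simp: convex_box_def)
        from oddconf_comp[OF this hi(1)] show ?thesis by (simp add: bb lin_comp)
      qed
      show "Re (?b y) \<noteq> Re (?b z)" if "\<bar>y\<bar> \<le> int n" "\<bar>z\<bar> \<le> int n" "y \<noteq> z" for y z
      proof -
        have "finv h y \<noteq> finv h z" using that(3) inv(1) by metis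
        then show ?thesis using that signed_permsD(4)[OF hi(1)] by (simp add: gen)
      qed
    qed (rule bo)
    then show ?thesis unfolding bh c(1) .
  qed
qed

text \<open>The coordinates are moved one after the other through the mixed configurations. All of
  them lie in the box, where the broken line is homotopic to the straight one.\<close>

lemma track_box:
  assumes v: "track n v b h" and B: "convex_box n B" "v 1 \<in> B" "a' \<in> B"
    and gen: "\<And>j y z. \<bar>y\<bar> \<le> int n \<Longrightarrow> \<bar>z\<bar> \<le> int n \<Longrightarrow> y \<noteq> z \<Longrightarrow> Re (mix j (v 1) a' y) \<noteq> Re (mix j (v 1) a' z)"
  shows "\<exists>b2 h2. track n (v +++ lin (v 1) a') b2 h2"
proof -
  let ?a = "v 1" and ?m = "\<lambda>j. mix j (v 1) a'"
  have vp: "path v" "path_image v \<subseteq> oddconf n" using v by (auto simp: track_def)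
  have sub: "B \<subseteq> oddconf n" using B(1) by (simp add: convex_box_def)
  have o: "?a \<in> oddfun n" "a' \<in> oddfun n" using B sub oddconf_oddfun by auto
  have mB: "?m j \<in> B" for j using B by (simp add: convex_box_def)
  \<comment> \<open>The mixture at 0 replaces only the coordinate 0, where both configurations
    vanish.\<close>
  have m0: "?m 0 = ?a" using oddfun_0[OF o(1)] oddfun_0[OF o(2)] by (auto simp: mix_def fun_eq_iff)
  have mn: "?m n = a'" using o by (auto simp: mix_def fun_eq_iff oddfun_def)
  have "\<exists>b2 h2. track n (v +++ lin ?a (?m j)) b2 h2" for j
  proof (induction j)
    case 0
    have "lin ?a ?a = (\<lambda>t. ?a)" by (rule ext) simp
    moreover have "homotopic_paths (oddconf n) v (v +++ (\<lambda>t. ?a))"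
      using vp by (intro homotopic_paths_sym[OF homotopic_paths_const_right]) (auto simp: pathfinish_def)
    ultimately show ?case using track_homotopic[OF v] unfolding m0 by metis
  next
    case (Suc j)
    then obtain b2 h2 where T: "track n (v +++ lin ?a (?m j)) b2 h2" by blast
    then have e: "b2 \<circ> h2 = ?m j" by (simp add: track_def joinpaths_def)
    have "\<exists>b3 h3. track n ((v +++ lin ?a (?m j)) +++ lin (?m j) (?m (Suc j))) b3 h3"
    proof (rule track_step[OF T B(1) e mB mB, of "int (Suc j)"])
      show "?m (Suc j) y = ?m j y" if "\<bar>y\<bar> \<noteq> int (Suc j)" for y
        using that by (auto simp: mix_def)
    qed (rule gen)
    then obtain b3 h3 where T3: "track n ((v +++ lin ?a (?m j)) +++ lin (?m j) (?m (Suc j))) b3 h3" by blast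
    have im: "path_image (lin ?a (?m j)) \<subseteq> B" "path_image (lin (?m j) (?m (Suc j))) \<subseteq> B"
      "path_image (lin ?a (?m (Suc j))) \<subseteq> B"
      using box_lin_image[OF B(1)] B(2) mB by auto
    have "homotopic_paths (oddconf n) (lin ?a (?m j) +++ lin (?m j) (?m (Suc j))) (lin ?a (?m (Suc j)))"
      using im by (intro box_homotopic[OF B(1)] path_join_imp path_lin subset_path_image_join)
        (auto simp: pathfinish_def pathstart_def joinpaths_def)
    from track_trans[OF T3 this vp path_lin _ path_lin] have "track n (v +++ lin ?a (?m (Suc j))) b3 h3"
      using im sub by auto
    then show ?case by blast
  qed
  from this[of n] show ?thesis by (simp add: mn)
qed

section \<open>Subdivision of a path\<close>

lemma path_image_linepath_01:
  "u \<in> {0..1} \<Longrightarrow> v \<in> {0..1} \<Longrightarrow> path_image (linepath u v) \<subseteq> {0..1::real}"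
  by (simp add: closed_segment_subset)

lemma path_comp_linepath:
  fixes w :: "real \<Rightarrow> 'a::topological_space"
  assumes "path w" "u \<in> {0..1}" "v \<in> {0..1}"
  shows "path (w \<circ> linepath u v)"
proof -
  have "path_image (linepath u v) \<subseteq> {0..1}" using assms by (intro path_image_linepath_01)
  then show ?thesis
    using assms(1) by (intro path_continuous_image path_linepath) (auto simp: path_def intro: continuous_on_subset)
qed

lemma homotopic_linepath_join:
  fixes w :: "real \<Rightarrow> 'a::topological_space"
  assumes "path w" "path_image w \<subseteq> S" "u \<in> {0..1}" "v \<in> {0..1}" "x \<in> {0..1}"
  shows "homotopic_paths S ((w \<circ> linepath u v) +++ (w \<circ> linepath v x)) (w \<circ> linepath u x)"
proof -
  note im = path_image_linepath_01
  have "homotopic_paths S (w \<circ> (linepath u v +++ linepath v x)) (w \<circ> linepath u x)"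
  proof (rule homotopic_paths_reparam[OF assms(1,2)])
    show "continuous_on {0..1} (linepath u v +++ linepath v x)"
      using path_join_imp[OF path_linepath path_linepath, of u v v x] by (simp add: path_def)
    show "linepath u v +++ linepath v x \<in> {0..1} \<rightarrow> {0..1}"
      using subset_path_image_join[OF im[OF assms(3,4)] im[OF assms(4,5)]] by (auto simp: path_image_def)
    show "continuous_on {0..1} (linepath u x)"
      using path_linepath[of u x] by (simp add: path_def)
    show "linepath u x \<in> {0..1} \<rightarrow> {0..1}"
      using im[OF assms(3,5)] by (auto simp: path_image_def)
  qed (auto simp: joinpaths_def linepath_def)
  then show ?thesis unfolding path_compose_join .
qed

text \<open>The stabiliser of the fundamental chamber is trivial. Monotonicity bounds the values
  from below going up from 0 and from above going down from n.\<close>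

lemma strict_mono_signed_perm:
  assumes g: "g \<in> signed_perms n" and mono: "\<And>x y. - int n \<le> x \<Longrightarrow> x < y \<Longrightarrow> y \<le> int n \<Longrightarrow> g x < g y"
  shows "g = id"
proof -
  have up: "int j \<le> int n \<longrightarrow> int j \<le> g (int j)" for j
  proof (induction j)
    case 0
    then show ?case using signed_permsD(3)[OF g] by simp
  next
    case (Suc j)
    then show ?case using mono[of "int j" "int (Suc j)"] by auto
  qed
  have down: "j \<le> n \<longrightarrow> g (int (n - j)) \<le> int (n - j)" for j
  proof (induction j)
    case 0
    then show ?case using signed_permsD(4)[OF g, of "int n"] by simp
  next
    case (Suc j)
    show ?case
    proof
      assume s: "Suc j \<le> n"
      then have e: "int (n - j) = int (n - Suc j) + 1" by simp
      have "g (int (n - Suc j)) < g (int (n - j))" by (rule mono) (use e in auto)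
      then show "g (int (n - Suc j)) \<le> int (n - Suc j)" using Suc s e by simp
    qed
  qed
  have pos: "g x = x" if "0 \<le> x" "x \<le> int n" for x
    using up[of "nat x"] down[of "n - nat x"] that by (simp add: nat_le_iff)
  have "g x = x" for x
  proof (cases "\<bar>x\<bar> \<le> int n")
    case True
    then show ?thesis using pos[of x] pos[of "- x"] signed_permsD(2)[OF g, of x] by (cases "0 \<le> x") auto
  next
    case False
    then have "x \<notin> {- int n..int n}" by auto
    then show ?thesis using permutes_not_in[OF signed_permsD(1)[OF g]] by blast
  qed
  then show ?thesis by (simp add: fun_eq_iff)
qed

text \<open>Induction over the subintervals: inside its box each piece of the path may be replaced
  by a straight segment, which \<open>track_box\<close> handles. At the end the tracked chamber has
  to be identified with the end of the path, so that the closing segment becomes constant.\<close>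

lemma generated_if_boxes:
  assumes w: "bpath n w g" and N: "0 < N"
    and B: "\<And>i. i < N \<Longrightarrow> convex_box n (B i)"
      "\<And>i t. i < N \<Longrightarrow> t \<in> {real i / N..real (Suc i) / N} \<Longrightarrow> w t \<in> B i"
    and gen: "\<And>i j y z. i < N \<Longrightarrow> \<bar>y\<bar> \<le> int n \<Longrightarrow> \<bar>z\<bar> \<le> int n \<Longrightarrow> y \<noteq> z \<Longrightarrow>
      Re (mix j (w (real i / N)) (w (real (Suc i) / N)) y) \<noteq> Re (mix j (w (real i / N)) (w (real (Suc i) / N)) z)"
  shows "cl n w \<in> generate (Br_B n) (gens n)"
proof -
  have wp: "path w" "path_image w \<subseteq> oddconf n" "w 0 = std n" "w 1 = std n \<circ> g" "g \<in> signed_perms n"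
    using w by (auto simp: bpath_def)
  have "i \<le> N \<longrightarrow> (\<exists>b h. track n ((w \<circ> linepath 0 (real i / N))) b h)" for i
  proof (induction i)
    case 0
    have "w \<circ> linepath 0 (real 0 / N) = (\<lambda>t. std n)" using wp(3) by (simp add: linepath_def fun_eq_iff)
    moreover have "track n (\<lambda>t. std n) (std n) id"
    proof -
      have "lin (std n) (std n) = (\<lambda>t. std n)" by (rule ext) simp
      moreover have "homotopic_paths (oddconf n) (\<lambda>t. std n) ((\<lambda>t. std n) +++ (\<lambda>t. std n))"
        using std_in_oddconf[of n]
        by (intro homotopic_paths_sym[OF homotopic_paths_const_right]) (auto simp: path_def path_image_def pathfinish_def)
      from genp_homotopic[OF genp_const this] have "genp n ((\<lambda>t. std n) +++ (\<lambda>t. std n)) id" .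
      ultimately show ?thesis
        using std_in_oddconf[of n] std_in_chamber[of n] by (auto simp: track_def path_def path_image_def)
    qed
    ultimately have "track n (w \<circ> linepath 0 (real 0 / N)) (std n) id" by (simp only:)
    then show ?case by blast
  next
    case (Suc i)
    show ?case
    proof
      assume "Suc i \<le> N"
      then have i: "i < N" by simp
      then obtain b h where T: "track n ((w \<circ> linepath 0 (real i / N))) b h"
        using Suc less_imp_le[OF i] by blast
      let ?u = "real i / N" and ?v = "real (Suc i) / N"
      have uv: "?u \<in> {0..1}" "?v \<in> {0..1}" "?u \<le> ?v" using i by (auto simp: field_simps)
      have e: "(w \<circ> linepath 0 ?u) 1 = w ?u" by (simp add: linepath_def)
      have wB: "w ?u \<in> B i" "w ?v \<in> B i" using B(2)[OF i] uv(3) by auto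
      obtain b2 h2 where T2: "track n ((w \<circ> linepath 0 ?u) +++ lin (w ?u) (w ?v)) b2 h2"
        using track_box[OF T B(1)[OF i], unfolded e, OF wB gen[OF i]] by blast
      have sB: "path_image ((w \<circ> linepath ?u ?v)) \<subseteq> B i"
        unfolding path_image_compose path_image_linepath using B(2)[OF i] uv(3) by (auto simp: closed_segment_eq_real_ivl)
      have "homotopic_paths (oddconf n) (lin (w ?u) (w ?v)) ((w \<circ> linepath ?u ?v))"
        by (rule box_homotopic[OF B(1)[OF i] path_lin box_lin_image[OF B(1)[OF i] wB]
            path_comp_linepath[OF wp(1) uv(1,2)] sB]) (simp_all add: linepath_def)
      then have "homotopic_paths (oddconf n) ((w \<circ> linepath 0 ?u) +++ lin (w ?u) (w ?v)) ((w \<circ> linepath 0 ?u) +++ (w \<circ> linepath ?u ?v))"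
        using T by (intro homotopic_paths_join) (auto simp: track_def pathfinish_def pathstart_def linepath_def)
      also have "homotopic_paths (oddconf n) \<dots> ((w \<circ> linepath 0 ?v))"
        using uv by (intro homotopic_linepath_join wp(1,2)) auto
      finally show "\<exists>b h. track n ((w \<circ> linepath 0 ?v)) b h"
        using track_homotopic[OF T2] by blast
    qed
  qed
  moreover have "w \<circ> linepath 0 (real N / N) = w" using N by (simp add: fun_eq_iff linepath_def)
  ultimately obtain b h where T: "track n w b h" by (metis order_refl)
  then have h: "h \<in> signed_perms n" "b \<in> chamber n" "std n \<circ> g = b \<circ> h" "genp n (w +++ lin (b \<circ> h) (std n \<circ> h)) h"
    using wp by (auto simp: track_def)
  note hi = signed_perms_inv[OF h(1)]
  \<comment> \<open>A translate of the base configuration lies in the fundamental chamber, so the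
    translating permutation is increasing and hence trivial, which gives \<open>g\<close> =
    \<open>h\<close>.\<close>
  have "b = std n \<circ> (g \<circ> finv h)"
    using h(3) hi(3) by (metis comp_assoc comp_id)
  moreover have gh: "g \<circ> finv h \<in> signed_perms n" by (rule signed_perms_comp[OF hi(1) wp(5)])
  ultimately have "g \<circ> finv h = id"
  proof (intro strict_mono_signed_perm)
    fix x y assume b: "b = std n \<circ> (g \<circ> finv h)" and xy: "- int n \<le> x" "x < y" "y \<le> int n"
    let ?f = "g \<circ> finv h"
    have "Re (std n (?f x)) < Re (std n (?f y))" using h(2) xy b by (auto simp: chamber_def)
    moreover have "\<bar>?f x\<bar> \<le> int n" "\<bar>?f y\<bar> \<le> int n" using signed_permsD(4)[OF gh] xy by auto
    ultimately have lt: "Re (sroot (?f x)) < Re (sroot (?f y))" by (simp add: std_def)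
    show "?f x < ?f y"
    proof (rule ccontr)
      assume "\<not> ?f x < ?f y"
      then consider "?f y = ?f x" | "?f y < ?f x" by linarith
      then show False
      proof cases
        case 1
        show False using lt unfolding 1 by simp
      next
        case 2
        show False using lt Re_sroot_less[OF 2] by linarith
      qed
    qed
  qed
  then have gheq: "g = h" using hi(2) by (metis comp_assoc comp_id id_comp)
  have "lin (b \<circ> h) (std n \<circ> h) = (\<lambda>t. std n \<circ> h)" using h(3) gheq by (auto simp: fun_eq_iff lin_def algebra_simps)
  then have "homotopic_paths (oddconf n) (w +++ lin (b \<circ> h) (std n \<circ> h)) w"
    using wp gheq by (auto intro!: homotopic_paths_const_right simp: pathfinish_def)
  from genp_homotopic[OF h(4) this] show ?thesis by (simp add: genp_def)
qed

section \<open>General position by shearing\<close>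

lemma oddconf_neq: "c \<in> oddconf n \<Longrightarrow> \<bar>y\<bar> \<le> int n \<Longrightarrow> \<bar>z\<bar> \<le> int n \<Longrightarrow> y \<noteq> z \<Longrightarrow> c y \<noteq> c z"
  using inj_on_eq_iff[of c "{- int n..int n}" y z] by (auto simp: oddconf_def abs_le_iff)

text \<open>A real linear bijection: it preserves oddness, injectivity and segments and fixes the
  real line, so it moves no base configuration while it changes the real parts of other
  points.\<close>

definition shear :: "real \<Rightarrow> complex \<Rightarrow> complex" where
  "shear \<eta> z = Complex (Re z + \<eta> * Im z) (Im z)"

lemma shear_0 [simp]: "shear 0 z = z"
  by (simp add: shear_def)

lemma shear_shear: "shear a (shear b z) = shear (a + b) z"
  by (simp add: shear_def algebra_simps)

lemma shear_inj: "shear a z = shear a z' \<longleftrightarrow> z = z'"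
  by (auto simp: shear_def complex_eq_iff)

lemma shear_lin: "shear \<eta> \<circ> lin a b t = lin (shear \<eta> \<circ> a) (shear \<eta> \<circ> b) t"
  by (auto simp: shear_def lin_def fun_eq_iff complex_eq_iff algebra_simps)

lemma shear_oddconf: "shear \<eta> \<circ> c \<in> oddconf n \<longleftrightarrow> c \<in> oddconf n"
proof -
  have "shear \<eta> (- z) = - shear \<eta> z" "shear \<eta> 0 = 0" for z
    by (simp_all add: shear_def complex_eq_iff)
  then have "shear \<eta> (c (- x)) = - shear \<eta> (c x) \<longleftrightarrow> c (- x) = - c x" "shear \<eta> (c x) = 0 \<longleftrightarrow> c x = 0" for x
    using shear_inj by metis+
  then show ?thesis by (simp add: oddconf_def inj_on_def shear_inj)
qed

lemma shear_sroot: "shear \<eta> (sroot x) = sroot x"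
  by (simp add: shear_def sroot_def complex_eq_iff)

lemma shear_std: "shear \<eta> \<circ> std n = std n"
  by (auto simp: std_def fun_eq_iff shear_sroot) (simp add: shear_def complex_eq_iff)

lemma homotopic_shear:
  assumes "path w" "path_image w \<subseteq> oddconf n"
    "\<And>s. shear s \<circ> w 0 = w 0" "\<And>s. shear s \<circ> w 1 = w 1"
  shows "homotopic_paths (oddconf n) w (\<lambda>t. shear \<eta> \<circ> w t)"
proof (rule homotopic_pathsI[of "\<lambda>z. shear (fst z * \<eta>) \<circ> w (snd z)"])
  have w: "continuous_on {0..1} (\<lambda>t. w t x)" for x using assms(1) by (simp add: path_fun_iff path_def)
  have "continuous_on ({0..1} \<times> {0..1}) (\<lambda>z. w (snd z) x)" for x
    by (rule continuous_on_compose2[OF w]) (auto intro!: continuous_intros)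
  then show "continuous_on ({0..1} \<times> {0..1}) (\<lambda>z. shear (fst z * \<eta>) \<circ> w (snd z))"
    unfolding o_def shear_def Complex_eq
    by (intro continuous_on_coordinatewise_then_product continuous_intros)
  show "shear (fst (s, t) * \<eta>) \<circ> w (snd (s, t)) \<in> oddconf n" if "s \<in> {0..1}" "t \<in> {0..1}" for s t
    using assms(2) that by (auto simp: shear_oddconf path_image_def)
qed (use assms in \<open>auto simp: fun_eq_iff\<close>)

text \<open>Points with equal imaginary parts keep the difference of their real parts, and each
  other pair excludes exactly one value of \<open>\<eta>\<close>; only finitely many values are
  bad.\<close>

lemma generic_shear:
  assumes "finite P"
  obtains \<eta> where "inj_on (\<lambda>z. Re (shear \<eta> z)) P"
proof -
  let ?bad = "(\<lambda>(z, z'). - (Re z - Re z') / (Im z - Im z')) ` (P \<times> P)"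
  have "finite ?bad" using assms by simp
  then obtain \<eta> where \<eta>: "\<eta> \<notin> ?bad" using ex_new_if_finite[OF infinite_UNIV_char_0] by blast
  have "z = z'" if z: "z \<in> P" "z' \<in> P" "Re (shear \<eta> z) = Re (shear \<eta> z')" for z z'
  proof (cases "Im z = Im z'")
    case True
    then show ?thesis using z(3) by (simp add: shear_def complex_eq_iff)
  next
    case False
    then have "\<eta> = - (Re z - Re z') / (Im z - Im z')"
      using z(3) by (simp add: shear_def field_simps)
    then have "\<eta> \<in> ?bad" using z(1,2) by (intro image_eqI[of _ _ "(z, z')"]) auto
    then show ?thesis using \<eta> by simp
  qed
  then show thesis by (intro that[of \<eta>] inj_onI)
qed

text \<open>By compactness the signed points keep some distance \<open>d\<close> from each other at
  all times, and by uniform continuity each moves less than d/2 on a short interval.\<close>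

lemma path_boxes:
  assumes w: "path w" "path_image w \<subseteq> oddconf n"
  obtains N B where "0 < N" "\<forall>i<N. convex_box n (B i)"
    "\<forall>i<N. \<forall>t\<in>{real i / real N..real (Suc i) / real N}. w t \<in> B i"
proof -
  let ?I = "{- int n..int n}"
  have cw: "continuous_on {0..1} (\<lambda>t. w t x)" for x using w(1) by (simp add: path_fun_iff path_def)
  have wo: "w t \<in> oddconf n" if "t \<in> {0..1}" for t using w(2) that by (auto simp: path_image_def)
  \<comment> \<open>Formulated for all sufficiently small positive \<open>d\<close>, finitely many
    bounds combine into one without taking a minimum.\<close>
  have "eventually (\<lambda>d. \<forall>p\<in>?I \<times> ?I. fst p \<noteq> snd p \<longrightarrow> (\<forall>t\<in>{0..1}. d \<le> cmod (w t (fst p) - w t (snd p)))) (at_right 0)"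
  proof (rule eventually_ball_finite, simp, rule ballI)
    fix p assume p: "p \<in> ?I \<times> ?I"
    show "eventually (\<lambda>d. fst p \<noteq> snd p \<longrightarrow> (\<forall>t\<in>{0..1}. d \<le> cmod (w t (fst p) - w t (snd p)))) (at_right 0)"
    proof (cases "fst p = snd p")
      case False
      let ?f = "\<lambda>t. cmod (w t (fst p) - w t (snd p))"
      have "continuous_on {0..1} ?f" by (intro continuous_intros cw)
      then obtain t0 where t0: "t0 \<in> {0..1}" "\<forall>t\<in>{0..1}. ?f t0 \<le> ?f t"
        using continuous_attains_inf[of "{0..1::real}" ?f] by auto
      have "w t0 (fst p) \<noteq> w t0 (snd p)"
        using wo[OF t0(1)] p False unfolding oddconf_def by (auto dest: inj_onD)
      then have "0 < ?f t0" by simp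
      then have "eventually (\<lambda>d. d < ?f t0) (at_right 0)"
        unfolding eventually_at_right_field by (intro exI[of _ "?f t0"]) simp
      then show ?thesis
        by eventually_elim (use t0(2) in force)
    qed simp
  qed
  then have "eventually (\<lambda>d. 0 < d \<and> (\<forall>p\<in>?I \<times> ?I. fst p \<noteq> snd p \<longrightarrow>
      (\<forall>t\<in>{0..1}. d \<le> cmod (w t (fst p) - w t (snd p))))) (at_right (0::real))"
    using eventually_at_right_less[of "0::real"] by eventually_elim auto
  then obtain d where d0: "0 < d" and
    "\<forall>p\<in>?I \<times> ?I. fst p \<noteq> snd p \<longrightarrow> (\<forall>t\<in>{0..1}. d \<le> cmod (w t (fst p) - w t (snd p)))"
    using eventually_happens'[OF trivial_limit_at_right_real] by blast
  then have d: "d \<le> cmod (w t x - w t y)" if "x \<in> ?I" "y \<in> ?I" "x \<noteq> y" "t \<in> {0..1}" for x y t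
    using that by auto
  have "eventually (\<lambda>e. \<forall>x\<in>?I. \<forall>s\<in>{0..1}. \<forall>t\<in>{0..1}. \<bar>s - t\<bar> \<le> e \<longrightarrow> cmod (w s x - w t x) < d / 2) (at_right 0)"
  proof (rule eventually_ball_finite, simp, rule ballI)
    fix x
    have "uniformly_continuous_on {0..1} (\<lambda>t. w t x)"
      by (rule compact_uniformly_continuous[OF cw]) simp
    then obtain e where e: "0 < e" "\<And>s t. s \<in> {0..1} \<Longrightarrow> t \<in> {0..1} \<Longrightarrow> dist s t < e \<Longrightarrow> dist (w s x) (w t x) < d / 2"
      using d0 unfolding uniformly_continuous_on_def by (metis half_gt_zero)
    then have "eventually (\<lambda>e'. e' < e) (at_right 0)"
      unfolding eventually_at_right_field by (intro exI[of _ e]) simp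
    then show "eventually (\<lambda>e. \<forall>s\<in>{0..1}. \<forall>t\<in>{0..1}. \<bar>s - t\<bar> \<le> e \<longrightarrow> cmod (w s x - w t x) < d / 2) (at_right 0)"
      by eventually_elim (use e(2) in \<open>auto simp: dist_norm\<close>)
  qed
  then have "eventually (\<lambda>e. 0 < e \<and> (\<forall>x\<in>?I. \<forall>s\<in>{0..1}. \<forall>t\<in>{0..1}. \<bar>s - t\<bar> \<le> e \<longrightarrow> cmod (w s x - w t x) < d / 2)) (at_right (0::real))"
    using eventually_at_right_less[of "0::real"] by eventually_elim auto
  then obtain e where e0: "0 < e" and
    e: "\<forall>x\<in>?I. \<forall>s\<in>{0..1}. \<forall>t\<in>{0..1}. \<bar>s - t\<bar> \<le> e \<longrightarrow> cmod (w s x - w t x) < d / 2"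
    using eventually_happens'[OF trivial_limit_at_right_real] by blast
  obtain M where M: "inverse (real (Suc M)) < e" using reals_Archimedean[OF e0] by blast
  define N where "N = Suc M"
  have N: "0 < N" "1 / real N < e" using M by (auto simp: N_def inverse_eq_divide)
  \<comment> \<open>Discs of radius d/2 about points at distance at least \<open>d\<close> are
    disjoint, so members are injective; the condition is convex and concerns each coordinate
    separately, which gives closure under \<open>lin\<close> and \<open>mix\<close>.\<close>
  define B where "B = (\<lambda>i. {c \<in> oddfun n. \<forall>x\<in>?I. cmod (c x - w (real i / N) x) < d / 2})"
  have iN: "real i / N \<in> {0..1}" if "i \<le> N" for i using that N by (simp add: field_simps)
  have "convex_box n (B i)" if i: "i < N" for i
    unfolding convex_box_def
  proof (intro conjI ballI allI subsetI)
    let ?t = "real i / N"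
    fix a assume a: "a \<in> B i"
    show "a \<in> oddconf n"
    proof (rule oddconfI)
      show "a \<in> oddfun n" using a by (simp add: B_def)
      fix x y assume xy: "- int n \<le> x" "x < y" "y \<le> int n"
      show "a x \<noteq> a y"
      proof
        assume eq: "a x = a y"
        have "cmod (a x - w ?t x) < d / 2" "cmod (a y - w ?t y) < d / 2" using a xy by (auto simp: B_def)
        moreover have "w ?t x - w ?t y = (a y - w ?t y) - (a x - w ?t x)" using eq by simp
        ultimately have "cmod (w ?t x - w ?t y) < d"
          using norm_triangle_ineq4[of "a y - w ?t y" "a x - w ?t x"] by simp
        then show False using d[of x y ?t] xy iN[of i] i by auto
      qed
    qed
    fix b assume b: "b \<in> B i"
    show "mix j a b \<in> B i" for j using a b by (auto simp: B_def mix_def oddfun_def)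
    show "lin a b t \<in> B i" if t: "t \<in> {0..1}" for t
    proof -
      have "cmod (lin a b t x - w ?t x) < d / 2" if x: "x \<in> ?I" for x
      proof -
        have "a x \<in> ball (w ?t x) (d / 2)" "b x \<in> ball (w ?t x) (d / 2)"
          using a b x by (auto simp: B_def dist_norm norm_minus_commute)
        then have "(1 - t) *\<^sub>R a x + t *\<^sub>R b x \<in> ball (w ?t x) (d / 2)"
          using t by (intro convexD[OF convex_ball]) auto
        then show ?thesis by (simp add: lin_def dist_norm norm_minus_commute scaleR_conv_of_real)
      qed
      then show ?thesis using a b by (auto simp: B_def oddfun_lin)
    qed
  qed
  moreover have "w t \<in> B i" if i: "i < N" and t: "t \<in> {real i / N..real (Suc i) / N}" for i t
  proof -
    have "\<bar>t - real i / N\<bar> \<le> 1 / N" using t by (auto simp: add_divide_distrib)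
    then have "\<bar>t - real i / N\<bar> \<le> e" using N(2) by linarith
    moreover have t1: "t \<in> {0..1}"
      using t iN[of i] iN[of "Suc i"] i unfolding atLeastAtMost_iff by linarith
    ultimately have "cmod (w t x - w (real i / N) x) < d / 2" if "x \<in> ?I" for x
      using e that iN[of i] i by auto
    then show ?thesis using wo[OF t1] oddconf_oddfun by (auto simp: B_def)
  qed
  ultimately show thesis using that[of N B] N(1) by blast
qed

text \<open>The shear depends on the subdivision, so the boxes are chosen for the original path and
  then carried along by the shear.\<close>

lemma cl_generated:
  assumes w: "bpath n w g"
  shows "cl n w \<in> generate (Br_B n) (gens n)"
proof -
  have wp: "path w" "path_image w \<subseteq> oddconf n" "w 0 = std n" "w 1 = std n \<circ> g" "g \<in> signed_perms n"
    using w by (auto simp: bpath_def)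
  obtain N B where N: "0 < N" and B: "\<forall>i<N. convex_box n (B i)"
    "\<forall>i<N. \<forall>t\<in>{real i / real N..real (Suc i) / real N}. w t \<in> B i"
    by (rule path_boxes[OF wp(1,2)])
  \<comment> \<open>Every coordinate of a mixed configuration already occurs at a subdivision time,
    so one shear generic for this finite set serves all mixtures.\<close>
  let ?P = "\<Union>i\<le>N. w (real i / N) ` {- int n..int n}"
  obtain \<eta> where \<eta>: "inj_on (\<lambda>z. Re (shear \<eta> z)) ?P" by (rule generic_shear[of ?P]) auto
  let ?w = "\<lambda>t. shear \<eta> \<circ> w t"
  have "shear s \<circ> (std n \<circ> g) = std n \<circ> g" for s by (simp add: o_assoc shear_std)
  then have hp: "homotopic_paths (oddconf n) w ?w"
    using wp by (intro homotopic_shear) (auto simp: shear_std)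
  have w': "bpath n ?w g" and c: "cl n ?w = cl n w" using bpath_homotopic[OF w hp] by auto
  define B' where "B' = (\<lambda>i. {c. shear (- \<eta>) \<circ> c \<in> B i})"
  have ss: "shear (- \<eta>) \<circ> (shear \<eta> \<circ> c) = c" for c :: "int \<Rightarrow> complex"
    by (simp add: fun_eq_iff shear_shear)
  have sm: "shear s \<circ> mix j a b = mix j (shear s \<circ> a) (shear s \<circ> b)" for s j a b
    by (auto simp: mix_def fun_eq_iff)
  have "cl n ?w \<in> generate (Br_B n) (gens n)"
  proof (rule generated_if_boxes[OF w' N, of B'])
    fix i assume i: "i < N"
    show "convex_box n (B' i)"
    proof -
      have b: "convex_box n (B i)" using B(1) i by simp
      then have "B' i \<subseteq> oddconf n"
        using shear_oddconf[of "- \<eta>" _ n] unfolding convex_box_def B'_def by blast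
      then show ?thesis using b unfolding convex_box_def B'_def by (simp add: sm shear_lin)
    qed
    show "?w t \<in> B' i" if "t \<in> {real i / N..real (Suc i) / N}" for t
      using B(2) i that by (simp add: B'_def ss)
    fix j y z assume yz: "\<bar>y\<bar> \<le> int n" "\<bar>z\<bar> \<le> int n" "y \<noteq> z"
    let ?a = "w (real i / N)" and ?b = "w (real (Suc i) / N)"
    have "real i / N \<le> real (Suc i) / N" by (simp add: divide_right_mono)
    then have "mix j ?a ?b \<in> B i" using B i by (auto simp: convex_box_def)
    then have "mix j ?a ?b \<in> oddconf n" using B(1) i by (auto simp: convex_box_def)
    then have ne: "mix j ?a ?b y \<noteq> mix j ?a ?b z"
      using yz by (rule oddconf_neq)
    have "mix j ?a ?b x \<in> ?P" if "\<bar>x\<bar> \<le> int n" for x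
    proof (cases "\<bar>x\<bar> \<le> int j")
      case True
      have "?b x \<in> ?P" using i that by (intro UN_I[of "Suc i"] imageI) auto
      then show ?thesis using True by (simp add: mix_def)
    next
      case False
      have "?a x \<in> ?P" using i that by (intro UN_I[of i] imageI) auto
      then show ?thesis using False by (simp add: mix_def)
    qed
    then have "Re (shear \<eta> (mix j ?a ?b y)) \<noteq> Re (shear \<eta> (mix j ?a ?b z))"
      using inj_on_eq_iff[OF \<eta>] ne yz by blast
    then show "Re (mix j (?w (real i / N)) (?w (real (Suc i) / N)) y) \<noteq>
        Re (mix j (?w (real i / N)) (?w (real (Suc i) / N)) z)"
      by (simp flip: sm)
  qed
  then show ?thesis by (simp add: c)
qed

section \<open>Completing partial braids\<close>

lemma arcs_bounded:
  assumes "arc_system m b"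
  obtains L where "0 < L" "\<forall>i\<in>dom b. \<forall>t\<in>{0..1}. cmod (pth b t i) < L"
proof -
  have "eventually (\<lambda>L. \<forall>i\<in>dom b. \<forall>t\<in>{0..1}. cmod (pth b t i) < L) at_top"
  proof (rule eventually_ball_finite, rule finite_subset[OF arc_systemD(1)[OF assms]], simp, rule ballI)
    fix i
    have "continuous_on {0..1} (\<lambda>t. cmod (pth b t i))"
      using arc_systemD(2)[OF assms] by (intro continuous_intros) (simp add: path_fun_iff path_def)
    then obtain t0 where t0: "\<forall>t\<in>{0..1}. cmod (pth b t i) \<le> cmod (pth b t0 i)"
      using continuous_attains_sup[of "{0..1::real}" "\<lambda>t. cmod (pth b t i)"] by auto
    show "eventually (\<lambda>L. \<forall>t\<in>{0..1}. cmod (pth b t i) < L) at_top"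
      by (rule eventually_mono[OF eventually_gt_at_top[of "cmod (pth b t0 i)"]])
        (use t0 le_less_trans in blast)
  qed
  then have "eventually (\<lambda>L. 0 < L \<and> (\<forall>i\<in>dom b. \<forall>t\<in>{0..1}. cmod (pth b t i) < L)) at_top"
    using eventually_gt_at_top[of "0::real"] by eventually_elim auto
  then show thesis using that eventually_happens'[OF trivial_limit_at_top_linorder] by blast
qed

text \<open>The missing strings are lifted to different heights above all strings of \<open>b\<close>, moved there
  to free end points, and lowered again.\<close>

lemma barc_completion:
  assumes b: "barc n b"
  obtains y where "y \<in> Units (IB_B n)"
    "cls (Suc n) b = cls (Suc n) (trivial_arcs (dom b)) \<otimes>\<^bsub>IB_B n\<^esub> y"
proof -
  note as = barc_arc_system[OF b]
  let ?A = "dom b" and ?p = "pth b"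
  have A: "?A \<subseteq> {..n}" "0 \<in> ?A" "endp b 0 = 0" using barc_dom[OF b] b by (auto simp: barc_def)
  have E: "endp b ` ?A \<subseteq> {..n}" using endp(2)[OF as] by fastforce
  \<comment> \<open>There are as many free lower points as missing strings, so the latter can be
    completed by a bijection \<open>f\<close>.\<close>
  have "card ({..n} - ?A) = card ({..n} - endp b ` ?A)"
    using A(1) E card_image[OF inj_on_endp[OF as]] by (simp add: card_Diff_subset finite_subset)
  then obtain f where f: "bij_betw f ({..n} - ?A) ({..n} - endp b ` ?A)"
    using finite_same_card_bij[of "{..n} - ?A" "{..n} - endp b ` ?A"] by auto
  define \<pi> where "\<pi> = (\<lambda>j. if j \<in> ?A then endp b j else f j)"
  have \<pi>: "\<pi> j \<le> n" if "j \<le> n" for j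
    using that E bij_betwE[OF f] by (auto simp: \<pi>_def)
  have f': "f j \<noteq> endp b i" if "j \<le> n" "j \<notin> ?A" "i \<in> ?A" for i j
    using bij_betwE[OF f] that by auto
  have \<pi>i: "\<pi> i \<noteq> \<pi> j" if "i \<le> n" "j \<le> n" "i \<noteq> j" for i j
    using that f'[of i j] f'[of j i] inj_onD[OF inj_on_endp[OF as], of i j]
      inj_onD[OF bij_betw_imp_inj_on[OF f], of i j]
    by (auto simp: \<pi>_def)
  obtain L where L: "0 < L" "\<forall>i\<in>?A. \<forall>t\<in>{0..1}. cmod (?p t i) < L" by (rule arcs_bounded[OF as])
  \<comment> \<open>The bound \<open>L\<close> exceeds all strings of \<open>b\<close>. A missing
    string has index j > 0, because the string 0 is present, so its height L j is at least
    \<open>L\<close> and different for different j. While rising and being lowered, points are told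
    apart by their real parts.\<close>
  define u1 where "u1 = (\<lambda>(t::real) j. if j \<in> ?A then of_nat j else if j \<le> n
    then Complex (real j) (t * L * real j) else 0)"
  define u2 where "u2 = (\<lambda>(t::real) j. if j \<in> ?A then ?p t j else if j \<le> n
    then Complex ((1 - t) * real j + t * real (\<pi> j)) (L * real j) else 0)"
  define u3 where "u3 = (\<lambda>(t::real) j. if j \<in> ?A then of_nat (endp b j) else if j \<le> n
    then Complex (real (\<pi> j)) ((1 - t) * L * real j) else 0)"
  have c: "path u1" "path u2" "path u3"
  proof -
    have "continuous_on {0..1} (\<lambda>t. u1 t j)" "continuous_on {0..1} (\<lambda>t. u2 t j)" "continuous_on {0..1} (\<lambda>t. u3 t j)" for j
      using arc_systemD(2)[OF as] unfolding u1_def u2_def u3_def path_fun_iff path_def Complex_eq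
      by (cases "j \<in> ?A"; cases "j \<le> n"; simp; intro continuous_intros)+
    then show "path u1" "path u2" "path u3" by (auto simp: path_fun_iff path_def)
  qed
  have i1: "path_image u1 \<subseteq> conf {..n}"
  proof -
    have "Re (u1 t j) = real j" if "j \<le> n" for t j using that by (simp add: u1_def)
    then have "inj_on (u1 t) {..n}" for t by (intro inj_onI) (metis atMost_iff of_nat_eq_iff)
    then show ?thesis using A(1) by (auto simp: conf_def path_image_def u1_def)
  qed
  have i3: "path_image u3 \<subseteq> conf {..n}"
  proof -
    have "Re (u3 t j) = real (\<pi> j)" if "j \<le> n" for t j using that by (simp add: u3_def \<pi>_def)
    then have "inj_on (u3 t) {..n}" for t using \<pi>i by (intro inj_onI) (metis atMost_iff of_nat_eq_iff)
    then show ?thesis using A(1) by (auto simp: conf_def path_image_def u3_def)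
  qed
  have i2: "path_image u2 \<subseteq> conf {..n}"
  proof -
    have "u2 t i \<noteq> u2 t j" if t: "t \<in> {0..1}" and ij: "i < j" "j \<le> n" for t i j
    proof -
      have low: "Im (u2 t k) < L" if "k \<in> ?A" for k
      proof -
        have "\<bar>Im (?p t k)\<bar> < L" using L(2) t that abs_Im_le_cmod[of "?p t k"] by (meson le_less_trans)
        then show ?thesis using that by (simp add: u2_def)
      qed
      have high: "Im (u2 t k) = L * real k" "L \<le> L * real k" if "k \<notin> ?A" "k \<le> n" for k
      proof -
        show "Im (u2 t k) = L * real k" using that by (simp add: u2_def)
        have "k \<noteq> 0" using that A(2) by metis
        then show "L \<le> L * real k" using L(1) by simp
      qed
      consider "i \<in> ?A" "j \<in> ?A" | "i \<in> ?A" "j \<notin> ?A" | "i \<notin> ?A" "j \<in> ?A" | "i \<notin> ?A" "j \<notin> ?A" by blast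
      then show ?thesis
      proof cases
        case 1
        then show ?thesis using conf_neq[OF pth_in_conf[OF as t], of i j] ij by (simp add: u2_def)
      next
        case 2
        then show ?thesis using low[of i] high[of j] ij by auto
      next
        case 3
        then show ?thesis using low[of j] high[of i] ij by auto
      next
        case 4
        then have "Im (u2 t i) < Im (u2 t j)" using high[of i] high[of j] ij L(1) by simp
        then show ?thesis by auto
      qed
    qed
    then have "inj_on (u2 t) {..n}" if "t \<in> {0..1}" for t
      using that by (intro linorder_inj_onI) auto
    then show ?thesis using A(1) by (auto simp: conf_def path_image_def u2_def)
  qed
  have m: "u1 1 = u2 0" "u2 1 = u3 0"
    using arc_systemD(4)[OF as] endp(1)[OF as] by (auto simp: u1_def u2_def u3_def fun_eq_iff)
  define u where "u = u1 +++ (u2 +++ u3)"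
  have u: "path u" "path_image u \<subseteq> conf {..n}"
  proof -
    have "pathfinish u2 = pathstart u3" "pathfinish u1 = pathstart (u2 +++ u3)"
      using m by (simp_all add: pathfinish_def pathstart_def joinpaths_def)
    then show "path u" unfolding u_def by (intro path_join_imp c)
    show "path_image u \<subseteq> conf {..n}" unfolding u_def by (intro subset_path_image_join i1 i2 i3)
  qed
  define y where "y = arcs_of {..n} u"
  have u0: "u 0 j = of_nat j" "u 1 j = of_nat (\<pi> j)" if "j \<le> n" for j
    using that by (auto simp: u_def joinpaths_def u1_def u3_def \<pi>_def complex_eq_iff)
  have pu: "pth y t = u t" if "t \<in> {0..1}" for t
  proof -
    have "u t \<in> conf {..n}" using u(2) that by (auto simp: path_image_def)
    then show ?thesis by (auto simp: y_def pth_arcs_of fun_eq_iff conf_def)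
  qed
  have dy: "dom y = {..n}" by (simp add: y_def)
  have "continuous_on {0..1} (pth y)"
    by (rule continuous_on_eq[of _ u]) (use u(1) pu in \<open>auto simp: path_def\<close>)
  then have "arc_system (Suc n) y"
    unfolding arc_system_iff dy using u(2) pu u0 \<pi>
    by (auto simp: path_def path_image_def less_Suc_eq_le)
  moreover have "endp y 0 = 0"
    using u0(2)[of 0] pu[of 1] A by (intro endp_eqI) (auto simp: dy \<pi>_def)
  ultimately have yb: "barc n y" by (simp add: barc_def dy)
  note ay = barc_arc_system[OF yb]
  have "(stack (trivial_arcs ?A) y, y |` ?A) \<in> isotopy_rel (Suc n)"
    using A(1) by (intro stack_trivial_left ay) auto
  also have "(y |` ?A, b) \<in> isotopy_rel (Suc n)"
  proof (rule isotopy_relI)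
    have dr: "dom (y |` ?A) = ?A" using A(1) by (auto simp: dy)
    then show "dom (y |` ?A) = ?A" .
    show "arc_system (Suc n) (y |` ?A)" by (rule arc_system_restrict[OF ay])
    \<comment> \<open>Seen on the strings of \<open>b\<close> alone, the rising and the lowering are
      waiting periods around the motion of \<open>b\<close>.\<close>
    have e1: "pull ?A id \<circ> u1 = (\<lambda>t. pathstart ?p)"
      using arc_systemD(4)[OF as] by (auto simp: fun_eq_iff pull_def u1_def pathstart_def pth_notin)
    have e2: "pull ?A id \<circ> u2 = ?p"
      by (auto simp: fun_eq_iff pull_def u2_def pth_notin)
    have e3: "pull ?A id \<circ> u3 = (\<lambda>t. pathfinish ?p)"
      using endp(1)[OF as] by (auto simp: fun_eq_iff pull_def u3_def pathfinish_def pth_notin)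
    have pb: "path ?p" "path_image ?p \<subseteq> conf ?A" using arc_systemD(2,3)[OF as] by auto
    have "homotopic_paths (conf ?A) (pth (y |` ?A)) (pull ?A id \<circ> u)"
    proof (rule homotopic_paths_eq)
      show "path (pth (y |` ?A))" "path_image (pth (y |` ?A)) \<subseteq> conf ?A"
        using arc_systemD(2,3)[OF arc_system_restrict[OF ay, of ?A]] dr by auto
      have "dom y \<inter> ?A = ?A" using A(1) dy by auto
      then show "pth (y |` ?A) t = (pull ?A id \<circ> u) t" if "t \<in> {0..1}" for t
        using pu[OF that] by (simp add: pth_restrict)
    qed
    also have "pull ?A id \<circ> u = (\<lambda>t. pathstart ?p) +++ (?p +++ (\<lambda>t. pathfinish ?p))"
      unfolding u_def path_compose_join e1 e2 e3 ..
    also have "homotopic_paths (conf ?A) \<dots> ((\<lambda>t. pathstart ?p) +++ ?p)"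
    proof (intro homotopic_paths_join homotopic_paths_const_right pb)
      show "homotopic_paths (conf ?A) (\<lambda>t. pathstart ?p) (\<lambda>t. pathstart ?p)"
        using pb pathstart_in_path_image[of ?p] by (auto simp: path_def path_image_def[of "\<lambda>t. pathstart ?p"])
    qed (simp_all add: pathfinish_def pathstart_def joinpaths_def)
    also have "homotopic_paths (conf ?A) \<dots> ?p"
      by (intro homotopic_paths_const_left pb refl)
    finally show "homotopic_paths (conf (dom (y |` ?A))) (pth (y |` ?A)) ?p" unfolding dr .
  qed
  finally have "cls (Suc n) (stack (trivial_arcs ?A) y) = cls (Suc n) b" by (rule cls_eqI)
  then have "cls (Suc n) b = cls (Suc n) (trivial_arcs ?A) \<otimes>\<^bsub>IB_B n\<^esub> cls (Suc n) y"
    using mult_cls_B[OF barc_trivial[OF A(1,2)] yb] by simp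
  moreover have "cls (Suc n) y \<in> Units (IB_B n)"
    unfolding Units_IB_B using yb dy by blast
  ultimately show thesis using that by blast
qed

section \<open>Uniqueness and surjectivity\<close>

text \<open>For inverses of generators in a target that is only a monoid: the values of
  \<open>h1\<close> and \<open>h2\<close> there are a left and a right inverse of the same element,
  hence equal.\<close>

lemma hom_eq_on_generate:
  assumes "group G" "monoid N" and h: "h1 \<in> hom G N" "h2 \<in> hom G N" "h1 \<one>\<^bsub>G\<^esub> = \<one>\<^bsub>N\<^esub>" "h2 \<one>\<^bsub>G\<^esub> = \<one>\<^bsub>N\<^esub>"
    and H: "H \<subseteq> carrier G" "\<And>x. x \<in> H \<Longrightarrow> h1 x = h2 x" and x: "x \<in> generate G H"
  shows "h1 x = h2 x"
proof -
  interpret G: group G by fact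
  interpret N: monoid N by fact
  show ?thesis
    using x
  proof (induction rule: generate.induct)
    case (inv g)
    have g: "g \<in> carrier G" "inv\<^bsub>G\<^esub> g \<in> carrier G" using inv H(1) by auto
    show ?case
    proof (rule N.inv_unique[of _ "h1 g"])
      show "h1 (inv\<^bsub>G\<^esub> g) \<otimes>\<^bsub>N\<^esub> h1 g = \<one>\<^bsub>N\<^esub>"
        using hom_mult[OF h(1) g(2,1)] g h(3) by simp
      show "h1 g \<otimes>\<^bsub>N\<^esub> h2 (inv\<^bsub>G\<^esub> g) = \<one>\<^bsub>N\<^esub>"
        using hom_mult[OF h(2) g] g h(4) H(2)[OF inv] by simp
    qed (use g h hom_in_carrier in metis)+
  next
    case (eng a b)
    then have "a \<in> carrier G" "b \<in> carrier G" using G.generate_in_carrier[OF H(1)] by auto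
    then show ?case using eng hom_mult[OF h(1)] hom_mult[OF h(2)] by simp
  qed (use h H in auto)
qed

lemma hom_Br_B_eq:
  assumes "1 \<le> n" "h1 \<in> hom (Br_B n) (I_B n)" "h2 \<in> hom (Br_B n) (I_B n)"
    and "h1 \<one>\<^bsub>IB_B n\<^esub> = \<one>\<^bsub>I_B n\<^esub>" "h2 \<one>\<^bsub>IB_B n\<^esub> = \<one>\<^bsub>I_B n\<^esub>"
    and "\<And>i. i \<in> {1..<n} \<Longrightarrow> h1 (sigma n i) = h2 (sigma n i)" "h1 (tau n) = h2 (tau n)"
    and x: "x \<in> Units (IB_B n)"
  shows "h1 x = h2 x"
proof -
  obtain p g where "bpath n p g" "x = cl n p" by (rule Units_eq_cl[OF x])
  then have g: "x \<in> generate (Br_B n) (gens n)" using cl_generated by simp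
  show ?thesis
  proof (rule hom_eq_on_generate[OF group_Br_B monoid_I_B assms(2,3) _ _ gens_in_carrier[OF assms(1)] _ g])
    show "h1 \<one>\<^bsub>Br_B n\<^esub> = \<one>\<^bsub>I_B n\<^esub>" "h2 \<one>\<^bsub>Br_B n\<^esub> = \<one>\<^bsub>I_B n\<^esub>"
      using assms(4,5) by (simp_all only: one_Br_B)
    show "h1 y = h2 y" if "y \<in> gens n" for y
      using that assms(6,7) unfolding gens_def by blast
  qed
qed

text \<open>A trivial partial braid is the product of the \<open>epsilon n i\<close> over its
  missing strings.\<close>

lemma cl_trivial_eq:
  assumes h: "h1 \<in> hom (IB_B n) (I_B n)" "h2 \<in> hom (IB_B n) (I_B n)"
    and one: "h1 \<one>\<^bsub>IB_B n\<^esub> = \<one>\<^bsub>I_B n\<^esub>" "h2 \<one>\<^bsub>IB_B n\<^esub> = \<one>\<^bsub>I_B n\<^esub>"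
    and eps: "\<And>i. i \<in> {1..n} \<Longrightarrow> h1 (epsilon n i) = h2 (epsilon n i)"
    and A: "A \<subseteq> {..n}" "0 \<in> A"
  shows "h1 (cls (Suc n) (trivial_arcs A)) = h2 (cls (Suc n) (trivial_arcs A))"
proof -
  let ?e = "\<lambda>A. cls (Suc n) (trivial_arcs A)"
  have ec: "?e A \<in> carrier (IB_B n)" if "A \<subseteq> {..n}" "0 \<in> A" for A
    using barc_trivial[OF that] by (auto simp: carrier_IB_B)
  have "finite F \<Longrightarrow> F \<subseteq> {1..n} \<Longrightarrow> h1 (?e ({..n} - F)) = h2 (?e ({..n} - F))" for F
  proof (induction rule: finite_induct)
    case empty
    then show ?case using one by (simp add: one_IB_B)
  next
    case (insert i F)
    have a: "{..n} - F \<subseteq> {..n}" "{..n} - {i} \<subseteq> {..n}" "0 \<in> {..n} - F" "0 \<in> {..n} - {i}"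
      using insert.prems by auto
    have "({..n} - F) \<inter> ({..n} - {i}) = {..n} - insert i F" by auto
    then have e: "?e ({..n} - insert i F) = ?e ({..n} - F) \<otimes>\<^bsub>IB_B n\<^esub> epsilon n i"
      using mult_trivial[OF a] by (simp add: epsilon_def flip: cls_def)
    have "epsilon n i \<in> carrier (IB_B n)"
      using ec[OF a(2,4)] by (simp add: epsilon_def flip: cls_def)
    moreover have "i \<in> {1..n}" using insert.prems by simp
    ultimately show ?case
      unfolding e using hom_mult[OF h(1)] hom_mult[OF h(2)] ec[OF a(1,3)] insert eps by simp
  qed
  from this[of "{..n} - A"] A have "h1 (?e ({..n} - ({..n} - A))) = h2 (?e ({..n} - ({..n} - A)))"
    by (force simp: Suc_le_eq)
  moreover have "{..n} - ({..n} - A) = A" using A by auto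
  ultimately show ?thesis by simp
qed

lemma hom_Units:
  assumes "monoid M" "monoid N" "h \<in> hom M N" "h \<one>\<^bsub>M\<^esub> = \<one>\<^bsub>N\<^esub>" "x \<in> Units M"
  shows "h x \<in> Units N"
proof -
  obtain y where "x \<in> carrier M" "y \<in> carrier M" "x \<otimes>\<^bsub>M\<^esub> y = \<one>\<^bsub>M\<^esub>" "y \<otimes>\<^bsub>M\<^esub> x = \<one>\<^bsub>M\<^esub>"
    using assms(5) by (auto simp: Units_def)
  then have "h x \<in> carrier N" "h y \<in> carrier N" "h x \<otimes>\<^bsub>N\<^esub> h y = \<one>\<^bsub>N\<^esub>" "h y \<otimes>\<^bsub>N\<^esub> h x = \<one>\<^bsub>N\<^esub>"
    using hom_in_carrier[OF assms(3)] hom_mult[OF assms(3)] assms(4) by metis+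
  then show ?thesis unfolding Units_def by blast
qed

text \<open>Each point is raised to its own height, moved horizontally and lowered. Distinct real
  parts prevent collisions in the vertical phases, distinct imaginary parts in the horizontal one.
  This gives surjectivity onto the Weyl group.\<close>

lemma bpath_exists:
  assumes g: "g \<in> signed_perms n"
  obtains p where "bpath n p g"
proof -
  define up where "up = (\<lambda>x. if \<bar>x\<bar> \<le> int n then of_int x * \<i> else 0)"
  let ?s = "std n" and ?g = "std n \<circ> g"
  let ?a = "\<lambda>x. ?s x + up x" and ?b = "\<lambda>x. ?g x + up x"
  have so: "?s \<in> oddfun n" "?g \<in> oddfun n"
    using std_in_oddconf[of n] oddconf_comp[OF std_in_oddconf g] oddconf_oddfun by auto
  have uo: "?a \<in> oddfun n" "?b \<in> oddfun n" using so by (auto simp: oddfun_def up_def)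
  have Re_ne: "Re (?s x) \<noteq> Re (?s y)" "Re (?g x) \<noteq> Re (?g y)"
    if "- int n \<le> x" "x < y" "y \<le> int n" for x y
  proof -
    have ne: "Re (?s x) \<noteq> Re (?s y)" if "\<bar>x\<bar> \<le> int n" "\<bar>y\<bar> \<le> int n" "x \<noteq> y" for x y
      using that Re_sroot_less[of x y] Re_sroot_less[of y x] by (cases x y rule: linorder_cases) (auto simp: std_def)
    show "Re (?s x) \<noteq> Re (?s y)" using that by (intro ne) auto
    have "g x \<noteq> g y" using injD[OF signed_permsD(6)[OF g]] that by fastforce
    then show "Re (?g x) \<noteq> Re (?g y)"
      using that signed_permsD(4)[OF g] ne[of "g x" "g y"] by auto
  qed
  have "lin ?s ?a t \<in> oddconf n" for t
  proof (rule oddconfI[OF oddfun_lin[OF so(1) uo(1)]])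
    fix x y assume xy: "- int n \<le> x" "x < y" "y \<le> int n"
    have "Re (lin ?s ?a t z) = Re (?s z)" for z by (simp add: lin_def up_def algebra_simps)
    then show "lin ?s ?a t x \<noteq> lin ?s ?a t y" using Re_ne(1)[OF xy] by metis
  qed
  then have 1: "path_image (lin ?s ?a) \<subseteq> oddconf n" by (auto simp: path_image_def)
  have "lin ?a ?b t \<in> oddconf n" for t
  proof (rule oddconfI[OF oddfun_lin[OF uo]])
    fix x y assume xy: "- int n \<le> x" "x < y" "y \<le> int n"
    have "Im (lin ?a ?b t z) = of_int z" if "\<bar>z\<bar> \<le> int n" for z
      using that by (simp add: lin_def up_def std_def sroot_def algebra_simps)
    then have "Im (lin ?a ?b t x) = of_int x" "Im (lin ?a ?b t y) = of_int y" using xy by auto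
    then show "lin ?a ?b t x \<noteq> lin ?a ?b t y" using xy by auto
  qed
  then have 2: "path_image (lin ?a ?b) \<subseteq> oddconf n" by (auto simp: path_image_def)
  have "lin ?b ?g t \<in> oddconf n" for t
  proof (rule oddconfI[OF oddfun_lin[OF uo(2) so(2)]])
    fix x y assume xy: "- int n \<le> x" "x < y" "y \<le> int n"
    have "Re (lin ?b ?g t z) = Re (?g z)" for z by (simp add: lin_def up_def algebra_simps)
    then show "lin ?b ?g t x \<noteq> lin ?b ?g t y" using Re_ne(2)[OF xy] by metis
  qed
  then have 3: "path_image (lin ?b ?g) \<subseteq> oddconf n" by (auto simp: path_image_def)
  let ?p = "lin ?s ?a +++ (lin ?a ?b +++ lin ?b ?g)"
  have "path ?p" by (intro path_join_imp path_lin) (simp_all add: pathfinish_def pathstart_def joinpaths_def)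
  moreover have "path_image ?p \<subseteq> oddconf n" by (intro subset_path_image_join 1 2 3)
  moreover have "?p 0 = ?s" "?p 1 = ?g" by (simp_all add: joinpaths_def)
  ultimately have "bpath n ?p g" using g by (simp add: bpath_def)
  then show thesis by (rule that)
qed

lemma rho_generators:
  assumes "1 \<le> n"
  shows "\<forall>i\<in>{1..<n}. rho (sigma n i) = sigma_map n i" "rho (tau n) = tau_map n"
proof -
  have "rho (sigma n i) = sigma_map n i" if i: "1 \<le> i" "i < n" for i
  proof -
    have "rho (sigma n i) = smap n (srefl i)"
      using rho_cl[OF bpath_hpath[OF i(2)]] cl_hpath_sigma[OF i] by simp
    also have "\<dots> = sigma_map n i" using i by (auto simp: smap_def sigma_map_def srefl_def fun_eq_iff)
    finally show ?thesis .
  qed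
  then show "\<forall>i\<in>{1..<n}. rho (sigma n i) = sigma_map n i" by simp
  have "rho (tau n) = smap n (srefl 0)"
    using rho_cl[OF bpath_hpath[of 0 n]] cl_hpath_tau[OF assms] assms by simp
  also have "\<dots> = tau_map n" by (auto simp: smap_def tau_map_def srefl_def fun_eq_iff)
  finally show "rho (tau n) = tau_map n" .
qed

theorem theorem2p2:
  fixes n :: nat
  assumes "n \<ge> 1"
  shows "units_of (I_B n) = W_B n \<and>
    (\<exists>\<rho> \<pi>.
       prescribed_action n \<rho> \<and>
       (\<forall>\<rho>'. prescribed_action n \<rho>' \<longrightarrow> (\<forall>x\<in>carrier (IB_B n). \<rho>' x = \<rho> x)) \<and>
       canonical_epi n \<pi> \<and>
       (\<forall>\<pi>'. canonical_epi n \<pi>' \<longrightarrow> (\<forall>x\<in>carrier (Br_B n). \<pi>' x = \<pi> x)) \<and>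
       (\<forall>x\<in>carrier (Br_B n). \<rho> x = \<pi> x))"
\<comment> \<open>The same function witnesses both the action and the canonical epimorphism, so the
  diagram commutes by construction; the content lies in the two characterisations and their
  uniqueness.\<close>
proof (intro conjI exI[of _ rho])
  note gen = rho_generators[OF assms]
  have rhom: "rho \<in> hom (IB_B n) (I_B n)" "rho \<one>\<^bsub>IB_B n\<^esub> = \<one>\<^bsub>I_B n\<^esub>"
    using rho_hom[of n] by (auto simp: inverse_monoid_hom_def)
  have toBr: "h \<in> hom (Br_B n) (I_B n)" if "h \<in> hom (IB_B n) (I_B n)" for h
    using that by (auto simp: hom_def carrier_Br_B mult_Br_B Units_def)
  show "units_of (I_B n) = W_B n" by (rule units_of_I_B)
  show "prescribed_action n rho"
    using rho_hom gen rho_epsilon by (simp add: prescribed_action_def)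
  show "\<forall>\<rho>'. prescribed_action n \<rho>' \<longrightarrow> (\<forall>x\<in>carrier (IB_B n). \<rho>' x = rho x)"
  proof (intro allI impI ballI)
    fix \<rho>' x assume "prescribed_action n \<rho>'" and x: "x \<in> carrier (IB_B n)"
    then have h: "\<rho>' \<in> hom (IB_B n) (I_B n)" "\<rho>' \<one>\<^bsub>IB_B n\<^esub> = \<one>\<^bsub>I_B n\<^esub>"
      and s: "\<And>i. i \<in> {1..<n} \<Longrightarrow> \<rho>' (sigma n i) = rho (sigma n i)" "\<rho>' (tau n) = rho (tau n)"
      and e: "\<And>i. i \<in> {1..n} \<Longrightarrow> \<rho>' (epsilon n i) = rho (epsilon n i)"
      using gen rho_epsilon by (auto simp: prescribed_action_def inverse_monoid_hom_def)
    obtain b where b: "barc n b" "x = cls (Suc n) b" using x by (auto simp: carrier_IB_B)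
    let ?e = "cls (Suc n) (trivial_arcs (dom b))"
    obtain y where y: "y \<in> Units (IB_B n)" "x = ?e \<otimes>\<^bsub>IB_B n\<^esub> y"
      using barc_completion[OF b(1)] unfolding b(2) by blast
    have A: "dom b \<subseteq> {..n}" "0 \<in> dom b" using barc_dom[OF b(1)] b(1) by (auto simp: barc_def)
    have ec: "?e \<in> carrier (IB_B n)" using barc_trivial[OF A] by (auto simp: carrier_IB_B)
    have yc: "y \<in> carrier (IB_B n)" using y(1) by (simp add: Units_def)
    have "\<rho>' ?e = rho ?e" by (rule cl_trivial_eq[OF h(1) rhom(1) h(2) rhom(2) e A])
    moreover have "\<rho>' y = rho y"
      using hom_Br_B_eq[OF assms toBr[OF h(1)] toBr[OF rhom(1)] h(2) rhom(2) s y(1)] .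
    ultimately show "\<rho>' x = rho x"
      unfolding y(2) hom_mult[OF h(1) ec yc] hom_mult[OF rhom(1) ec yc] by simp
  qed
  have carW: "carrier (W_B n) = Units (I_B n)" by (simp flip: units_of_I_B add: units_of_carrier)
  have multW: "mult (W_B n) = mult (I_B n)" "one (W_B n) = one (I_B n)" by (simp_all add: W_B_def)
  show "canonical_epi n rho"
    unfolding canonical_epi_def
  proof (intro conjI gen)
    have "rho \<in> hom (Br_B n) (W_B n)"
    proof (rule homI)
      show "rho x \<in> carrier (W_B n)" if "x \<in> carrier (Br_B n)" for x
        using hom_Units[OF monoid_IB_B monoid_I_B rhom] that by (simp add: carW carrier_Br_B)
      show "rho (x \<otimes>\<^bsub>Br_B n\<^esub> y) = rho x \<otimes>\<^bsub>W_B n\<^esub> rho y"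
        if "x \<in> carrier (Br_B n)" "y \<in> carrier (Br_B n)" for x y
        using hom_mult[OF toBr[OF rhom(1)] that] by (simp only: multW)
    qed
    moreover have "s \<in> rho ` carrier (Br_B n)" if s: "s \<in> carrier (W_B n)" for s
    proof -
      obtain g where g: "g \<in> signed_perms n" "s = smap n g" by (rule W_B_smap[OF s])
      obtain p where p: "bpath n p g" by (rule bpath_exists[OF g(1)])
      show ?thesis
        using rho_cl[OF p] cl_in_Units[OF p] g(2) by (intro image_eqI[of _ _ "cl n p"]) (auto simp: carrier_Br_B)
    qed
    ultimately show "rho \<in> epi (Br_B n) (W_B n)" by (auto simp: epi_iff_subset)
  qed
  show "\<forall>\<pi>'. canonical_epi n \<pi>' \<longrightarrow> (\<forall>x\<in>carrier (Br_B n). \<pi>' x = rho x)"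
  proof (intro allI impI ballI)
    fix \<pi>' x assume pi: "canonical_epi n \<pi>'" and x: "x \<in> carrier (Br_B n)"
    then have h: "\<pi>' \<in> hom (Br_B n) (W_B n)" by (simp add: canonical_epi_def epi_def)
    \<comment> \<open>An epimorphism is only required to respect products; that it preserves the
      unit follows because both sides are groups.\<close>
    have "group (W_B n)" using monoid.units_group[OF monoid_I_B] by (simp add: units_of_I_B)
    then have one: "\<pi>' \<one>\<^bsub>Br_B n\<^esub> = \<one>\<^bsub>W_B n\<^esub>" using h group_Br_B by (intro hom_one)
    have h': "\<pi>' \<in> hom (Br_B n) (I_B n)"
      using h by (simp add: hom_def W_B_def Pi_iff)
    show "\<pi>' x = rho x"
    proof (rule hom_Br_B_eq[OF assms h' toBr[OF rhom(1)] _ rhom(2)])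
      show "\<pi>' \<one>\<^bsub>IB_B n\<^esub> = \<one>\<^bsub>I_B n\<^esub>" using one by (simp only: multW one_Br_B)
      show "\<pi>' (sigma n i) = rho (sigma n i)" if "i \<in> {1..<n}" for i
        using pi gen(1) that by (simp add: canonical_epi_def)
      show "\<pi>' (tau n) = rho (tau n)" using pi gen(2) by (simp add: canonical_epi_def)
      show "x \<in> Units (IB_B n)" using x by (simp only: carrier_Br_B)
    qed
  qed
qed simp

end
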